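(* Let $\{\underline f\}=\{f_1,\dots,f_n\}$ be a set of elements of $A$, and for each $f_i$ fix a compatible system of $p$-power roots of $f_i$ in $A_\infty$. Then $$(f_1,\dots,f_n)\subseteq\tau([\underline f])=\tau([\underline f]^1).$$ In particular, $\mathfrak a\subseteq\tau(\mathfrak a)=\tau(\mathfrak a^1)$ for any ideal $\mathfrak a\subseteq A$.
   Context: Fix a prime $p$. $K^\circ$ denotes the $p$-adic completion of $\mathbb Z_p[p^{1/p^\infty}]$. A $K^\circ$-algebra $S$ is integral perfectoid if it is $p$-adically complete, $p$-torsion free, and Frobenius induces an isomorphism $S/p^{1/p}\to S/p$; by convention every integral perfectoid $S$ is also assumed integrally closed in $S[1/p]$. An element $z$ of a $K^\circ$-module (or a module) is almost zero if it is annihilated by $p^{1/p^k}$ for all $k>0$; "$p^{1/p^\infty}z=0$" means $z$ is almost zero. A compatible system of $p$-power roots of $g$ in $S$ is a sequence $\{g^{1/p^e}\}_{e\ge 0}$ with $g^{1/p^0}=g$ and $(g^{1/p^{e+1}})^p=g^{1/p^e}$. A ring map $A\to S$ with $S$ a $K^\circ$-algebra is almost flat if $\operatorname{Tor}_i^A(M,S)$ is almost zero for all $A$-modules $M$ and $i>0$. $(A,\mathfrak m)$ is a complete regular local ring of mixed characteristic $(0,p)$ and dimension $d$. $A\to A_\infty$ is a fixed map to an integral perfectoid $K^\circ$-algebra such that: (a) every element of $A$ has a compatible system of $p$-power roots in $A_\infty$; (b) $A\to A_\infty$ is almost flat (so it is injective, and nonzero elements of $A$ are nonzerodivisors on $A_\infty$);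 (c) if $M$ is an $A$-module with $M\otimes_AA_\infty$ almost zero, then $M=0$. For an ideal $\mathfrak a\subseteq A$ and real $t\ge0$, let $0^{\diamondsuit\mathfrak a^t}_{H^d_{\mathfrak m}(A)}$ be the set of $\eta\in H^d_{\mathfrak m}(A)$ such that for all $e>0$, all $f\in\mathfrak a^{\lceil tp^e\rceil}$ and all $p^e$-th roots $f^{1/p^e}\in A_\infty$ of $f$ that are part of some compatible system of $p$-power roots of $f$, one has $p^{1/p^\infty}f^{1/p^e}\eta=0$ in $H^d_{\mathfrak m}(A_\infty)$. Put $\tau^\sharp(\mathfrak a^t)=\operatorname{Ann}_A\big(0^{\diamondsuit\mathfrak a^t}_{H^d_{\mathfrak m}(A)}\big)$ and $\tau(\mathfrak a^t)=\sum_{t'>t}\tau^\sharp(\mathfrak a^{t'})=\tau^\sharp(\mathfrak a^{t+\epsilon})$ for $0<\epsilon\ll1$. For elements $f_1,\dots,f_n\in A$ with one fixed compatible system $\{f_i^{1/p^e}\}_e$ for each $i$ (data denoted $[\underline f]=[f_1,\dots,f_n]$), let $0^{\diamondsuit[\underline f]^t}_{H^d_{\mathfrak m}(A)}$ be the set of $\eta\in H^d_{\mathfrak m}(A)$ such that for all $e>0$, $p^{1/p^\infty}g\eta=0$ in $H^d_{\mathfrak m}(A_\infty)$ for every product $g=\prod_{i=1}^af_{j_i}^{1/p^e}$ of the chosen roots (repetitions allowed) with integer $a\ge tp^e$. Put $\tau^\sharp([\underline f]^t)=\operatorname{Ann}_A\big(0^{\diamondsuit[\underline f]^t}_{H^d_{\mathfrak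 m}(A)}\big)$, and $\tau([\underline f]^t)=\tau^\sharp([\underline f]^{t+\epsilon})$ for $0<\epsilon\ll1$. When the exponent is omitted it is $1$. *)

theory Defs
  imports Complex_Main "HOL-Computational_Algebra.Primes" "HOL-Algebra.Module"
    "HOL-Algebra.Ideal_Product" "HOL-Algebra.QuotRing" "HOL-Algebra.IntRing"
    "HOL-Algebra.Ring_Divisibility"
begin

section \<open>Ideals, completions, regular local rings\<close>

abbreviation ideal_pow :: "'a ring \<Rightarrow> 'a set \<Rightarrow> nat \<Rightarrow> 'a set"
  where "ideal_pow R I n \<equiv> I [^]\<^bsub>ideals_set R\<^esub> n"

abbreviation nat_elt :: "'a ring \<Rightarrow> nat \<Rightarrow> 'a"
  where "nat_elt R n \<equiv> [n] \<cdot>\<^bsub>R\<^esub> \<one>\<^bsub>R\<^esub>"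

text \<open>The \<open>I\<close>-adic completion as the inverse limit of the rings \<open>R / I\<^sup>n\<close>. An element is a
  sequence of cosets, and the coset modulo \<open>I\<^sup>n\<^sup>+\<^sup>1\<close> lies over the coset modulo \<open>I\<^sup>n\<close> iff it is
  contained in it.\<close>

definition completion :: "'a ring \<Rightarrow> 'a set \<Rightarrow> (nat \<Rightarrow> 'a set) ring"
  where "completion R I =
    \<lparr>carrier = {u. \<forall>n. u n \<in> carrier (R Quot (ideal_pow R I n)) \<and> u (Suc n) \<subseteq> u n},
     monoid.mult = (\<lambda>u v n. u n \<otimes>\<^bsub>R Quot (ideal_pow R I n)\<^esub> v n),
     monoid.one = (\<lambda>n. \<one>\<^bsub>R Quot (ideal_pow R I n)\<^esub>),
     ring.zero = (\<lambda>n. \<zero>\<^bsub>R Quot (ideal_pow R I n)\<^esub>),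
     ring.add = (\<lambda>u v n. u n \<oplus>\<^bsub>R Quot (ideal_pow R I n)\<^esub> v n)\<rparr>"

definition to_completion :: "'a ring \<Rightarrow> 'a set \<Rightarrow> 'a \<Rightarrow> (nat \<Rightarrow> 'a set)"
  where "to_completion R I a = (\<lambda>n. ideal_pow R I n +>\<^bsub>R\<^esub> a)"

definition adically_complete :: "'a ring \<Rightarrow> 'a set \<Rightarrow> bool"
  where "adically_complete R I \<longleftrightarrow>
    bij_betw (to_completion R I) (carrier R) (carrier (completion R I))"

definition local_ring :: "'a ring \<Rightarrow> 'a set \<Rightarrow> bool"
  where "local_ring R \<mm> \<longleftrightarrow>
    cring R \<and> maximalideal \<mm> R \<and> (\<forall>J. maximalideal J R \<longrightarrow> J = \<mm>)"

definition prime_chain :: "'a ring \<Rightarrow> (nat \<Rightarrow> 'a set) \<Rightarrow> nat \<Rightarrow> bool"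
  where "prime_chain R P n \<longleftrightarrow>
    (\<forall>i\<le>n. primeideal (P i) R) \<and> (\<forall>i<n. P i \<subset> P (Suc i))"

definition has_krull_dim :: "'a ring \<Rightarrow> nat \<Rightarrow> bool"
  where "has_krull_dim R d \<longleftrightarrow>
    (\<exists>P. prime_chain R P d) \<and> (\<forall>n P. prime_chain R P n \<longrightarrow> n \<le> d)"

definition complete_regular_local_ring :: "'a ring \<Rightarrow> 'a set \<Rightarrow> nat \<Rightarrow> bool"
  where "complete_regular_local_ring R \<mm> d \<longleftrightarrow>
    local_ring R \<mm> \<and> noetherian_ring R \<and> has_krull_dim R d \<and>
    (\<exists>x \<in> {..<d} \<rightarrow> carrier R. \<mm> = Idl\<^bsub>R\<^esub> (x ` {..<d})) \<and>
    adically_complete R \<mm>"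

definition has_char :: "'a ring \<Rightarrow> nat \<Rightarrow> bool"
  where "has_char R c \<longleftrightarrow> (\<forall>n::nat. nat_elt R n = \<zero>\<^bsub>R\<^esub> \<longleftrightarrow> c dvd n)"

definition mixed_char :: "nat \<Rightarrow> 'a ring \<Rightarrow> 'a set \<Rightarrow> bool"
  where "mixed_char p R \<mm> \<longleftrightarrow> has_char R 0 \<and> has_char (R Quot \<mm>) p"


section \<open>Modules\<close>

text \<open>A module record extends the ring record; for modules the fields \<open>mult\<close> and \<open>one\<close> carry no
  information.\<close>

definition self_module :: "'a ring \<Rightarrow> ('a, 'a) module"
  where "self_module R =
    \<lparr>carrier = carrier R, monoid.mult = monoid.mult R, monoid.one = \<one>\<^bsub>R\<^esub>,
     ring.zero = \<zero>\<^bsub>R\<^esub>, ring.add = ring.add R,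
     smult = monoid.mult R\<rparr>"

definition fin_supp :: "'a ring \<Rightarrow> 'x set \<Rightarrow> ('x \<Rightarrow> 'a) set"
  where "fin_supp R Y =
    {c. (\<forall>x. c x \<in> carrier R) \<and> (\<forall>x. x \<notin> Y \<longrightarrow> c x = \<zero>\<^bsub>R\<^esub>) \<and> finite {x. c x \<noteq> \<zero>\<^bsub>R\<^esub>}}"

definition delta :: "'a ring \<Rightarrow> 'x \<Rightarrow> 'x \<Rightarrow> 'a"
  where "delta R x = (\<lambda>y. if y = x then \<one>\<^bsub>R\<^esub> else \<zero>\<^bsub>R\<^esub>)"

definition free_module :: "'a ring \<Rightarrow> 'x set \<Rightarrow> ('a, 'x \<Rightarrow> 'a) module"
  where "free_module R Y =
    \<lparr>carrier = fin_supp R Y, monoid.mult = undefined, monoid.one = undefined,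
     ring.zero = (\<lambda>_. \<zero>\<^bsub>R\<^esub>), ring.add = (\<lambda>c c' x. c x \<oplus>\<^bsub>R\<^esub> c' x),
     smult = (\<lambda>r c x. r \<otimes>\<^bsub>R\<^esub> c x)\<rparr>"

definition mod_span :: "'a ring \<Rightarrow> ('a, 'm) module \<Rightarrow> 'm set \<Rightarrow> 'm set"
  where "mod_span R M B = \<Inter>{N. submodule N R M \<and> B \<subseteq> N}"

definition quot_module :: "'a ring \<Rightarrow> ('a, 'm) module \<Rightarrow> 'm set \<Rightarrow> ('a, 'm set) module"
  where "quot_module R M N =
    \<lparr>carrier = a_rcosets\<^bsub>M\<^esub> N, monoid.mult = undefined, monoid.one = undefined,
     ring.zero = N, ring.add = set_add M,
     smult = (\<lambda>r U. \<Union>u\<in>U. N +>\<^bsub>M\<^esub> (r \<odot>\<^bsub>M\<^esub> u))\<rparr>"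

definition module_hom :: "'a ring \<Rightarrow> ('a, 'm) module \<Rightarrow> ('a, 'n) module \<Rightarrow> ('m \<Rightarrow> 'n) set"
  where "module_hom R M N =
    {h \<in> carrier M \<rightarrow> carrier N.
      (\<forall>u\<in>carrier M. \<forall>v\<in>carrier M. h (u \<oplus>\<^bsub>M\<^esub> v) = h u \<oplus>\<^bsub>N\<^esub> h v) \<and>
      (\<forall>r\<in>carrier R. \<forall>u\<in>carrier M. h (r \<odot>\<^bsub>M\<^esub> u) = r \<odot>\<^bsub>N\<^esub> h u)}"

definition is_free :: "'a ring \<Rightarrow> ('a, 'm) module \<Rightarrow> bool"
  where "is_free R M \<longleftrightarrow> (\<exists>B \<subseteq> carrier M. \<forall>u \<in> carrier M.
    \<exists>!c. c \<in> fin_supp R B \<and> u = (\<Oplus>\<^bsub>M\<^esub>b\<in>{b. c b \<noteq> \<zero>\<^bsub>R\<^esub>}. c b \<odot>\<^bsub>M\<^esub> b))"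

text \<open>Localization \<open>M\<^sub>y\<close>: the fraction \<open>m / y\<^sup>k\<close> is the equivalence class of the pair \<open>(m, k)\<close>.
  The fields \<open>mult\<close> and \<open>one\<close> are meaningful when \<open>M\<close> is \<open>self_module R\<close>, in which case
  the result is the ring \<open>R[1/y]\<close>.\<close>

definition frac :: "'a ring \<Rightarrow> ('a, 'm) module \<Rightarrow> 'a \<Rightarrow> 'm \<Rightarrow> nat \<Rightarrow> ('m \<times> nat) set"
  where "frac R M y m k =
    {(m', k'). m' \<in> carrier M \<and>
      (\<exists>l::nat. (y [^]\<^bsub>R\<^esub> l) \<odot>\<^bsub>M\<^esub> ((y [^]\<^bsub>R\<^esub> k') \<odot>\<^bsub>M\<^esub> m) =
                (y [^]\<^bsub>R\<^esub> l) \<odot>\<^bsub>M\<^esub> ((y [^]\<^bsub>R\<^esub> k) \<odot>\<^bsub>M\<^esub> m'))}"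

definition localization :: "'a ring \<Rightarrow> ('a, 'm) module \<Rightarrow> 'a \<Rightarrow> ('a, ('m \<times> nat) set) module"
  where "localization R M y =
    \<lparr>carrier = {frac R M y m k | m k. m \<in> carrier M},
     monoid.mult = (\<lambda>U V. \<Union>(m, k)\<in>U. \<Union>(n, l)\<in>V. frac R M y (m \<otimes>\<^bsub>M\<^esub> n) (k + l)),
     monoid.one = frac R M y \<one>\<^bsub>M\<^esub> 0,
     ring.zero = frac R M y \<zero>\<^bsub>M\<^esub> 0,
     ring.add = (\<lambda>U V. \<Union>(m, k)\<in>U. \<Union>(n, l)\<in>V.
       frac R M y (((y [^]\<^bsub>R\<^esub> l) \<odot>\<^bsub>M\<^esub> m) \<oplus>\<^bsub>M\<^esub> ((y [^]\<^bsub>R\<^esub> k) \<odot>\<^bsub>M\<^esub> n)) (k + l)),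
     smult = (\<lambda>r U. \<Union>(m, k)\<in>U. frac R M y (r \<odot>\<^bsub>M\<^esub> m) k)\<rparr>"


section \<open>The base ring and integral perfectoid algebras\<close>

definition p_ideal :: "nat \<Rightarrow> 'a ring \<Rightarrow> 'a set"
  where "p_ideal p R = PIdl\<^bsub>R\<^esub> (nat_elt R p)"

definition Zp :: "nat \<Rightarrow> (nat \<Rightarrow> int set) ring"
  where "Zp p = completion int_ring (p_ideal p int_ring)"

text \<open>\<open>R[X\<^bsup>1/p\<^sup>\<infinity>\<^esup>]\<close> is the algebra of the additive monoid of nonnegative elements of \<open>\<int>[1/p]\<close>, and
  \<open>R[p\<^bsup>1/p\<^sup>\<infinity>\<^esup>]\<close> is its quotient by \<open>X - p\<close>; the class of \<open>X\<^sup>q\<close> is \<open>p\<^sup>q\<close>.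
  Thus \<open>Kcirc_root p k\<close> below is \<open>p\<^bsup>1/p\<^sup>k\<^esup>\<close>.\<close>

definition p_exponents :: "nat \<Rightarrow> rat set"
  where "p_exponents p = {q. q \<ge> 0 \<and> (\<exists>k::nat. q * of_nat p ^ k \<in> \<int>)}"

definition perfect_poly_ring :: "nat \<Rightarrow> 'a ring \<Rightarrow> (rat \<Rightarrow> 'a) ring"
  where "perfect_poly_ring p R =
    \<lparr>carrier = fin_supp R (p_exponents p),
     monoid.mult = (\<lambda>f g q. \<Oplus>\<^bsub>R\<^esub>ab\<in>{(a, b). f a \<noteq> \<zero>\<^bsub>R\<^esub> \<and> g b \<noteq> \<zero>\<^bsub>R\<^esub> \<and> a + b = q}.
       f (fst ab) \<otimes>\<^bsub>R\<^esub> g (snd ab)),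
     monoid.one = delta R 0,
     ring.zero = (\<lambda>_. \<zero>\<^bsub>R\<^esub>),
     ring.add = (\<lambda>f g q. f q \<oplus>\<^bsub>R\<^esub> g q)\<rparr>"

definition p_root_ideal :: "nat \<Rightarrow> 'a ring \<Rightarrow> (rat \<Rightarrow> 'a) set"
  where "p_root_ideal p R = (let T = perfect_poly_ring p R in
    PIdl\<^bsub>T\<^esub> (delta R 1 \<ominus>\<^bsub>T\<^esub> nat_elt T p))"

definition adjoin_p_roots :: "nat \<Rightarrow> 'a ring \<Rightarrow> (rat \<Rightarrow> 'a) set ring"
  where "adjoin_p_roots p R = perfect_poly_ring p R Quot p_root_ideal p R"

type_synonym Kcirc_elt = "nat \<Rightarrow> (rat \<Rightarrow> nat \<Rightarrow> int set) set set"

definition Kcirc :: "nat \<Rightarrow> Kcirc_elt ring"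
  where "Kcirc p = (let B = adjoin_p_roots p (Zp p) in completion B (p_ideal p B))"

definition Kcirc_root :: "nat \<Rightarrow> nat \<Rightarrow> Kcirc_elt"
  where "Kcirc_root p k =
    (let B = adjoin_p_roots p (Zp p) in
     to_completion B (p_ideal p B)
       (p_root_ideal p (Zp p) +>\<^bsub>perfect_poly_ring p (Zp p)\<^esub>
         delta (Zp p) (1 / of_nat (p ^ k))))"

definition Kcirc_algebra :: "nat \<Rightarrow> 's ring \<Rightarrow> (Kcirc_elt \<Rightarrow> 's) \<Rightarrow> bool"
  where "Kcirc_algebra p S \<kappa> \<longleftrightarrow> cring S \<and> \<kappa> \<in> ring_hom (Kcirc p) S"

definition integrally_closed_in_loc :: "'s ring \<Rightarrow> 's \<Rightarrow> bool"
  where "integrally_closed_in_loc S y \<longleftrightarrow>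
    (let L = localization S (self_module S) y in
     \<forall>z \<in> carrier L.
       (\<exists>n. \<exists>c \<in> {..<n} \<rightarrow> carrier S.
         (z [^]\<^bsub>L\<^esub> (n::nat)) \<oplus>\<^bsub>L\<^esub> (\<Oplus>\<^bsub>L\<^esub>i\<in>{..<n}. c i \<odot>\<^bsub>L\<^esub> (z [^]\<^bsub>L\<^esub> i)) = \<zero>\<^bsub>L\<^esub>)
       \<longrightarrow> (\<exists>s \<in> carrier S. z = frac S (self_module S) y s 0))"

definition integral_perfectoid :: "nat \<Rightarrow> 's ring \<Rightarrow> (Kcirc_elt \<Rightarrow> 's) \<Rightarrow> bool"
  where "integral_perfectoid p S \<kappa> \<longleftrightarrow>
    Kcirc_algebra p S \<kappa> \<and>
    adically_complete S (p_ideal p S) \<and>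
    (\<forall>s\<in>carrier S. nat_elt S p \<otimes>\<^bsub>S\<^esub> s = \<zero>\<^bsub>S\<^esub> \<longrightarrow> s = \<zero>\<^bsub>S\<^esub>) \<and>
    (\<exists>F \<in> ring_iso (S Quot (PIdl\<^bsub>S\<^esub> (\<kappa> (Kcirc_root p 1)))) (S Quot (p_ideal p S)).
      \<forall>s\<in>carrier S. F ((PIdl\<^bsub>S\<^esub> (\<kappa> (Kcirc_root p 1))) +>\<^bsub>S\<^esub> s) = p_ideal p S +>\<^bsub>S\<^esub> (s [^]\<^bsub>S\<^esub> p)) \<and>
    integrally_closed_in_loc S (nat_elt S p)"

definition almost_zero_elt ::
  "nat \<Rightarrow> (Kcirc_elt \<Rightarrow> 's) \<Rightarrow> ('s, 'm) module \<Rightarrow> 'm \<Rightarrow> bool"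
  where "almost_zero_elt p \<kappa> M z \<longleftrightarrow> (\<forall>k>0. \<kappa> (Kcirc_root p k) \<odot>\<^bsub>M\<^esub> z = \<zero>\<^bsub>M\<^esub>)"

definition almost_zero :: "nat \<Rightarrow> (Kcirc_elt \<Rightarrow> 's) \<Rightarrow> ('s, 'm) module \<Rightarrow> bool"
  where "almost_zero p \<kappa> M \<longleftrightarrow> (\<forall>z\<in>carrier M. almost_zero_elt p \<kappa> M z)"

definition compatible_roots :: "nat \<Rightarrow> 's ring \<Rightarrow> 's \<Rightarrow> (nat \<Rightarrow> 's) \<Rightarrow> bool"
  where "compatible_roots p S g \<sigma> \<longleftrightarrow>
    \<sigma> 0 = g \<and> (\<forall>e. \<sigma> e \<in> carrier S \<and> \<sigma> (Suc e) [^]\<^bsub>S\<^esub> p = \<sigma> e)"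


section \<open>Tensor products, Tor and almost flatness\<close>

text \<open>For a ring map \<open>\<phi>\<close> from \<open>A\<close> to \<open>S\<close>, the tensor product of an \<open>A\<close>-module \<open>M\<close> with \<open>S\<close>,
  as an \<open>S\<close>-module, is the free \<open>S\<close>-module on the symbols \<open>m \<otimes> 1\<close> modulo \<open>A\<close>-linearity in \<open>m\<close>.\<close>

definition tensor_rel :: "'a ring \<Rightarrow> 's ring \<Rightarrow> ('a \<Rightarrow> 's) \<Rightarrow> ('a, 'm) module \<Rightarrow> ('m \<Rightarrow> 's) set"
  where "tensor_rel A S \<phi> M = (let F = free_module S (carrier M) in
    mod_span S F
      ({delta S (u \<oplus>\<^bsub>M\<^esub> v) \<ominus>\<^bsub>F\<^esub> (delta S u \<oplus>\<^bsub>F\<^esub> delta S v) | u v. u \<in> carrier M \<and> v \<in> carrier M} \<union>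
       {delta S (a \<odot>\<^bsub>M\<^esub> u) \<ominus>\<^bsub>F\<^esub> (\<phi> a \<odot>\<^bsub>F\<^esub> delta S u) | a u. a \<in> carrier A \<and> u \<in> carrier M}))"

definition tensor :: "'a ring \<Rightarrow> 's ring \<Rightarrow> ('a \<Rightarrow> 's) \<Rightarrow> ('a, 'm) module \<Rightarrow> ('s, ('m \<Rightarrow> 's) set) module"
  where "tensor A S \<phi> M = quot_module S (free_module S (carrier M)) (tensor_rel A S \<phi> M)"

text \<open>The map \<open>h \<otimes> S\<close> from \<open>M \<otimes> S\<close> to \<open>N \<otimes> S\<close>: push coefficients forward along \<open>h\<close>.\<close>

definition push_coeffs :: "'s ring \<Rightarrow> ('m \<Rightarrow> 'n) \<Rightarrow> ('m \<Rightarrow> 's) \<Rightarrow> ('n \<Rightarrow> 's)"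
  where "push_coeffs S h c = (\<lambda>v. \<Oplus>\<^bsub>S\<^esub>u\<in>{u. c u \<noteq> \<zero>\<^bsub>S\<^esub> \<and> h u = v}. c u)"

definition tensor_map ::
  "'a ring \<Rightarrow> 's ring \<Rightarrow> ('a \<Rightarrow> 's) \<Rightarrow> ('a, 'n) module \<Rightarrow> ('m \<Rightarrow> 'n) \<Rightarrow>
    ('m \<Rightarrow> 's) set \<Rightarrow> ('n \<Rightarrow> 's) set"
  where "tensor_map A S \<phi> N h U =
    (\<Union>c\<in>U. tensor_rel A S \<phi> N +>\<^bsub>free_module S (carrier N)\<^esub> push_coeffs S h c)"

definition free_resolution ::
  "'a ring \<Rightarrow> ('a, 'm) module \<Rightarrow> (nat \<Rightarrow> ('a, 'q) module) \<Rightarrow> (nat \<Rightarrow> 'q \<Rightarrow> 'q) \<Rightarrow> ('q \<Rightarrow> 'm) \<Rightarrow> bool"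
  where "free_resolution A M P \<delta> \<epsilon> \<longleftrightarrow>
    (\<forall>n. Module.module A (P n) \<and> is_free A (P n) \<and> \<delta> n \<in> module_hom A (P (Suc n)) (P n)) \<and>
    \<epsilon> \<in> module_hom A (P 0) M \<and>
    \<epsilon> ` carrier (P 0) = carrier M \<and>
    a_kernel (P 0) M \<epsilon> = \<delta> 0 ` carrier (P 1) \<and>
    (\<forall>n. a_kernel (P (Suc n)) (P n) (\<delta> n) = \<delta> (Suc n) ` carrier (P (Suc (Suc n))))"

text \<open>HOL cannot quantify over the \<open>A\<close>-modules of all types, so we fix one universe of modules:
  those with carrier in \<open>(nat \<Rightarrow> 'a) set\<close>, where \<open>'a\<close> is the type of \<open>A\<close>. If \<open>'a\<close> is infinite, then up
  to isomorphism it contains every module of cardinality at most that of this type; in particular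
  it contains all countably generated modules and, by a cardinality count, a free resolution of each
  of its members. Its cyclic members already detect almost flatness, since Tor commutes with filtered
  colimits and is half exact; given almost flatness they also detect almost faithfulness, since every
  nonzero module has a nonzero cyclic submodule.\<close>

type_synonym 'a univ = "(nat \<Rightarrow> 'a) set"

text \<open>Tor is the homology of \<open>P \<otimes> S\<close> for a chosen free resolution \<open>P\<close> of \<open>M\<close> within the universe.\<close>

definition Tor ::
  "'a ring \<Rightarrow> 's ring \<Rightarrow> ('a \<Rightarrow> 's) \<Rightarrow> nat \<Rightarrow> ('a, 'a univ) module \<Rightarrow>
    ('s, ('a univ \<Rightarrow> 's) set set) module"
  where "Tor A S \<phi> i M =
    (let (P, \<delta>) = (SOME (P, \<delta>). \<exists>\<epsilon> :: 'a univ \<Rightarrow> 'a univ. free_resolution A M P \<delta> \<epsilon>);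
         T = (\<lambda>n. tensor A S \<phi> (P n));
         D = (\<lambda>n. tensor_map A S \<phi> (P n) (\<delta> n));
         Z = (case i of 0 \<Rightarrow> carrier (T 0) | Suc j \<Rightarrow> a_kernel (T (Suc j)) (T j) (D j))
     in quot_module S ((T i)\<lparr>carrier := Z\<rparr>) (D i ` carrier (T (Suc i))))"

definition almost_flat ::
  "nat \<Rightarrow> 'a ring \<Rightarrow> 's ring \<Rightarrow> (Kcirc_elt \<Rightarrow> 's) \<Rightarrow> ('a \<Rightarrow> 's) \<Rightarrow> bool"
  where "almost_flat p A S \<kappa> \<phi> \<longleftrightarrow>
    (\<forall>M :: ('a, 'a univ) module. Module.module A M \<longrightarrow>
      (\<forall>i>0. almost_zero p \<kappa> (Tor A S \<phi> i M)))"

definition almost_faithful ::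
  "nat \<Rightarrow> 'a ring \<Rightarrow> 's ring \<Rightarrow> (Kcirc_elt \<Rightarrow> 's) \<Rightarrow> ('a \<Rightarrow> 's) \<Rightarrow> bool"
  where "almost_faithful p A S \<kappa> \<phi> \<longleftrightarrow>
    (\<forall>M :: ('a, 'a univ) module. Module.module A M \<longrightarrow>
      almost_zero p \<kappa> (tensor A S \<phi> M) \<longrightarrow> carrier M = {\<zero>\<^bsub>M\<^esub>})"


section \<open>Top local cohomology\<close>

text \<open>The top local cohomology of \<open>M\<close> with support in \<open>(x\<^sub>0, \<dots>, x\<^sub>d\<^sub>-\<^sub>1)\<close> is the top cohomology of the
  Cech complex, i.e. the localization of \<open>M\<close> at the product \<open>y\<close> of all the \<open>x\<^sub>i\<close> modulo the sum of the
  images of the localizations at the \<open>y\<^sub>i = \<Prod>\<^bsub>j \<noteq> i\<^esub> x\<^sub>j\<close>. The localization map sends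
  \<open>m / y\<^sub>i\<^sup>k\<close> to \<open>x\<^sub>i\<^sup>k m / y\<^sup>k\<close>.\<close>

definition cech_top :: "'a ring \<Rightarrow> ('a, 'm) module \<Rightarrow> nat \<Rightarrow> (nat \<Rightarrow> 'a) \<Rightarrow> ('a, ('m \<times> nat) set) module"
  where "cech_top R M d x = localization R M (finprod R x {..<d})"

definition cech_boundaries :: "'a ring \<Rightarrow> ('a, 'm) module \<Rightarrow> nat \<Rightarrow> (nat \<Rightarrow> 'a) \<Rightarrow> ('m \<times> nat) set set"
  where "cech_boundaries R M d x = mod_span R (cech_top R M d x)
    {frac R M (finprod R x {..<d}) ((x i [^]\<^bsub>R\<^esub> k) \<odot>\<^bsub>M\<^esub> m) k | i m k. i < d \<and> m \<in> carrier M}"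

definition local_coh :: "'a ring \<Rightarrow> ('a, 'm) module \<Rightarrow> nat \<Rightarrow> (nat \<Rightarrow> 'a) \<Rightarrow> ('a, ('m \<times> nat) set set) module"
  where "local_coh R M d x = quot_module R (cech_top R M d x) (cech_boundaries R M d x)"

definition coh_class :: "'a ring \<Rightarrow> ('a, 'm) module \<Rightarrow> nat \<Rightarrow> (nat \<Rightarrow> 'a) \<Rightarrow> 'm \<Rightarrow> nat \<Rightarrow> ('m \<times> nat) set set"
  where "coh_class R M d x m k =
    cech_boundaries R M d x +>\<^bsub>cech_top R M d x\<^esub> frac R M (finprod R x {..<d}) m k"

text \<open>\<open>H\<^sup>d\<^sub>\<mm>(A)\<close> and \<open>H\<^sup>d\<^sub>\<mm>(S)\<close> for generators \<open>x\<^sub>0, \<dots>, x\<^sub>d\<^sub>-\<^sub>1\<close> of \<open>\<mm>\<close>; the latter, computed from the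
  images of the \<open>x\<^sub>i\<close> in \<open>S\<close>, is regarded as an \<open>S\<close>-module. The map between them induced by
  \<open>\<phi>\<close> sends the class of \<open>m / y\<^sup>k\<close> to that of \<open>\<phi>(m) / \<phi>(y)\<^sup>k\<close>.\<close>

definition H_base :: "'a ring \<Rightarrow> nat \<Rightarrow> (nat \<Rightarrow> 'a) \<Rightarrow> ('a, ('a \<times> nat) set set) module"
  where "H_base A d x = local_coh A (self_module A) d x"

definition H_ext :: "'s ring \<Rightarrow> ('a \<Rightarrow> 's) \<Rightarrow> nat \<Rightarrow> (nat \<Rightarrow> 'a) \<Rightarrow> ('s, ('s \<times> nat) set set) module"
  where "H_ext S \<phi> d x = local_coh S (self_module S) d (\<lambda>i. \<phi> (x i))"

definition H_map ::
  "'a ring \<Rightarrow> 's ring \<Rightarrow> ('a \<Rightarrow> 's) \<Rightarrow> nat \<Rightarrow> (nat \<Rightarrow> 'a) \<Rightarrow> ('a \<times> nat) set set \<Rightarrow> ('s \<times> nat) set set"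
  where "H_map A S \<phi> d x \<eta> =
    (THE \<xi>. \<exists>m k. m \<in> carrier A \<and> \<eta> = coh_class A (self_module A) d x m k \<and>
       \<xi> = coh_class S (self_module S) d (\<lambda>i. \<phi> (x i)) (\<phi> m) k)"


section \<open>Test ideals\<close>

definition annihilator :: "'a ring \<Rightarrow> ('a, 'm) module \<Rightarrow> 'm set \<Rightarrow> 'a set"
  where "annihilator A M N = {a \<in> carrier A. \<forall>\<eta>\<in>N. a \<odot>\<^bsub>M\<^esub> \<eta> = \<zero>\<^bsub>M\<^esub>}"

text \<open>\<open>p\<^bsup>1/p\<^sup>\<infinity>\<^esup> g \<eta> = 0\<close> in \<open>H\<^sup>d\<^sub>\<mm>(S)\<close>, for \<open>g \<in> S\<close> and \<open>\<eta> \<in> H\<^sup>d\<^sub>\<mm>(A)\<close>.\<close>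

definition almost_kills ::
  "nat \<Rightarrow> 'a ring \<Rightarrow> 's ring \<Rightarrow> (Kcirc_elt \<Rightarrow> 's) \<Rightarrow> ('a \<Rightarrow> 's) \<Rightarrow> nat \<Rightarrow> (nat \<Rightarrow> 'a) \<Rightarrow>
    's \<Rightarrow> ('a \<times> nat) set set \<Rightarrow> bool"
  where "almost_kills p A S \<kappa> \<phi> d x g \<eta> \<longleftrightarrow>
    almost_zero_elt p \<kappa> (H_ext S \<phi> d x) (g \<odot>\<^bsub>H_ext S \<phi> d x\<^esub> H_map A S \<phi> d x \<eta>)"

definition zero_diamond ::
  "nat \<Rightarrow> 'a ring \<Rightarrow> 's ring \<Rightarrow> (Kcirc_elt \<Rightarrow> 's) \<Rightarrow> ('a \<Rightarrow> 's) \<Rightarrow> nat \<Rightarrow> (nat \<Rightarrow> 'a) \<Rightarrow>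
    'a set \<Rightarrow> real \<Rightarrow> ('a \<times> nat) set set set"
  where "zero_diamond p A S \<kappa> \<phi> d x \<aa> t =
    {\<eta> \<in> carrier (H_base A d x).
      \<forall>e>0. \<forall>f \<in> ideal_pow A \<aa> (nat \<lceil>t * real p ^ e\<rceil>). \<forall>\<sigma>.
        compatible_roots p S (\<phi> f) \<sigma> \<longrightarrow> almost_kills p A S \<kappa> \<phi> d x (\<sigma> e) \<eta>}"

definition tau_sharp ::
  "nat \<Rightarrow> 'a ring \<Rightarrow> 's ring \<Rightarrow> (Kcirc_elt \<Rightarrow> 's) \<Rightarrow> ('a \<Rightarrow> 's) \<Rightarrow> nat \<Rightarrow> (nat \<Rightarrow> 'a) \<Rightarrow>
    'a set \<Rightarrow> real \<Rightarrow> 'a set"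
  where "tau_sharp p A S \<kappa> \<phi> d x \<aa> t =
    annihilator A (H_base A d x) (zero_diamond p A S \<kappa> \<phi> d x \<aa> t)"

definition tau ::
  "nat \<Rightarrow> 'a ring \<Rightarrow> 's ring \<Rightarrow> (Kcirc_elt \<Rightarrow> 's) \<Rightarrow> ('a \<Rightarrow> 's) \<Rightarrow> nat \<Rightarrow> (nat \<Rightarrow> 'a) \<Rightarrow>
    'a set \<Rightarrow> real \<Rightarrow> 'a set"
  where "tau p A S \<kappa> \<phi> d x \<aa> t = Idl\<^bsub>A\<^esub> (\<Union>t'\<in>{t<..}. tau_sharp p A S \<kappa> \<phi> d x \<aa> t')"

text \<open>The bracketed versions depend on \<open>n\<close> compatible systems of roots, \<open>r i e\<close> being the chosen
  \<open>p\<^sup>e\<close>-th root of the \<open>i\<close>-th element.\<close>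

definition zero_diamond_br ::
  "nat \<Rightarrow> 'a ring \<Rightarrow> 's ring \<Rightarrow> (Kcirc_elt \<Rightarrow> 's) \<Rightarrow> ('a \<Rightarrow> 's) \<Rightarrow> nat \<Rightarrow> (nat \<Rightarrow> 'a) \<Rightarrow>
    nat \<Rightarrow> (nat \<Rightarrow> nat \<Rightarrow> 's) \<Rightarrow> real \<Rightarrow> ('a \<times> nat) set set set"
  where "zero_diamond_br p A S \<kappa> \<phi> d x n r t =
    {\<eta> \<in> carrier (H_base A d x).
      \<forall>e>0. \<forall>a. real a \<ge> t * real p ^ e \<longrightarrow> (\<forall>j \<in> {..<a} \<rightarrow> {..<n}.
        almost_kills p A S \<kappa> \<phi> d x (\<Otimes>\<^bsub>S\<^esub>i\<in>{..<a}. r (j i) e) \<eta>)}"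

definition tau_sharp_br ::
  "nat \<Rightarrow> 'a ring \<Rightarrow> 's ring \<Rightarrow> (Kcirc_elt \<Rightarrow> 's) \<Rightarrow> ('a \<Rightarrow> 's) \<Rightarrow> nat \<Rightarrow> (nat \<Rightarrow> 'a) \<Rightarrow>
    nat \<Rightarrow> (nat \<Rightarrow> nat \<Rightarrow> 's) \<Rightarrow> real \<Rightarrow> 'a set"
  where "tau_sharp_br p A S \<kappa> \<phi> d x n r t =
    annihilator A (H_base A d x) (zero_diamond_br p A S \<kappa> \<phi> d x n r t)"

text \<open>The common value of \<open>tau_sharp_br\<close> at \<open>t + \<epsilon>\<close> for \<open>0 < \<epsilon> \<lless> 1\<close>. It exists for noetherian \<open>A\<close>,
  because these ideals grow as \<open>\<epsilon>\<close> decreases.\<close>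

definition tau_br ::
  "nat \<Rightarrow> 'a ring \<Rightarrow> 's ring \<Rightarrow> (Kcirc_elt \<Rightarrow> 's) \<Rightarrow> ('a \<Rightarrow> 's) \<Rightarrow> nat \<Rightarrow> (nat \<Rightarrow> 'a) \<Rightarrow>
    nat \<Rightarrow> (nat \<Rightarrow> nat \<Rightarrow> 's) \<Rightarrow> real \<Rightarrow> 'a set"
  where "tau_br p A S \<kappa> \<phi> d x n r t =
    (THE I. eventually (\<lambda>\<epsilon>. tau_sharp_br p A S \<kappa> \<phi> d x n r (t + \<epsilon>) = I) (at_right 0))"

end

theory Submission
  imports Defs "HOL-Algebra.Free_Abelian_Groups" "HOL-Library.Equipollence"
begin

text \<open>Let \<open>f \<noteq> 0\<close> be in \<open>A\<close>. As \<open>p f \<noteq> 0\<close> and \<open>A\<close> is separated, \<open>p f \<notin> \<mm>\<^bsup>q\<^esup>\<close> for some \<open>q = p\<^sup>e\<close>, and \<open>f\<close> lies in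
  the test ideal with exponent \<open>1 + 1/q\<close>. Indeed, let \<open>\<eta>\<close> be killed almost by \<open>f\<^bsup>1 + 1/q\<^esup>\<close> and suppose
  \<open>f \<eta> \<noteq> 0\<close>. Writing \<open>\<eta>\<close> as a fraction \<open>m / y\<^sup>k\<close>, some multiple \<open>u = y\<^sup>l f m\<close> and the ideal \<open>I\<close> of the
  \<open>x\<^sub>i\<^bsup>k+l\<^esup>\<close> satisfy \<open>u \<notin> I\<close>, while \<open>f\<^bsup>1/q\<^esup> u\<close> lies in \<open>I S\<close> up to a small power of \<open>p\<close>. By almost
  flatness \<open>f\<^bsup>1/q\<^esup>\<close> lies in \<open>(I : u) S\<close>, hence in \<open>\<mm> S\<close>, up to a small power of \<open>p\<close>. The \<open>q\<close>-th power of
  this relation is \<open>p f \<in> \<mm>\<^bsup>q\<^esup> S\<close>, which almost faithfulness turns into \<open>p f \<in> \<mm>\<^bsup>q\<^esup>\<close>, a contradiction.\<close>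

section \<open>Linear combinations and free modules\<close>

text \<open>The exponent \<open>e\<close> has to be fixed by \<open>f\<close> alone, before any
  class is considered; this is why it comes from separatedness of \<open>A\<close> and not from
  \<eta>. The factor \<open>p\<close> in \<open>p f\<close> pays for the almost mathematics: the
  root of index \<open>e + 1\<close> is lost once to almost vanishing and once to almost flatness,
  and the \<open>q\<close>-th power of these two losses is \<open>p^(2/p)\<close>, which divides
  \<open>p\<close> because \<open>p >= 2\<close>. The exponent \<open>1 + 1/q\<close> splits off a
  full factor \<open>f\<close>, which is absorbed into \<open>u\<close>, so that only the root
  itself is left in the colon relation. That \<open>p f\<close> is nonzero is read off in
  \<open>S\<close>, into which \<open>A\<close> injects and where \<open>p\<close> is a
  nonzerodivisor. The main obstacle is Tor. It is formed from an arbitrarily chosen resolution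
  inside a fixed universe of modules, so nothing may be assumed of the resolution beyond freeness
  and exactness. Constructing one resolution of each cyclic module makes the choice meaningful; the
  colon statement then has to extract its relation from whichever resolution was chosen.\<close>

definition lin_comb :: "'a ring \<Rightarrow> ('a, 'm) module \<Rightarrow> ('x \<Rightarrow> 'm) \<Rightarrow> ('x \<Rightarrow> 'a) \<Rightarrow> 'm"
  where "lin_comb R M w c = (\<Oplus>\<^bsub>M\<^esub>x\<in>{x. c x \<noteq> \<zero>\<^bsub>R\<^esub>}. c x \<odot>\<^bsub>M\<^esub> w x)"

text \<open>Fixes \<open>R\<close> and \<open>M\<close> at plain record types. The library locale
  leaves record extensions open, while \<open>fin_supp\<close>, \<open>mod_span\<close> and the
  other constants take exactly \<open>'a ring\<close> and \<open>('a, 'm) module\<close>.\<close>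

locale rmodule = module R M for R :: "'a ring" (structure) and M :: "('a, 'm) module" (structure)

lemma rmoduleI: "Module.module R M \<Longrightarrow> rmodule R M"
  by (simp add: rmodule_def)

lemma (in rmodule) is_module: "Module.module R M"
  by (rule module_axioms)

lemma fin_suppI:
  assumes "\<And>x. c x \<in> carrier R" "\<And>x. x \<notin> Y \<Longrightarrow> c x = \<zero>\<^bsub>R\<^esub>" "finite {x. c x \<noteq> \<zero>\<^bsub>R\<^esub>}"
  shows "c \<in> fin_supp R Y"
  using assms by (auto simp: fin_supp_def)

lemma fin_suppD:
  assumes "c \<in> fin_supp R Y"
  shows "c x \<in> carrier R" "x \<notin> Y \<Longrightarrow> c x = \<zero>\<^bsub>R\<^esub>" "finite {x. c x \<noteq> \<zero>\<^bsub>R\<^esub>}" "{x. c x \<noteq> \<zero>\<^bsub>R\<^esub>} \<subseteq> Y"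
  using assms by (auto simp: fin_supp_def)

lemma free_module_simps [simp]:
  "carrier (free_module R Y) = fin_supp R Y"
  "\<zero>\<^bsub>free_module R Y\<^esub> = (\<lambda>_. \<zero>\<^bsub>R\<^esub>)"
  "c \<oplus>\<^bsub>free_module R Y\<^esub> c' = (\<lambda>x. c x \<oplus>\<^bsub>R\<^esub> c' x)"
  "r \<odot>\<^bsub>free_module R Y\<^esub> c = (\<lambda>x. r \<otimes>\<^bsub>R\<^esub> c x)"
  by (simp_all add: free_module_def)

lemma self_module_simps [simp]:
  "carrier (self_module R) = carrier R"
  "monoid.mult (self_module R) = monoid.mult R"
  "\<one>\<^bsub>self_module R\<^esub> = \<one>\<^bsub>R\<^esub>"
  "\<zero>\<^bsub>self_module R\<^esub> = \<zero>\<^bsub>R\<^esub>"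
  "ring.add (self_module R) = ring.add R"
  "smult (self_module R) = monoid.mult R"
  by (simp_all add: self_module_def)

lemma delta_fin_supp: "cring R \<Longrightarrow> x \<in> Y \<Longrightarrow> delta R x \<in> fin_supp R Y"
  by (rule fin_suppI) (auto simp: delta_def cring_def ring.ring_simprules intro!: finite_subset[of _ "{x}"])

lemma fin_supp_zero: "cring R \<Longrightarrow> (\<lambda>_. \<zero>\<^bsub>R\<^esub>) \<in> fin_supp R Y"
  by (rule fin_suppI) (auto simp: cring_def ring.ring_simprules)

lemma fin_supp_add:
  assumes "cring R" "c \<in> fin_supp R Y" "c' \<in> fin_supp R Y"
  shows "(\<lambda>x. c x \<oplus>\<^bsub>R\<^esub> c' x) \<in> fin_supp R Y"
proof -
  interpret cring R by fact
  show ?thesis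
    using fin_suppD[OF assms(2)] fin_suppD[OF assms(3)]
    by (intro fin_suppI) (auto intro!: finite_subset[of _ "{x. c x \<noteq> \<zero>\<^bsub>R\<^esub>} \<union> {x. c' x \<noteq> \<zero>\<^bsub>R\<^esub>}"])
qed

lemma fin_supp_smult:
  assumes "cring R" "c \<in> fin_supp R Y" "r \<in> carrier R"
  shows "(\<lambda>x. r \<otimes>\<^bsub>R\<^esub> c x) \<in> fin_supp R Y"
proof -
  interpret cring R by fact
  show ?thesis
    using fin_suppD[OF assms(2)] assms(3)
    by (intro fin_suppI) (auto intro!: finite_subset[of _ "{x. c x \<noteq> \<zero>\<^bsub>R\<^esub>}"])
qed

lemma free_module_module:
  assumes "cring R"
  shows "Module.module R (free_module R Y)"
proof -
  interpret cring R by fact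
  have minus: "(\<lambda>x. \<ominus>\<^bsub>R\<^esub> c x) \<in> fin_supp R Y" if "c \<in> fin_supp R Y" for c
    using fin_suppD[OF that]
    by (intro fin_suppI) (auto intro!: finite_subset[of _ "{x. c x \<noteq> \<zero>\<^bsub>R\<^esub>}"])
  note car = fin_suppD(1)
  show ?thesis
  proof (rule moduleI)
    show "cring R" by fact
    show "abelian_group (free_module R Y)"
    proof (rule abelian_groupI)
      show "\<exists>y\<in>carrier (free_module R Y). y \<oplus>\<^bsub>free_module R Y\<^esub> c = \<zero>\<^bsub>free_module R Y\<^esub>"
        if "c \<in> carrier (free_module R Y)" for c
        using that minus[of c] car[of c] by (intro bexI[of _ "\<lambda>x. \<ominus>\<^bsub>R\<^esub> c x"]) (auto simp: l_neg)
    qed (use assms in \<open>auto simp: fin_supp_zero fin_supp_add a_ac car\<close>)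
  qed (use assms in \<open>auto simp: fin_supp_smult l_distr r_distr m_assoc car\<close>)
qed

lemma self_module_module:
  assumes "cring R"
  shows "Module.module R (self_module R)"
proof -
  interpret cring R by fact
  show ?thesis
  proof (rule moduleI)
    show "abelian_group (self_module R)"
      by (rule abelian_groupI) (auto simp: a_ac intro: l_neg)
  qed (auto simp: l_distr r_distr m_assoc assms)
qed

lemma self_module_a_inv: "a_inv (self_module R) x = a_inv R x"
  by (simp add: a_inv_def m_inv_def)

context rmodule
begin

text \<open>The sum runs over the exact support of \<open>c\<close>, which changes under addition
  and scaling; a common larger index set makes such sums comparable.\<close>

lemma lin_comb_superset:
  assumes c: "c \<in> fin_supp R Y" and w: "w \<in> Y \<rightarrow> carrier M"
    and X: "finite X" "{x. c x \<noteq> \<zero>} \<subseteq> X" "X \<subseteq> Y"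
  shows "lin_comb R M w c = (\<Oplus>\<^bsub>M\<^esub>x\<in>X. c x \<odot>\<^bsub>M\<^esub> w x)"
  unfolding lin_comb_def
proof (rule M.add.finprod_mono_neutral_cong_left)
  show "c i \<odot>\<^bsub>M\<^esub> w i = \<zero>\<^bsub>M\<^esub>" if "i \<in> X - {x. c x \<noteq> \<zero>}" for i
    using that X w by (auto simp: Pi_iff subset_iff)
qed (use X w fin_suppD(1)[OF c] in \<open>auto simp: Pi_iff\<close>)

lemma lin_comb_closed:
  assumes c: "c \<in> fin_supp R Y" and w: "w \<in> Y \<rightarrow> carrier M"
  shows "lin_comb R M w c \<in> carrier M"
  unfolding lin_comb_def
  using fin_suppD[OF c] w by (intro M.finsum_closed) (auto simp: Pi_iff)

lemma lin_comb_add: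
  assumes c: "c \<in> fin_supp R Y" "c' \<in> fin_supp R Y" and w: "w \<in> Y \<rightarrow> carrier M"
  shows "lin_comb R M w (\<lambda>x. c x \<oplus> c' x) = lin_comb R M w c \<oplus>\<^bsub>M\<^esub> lin_comb R M w c'"
proof -
  let ?X = "{x. c x \<noteq> \<zero>} \<union> {x. c' x \<noteq> \<zero>}"
  have X: "finite ?X" "?X \<subseteq> Y" using fin_suppD[OF c(1)] fin_suppD[OF c(2)] by auto
  note carr = fin_suppD(1)[OF c(1)] fin_suppD(1)[OF c(2)]
  have s: "{x. c x \<oplus> c' x \<noteq> \<zero>} \<subseteq> ?X" by auto
  have "lin_comb R M w (\<lambda>x. c x \<oplus> c' x) = (\<Oplus>\<^bsub>M\<^esub>x\<in>?X. (c x \<oplus> c' x) \<odot>\<^bsub>M\<^esub> w x)"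
    by (rule lin_comb_superset[OF fin_supp_add[OF R.is_cring c] w X(1) s X(2)])
  also have "\<dots> = (\<Oplus>\<^bsub>M\<^esub>x\<in>?X. c x \<odot>\<^bsub>M\<^esub> w x \<oplus>\<^bsub>M\<^esub> c' x \<odot>\<^bsub>M\<^esub> w x)"
    using X(2) w carr by (intro M.finsum_cong') (auto simp: smult_l_distr Pi_iff subset_iff)
  also have "\<dots> = (\<Oplus>\<^bsub>M\<^esub>x\<in>?X. c x \<odot>\<^bsub>M\<^esub> w x) \<oplus>\<^bsub>M\<^esub> (\<Oplus>\<^bsub>M\<^esub>x\<in>?X. c' x \<odot>\<^bsub>M\<^esub> w x)"
    using X(2) w carr by (intro M.finsum_addf) (auto simp: Pi_iff subset_iff)
  also have "\<dots> = lin_comb R M w c \<oplus>\<^bsub>M\<^esub> lin_comb R M w c'"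
    using lin_comb_superset[OF c(1) w X(1) _ X(2)] lin_comb_superset[OF c(2) w X(1) _ X(2)] by simp
  finally show ?thesis .
qed

lemma lin_comb_smult:
  assumes c: "c \<in> fin_supp R Y" and w: "w \<in> Y \<rightarrow> carrier M" and r: "r \<in> carrier R"
  shows "lin_comb R M w (\<lambda>x. r \<otimes> c x) = r \<odot>\<^bsub>M\<^esub> lin_comb R M w c"
proof -
  let ?X = "{x. c x \<noteq> \<zero>}"
  have X: "finite ?X" "?X \<subseteq> Y" using fin_suppD[OF c] by auto
  note carr = fin_suppD(1)[OF c]
  have s: "{x. r \<otimes> c x \<noteq> \<zero>} \<subseteq> ?X" using r by auto
  have "lin_comb R M w (\<lambda>x. r \<otimes> c x) = (\<Oplus>\<^bsub>M\<^esub>x\<in>?X. (r \<otimes> c x) \<odot>\<^bsub>M\<^esub> w x)"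
    by (rule lin_comb_superset[OF fin_supp_smult[OF R.is_cring c r] w X(1) s X(2)])
  also have "\<dots> = (\<Oplus>\<^bsub>M\<^esub>x\<in>?X. r \<odot>\<^bsub>M\<^esub> (c x \<odot>\<^bsub>M\<^esub> w x))"
    using X(2) w carr r by (intro M.finsum_cong') (auto simp: smult_assoc1 Pi_iff subset_iff)
  also have "\<dots> = r \<odot>\<^bsub>M\<^esub> (\<Oplus>\<^bsub>M\<^esub>x\<in>?X. c x \<odot>\<^bsub>M\<^esub> w x)"
    using X w carr r by (intro finsum_smult_ldistr[symmetric]) (auto simp: Pi_iff subset_iff)
  finally show ?thesis by (simp add: lin_comb_def)
qed

lemma lin_comb_delta:
  assumes x: "x \<in> Y" and w: "w \<in> Y \<rightarrow> carrier M"
  shows "lin_comb R M w (delta R x) = w x"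
proof -
  have "lin_comb R M w (delta R x) = (\<Oplus>\<^bsub>M\<^esub>y\<in>{x}. delta R x y \<odot>\<^bsub>M\<^esub> w y)"
    using x by (intro lin_comb_superset[OF delta_fin_supp[OF R.is_cring x] w]) (auto simp: delta_def)
  also have "\<dots> = w x" using x w by (auto simp: delta_def Pi_iff)
  finally show ?thesis .
qed

lemma lin_comb_hom:
  assumes "w \<in> Y \<rightarrow> carrier M"
  shows "lin_comb R M w \<in> module_hom R (free_module R Y) M"
  using assms by (auto simp: module_hom_def lin_comb_closed lin_comb_add lin_comb_smult)

lemma lin_comb_in_submodule:
  assumes N: "submodule N R M" and c: "c \<in> fin_supp R Y" and w: "w \<in> Y \<rightarrow> N"
  shows "lin_comb R M w c \<in> N"
proof -
  note NE = submoduleE[OF N]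
  have 0: "\<zero>\<^bsub>M\<^esub> \<in> N" using NE by (metis M.r_neg all_not_in_conv subsetD)
  have "(\<Oplus>\<^bsub>M\<^esub>x\<in>X. c x \<odot>\<^bsub>M\<^esub> w x) \<in> N" if "finite X" "X \<subseteq> Y" for X
    using that
  proof (induct X rule: finite_induct)
    case (insert x X)
    have "(\<Oplus>\<^bsub>M\<^esub>x\<in>insert x X. c x \<odot>\<^bsub>M\<^esub> w x) = c x \<odot>\<^bsub>M\<^esub> w x \<oplus>\<^bsub>M\<^esub> (\<Oplus>\<^bsub>M\<^esub>x\<in>X. c x \<odot>\<^bsub>M\<^esub> w x)"
      using insert w NE(1) fin_suppD(1)[OF c] by (intro M.finsum_insert) (auto simp: Pi_iff subset_iff)
    then show ?case using insert w NE(4,5) fin_suppD(1)[OF c] by (auto simp: Pi_iff)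
  qed (simp add: 0)
  from this[OF fin_suppD(3,4)[OF c]] show ?thesis unfolding lin_comb_def .
qed

lemma mod_span_submodule:
  assumes "B \<subseteq> carrier M"
  shows "submodule (mod_span R M B) R M"
proof (rule submoduleI)
  show "mod_span R M B \<subseteq> carrier M"
    using carrier_is_submodule assms by (auto simp: mod_span_def)
  show "\<zero>\<^bsub>M\<^esub> \<in> mod_span R M B"
    by (auto simp: mod_span_def intro: subgroup.one_closed[of _ "add_monoid M", simplified] submodule.axioms(1))
qed (auto simp: mod_span_def dest: submoduleE)

lemma mod_span_incl: "B \<subseteq> mod_span R M B"
  by (auto simp: mod_span_def)

lemma mod_span_minimal: "submodule N R M \<Longrightarrow> B \<subseteq> N \<Longrightarrow> mod_span R M B \<subseteq> N"
  by (auto simp: mod_span_def)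

lemma submodule_zero: "submodule N R M \<Longrightarrow> \<zero>\<^bsub>M\<^esub> \<in> N"
  by (auto intro: subgroup.one_closed[of _ "add_monoid M", simplified] submodule.axioms(1))

lemma submodule_abelian_subgroup:
  assumes "submodule N R M"
  shows "abelian_subgroup N M"
  by (rule abelian_subgroupI3)
    (auto intro: additive_subgroup.intro submodule.axioms(1)[OF assms] M.abelian_group_axioms)

end

lemma module_homD:
  assumes "h \<in> module_hom R M N"
  shows "u \<in> carrier M \<Longrightarrow> h u \<in> carrier N"
    "u \<in> carrier M \<Longrightarrow> v \<in> carrier M \<Longrightarrow> h (u \<oplus>\<^bsub>M\<^esub> v) = h u \<oplus>\<^bsub>N\<^esub> h v"
    "r \<in> carrier R \<Longrightarrow> u \<in> carrier M \<Longrightarrow> h (r \<odot>\<^bsub>M\<^esub> u) = r \<odot>\<^bsub>N\<^esub> h u"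
  using assms by (auto simp: module_hom_def)

lemma module_hom_zero:
  assumes "Module.module R M" "Module.module R N" "h \<in> module_hom R M N"
  shows "h \<zero>\<^bsub>M\<^esub> = \<zero>\<^bsub>N\<^esub>"
proof -
  interpret M: Module.module R M by fact
  interpret N: Module.module R N by fact
  show ?thesis using module_homD[OF assms(3)]
    by (metis M.R.zero_closed M.M.zero_closed M.smult_r_null N.smult_l_null)
qed

lemma module_hom_minus:
  assumes "Module.module R M" "Module.module R N" "h \<in> module_hom R M N" "u \<in> carrier M"
  shows "h (\<ominus>\<^bsub>M\<^esub> u) = \<ominus>\<^bsub>N\<^esub> (h u)"
proof -
  interpret M: Module.module R M by fact
  interpret N: Module.module R N by fact
  show ?thesis using module_homD[OF assms(3)] module_hom_zero[OF assms(1-3)] assms(4)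
    by (metis M.M.a_inv_closed M.M.l_neg N.M.minus_equality)
qed

lemma module_hom_diff:
  assumes "Module.module R M" "Module.module R N" "h \<in> module_hom R M N" "u \<in> carrier M" "v \<in> carrier M"
  shows "h (u \<ominus>\<^bsub>M\<^esub> v) = h u \<ominus>\<^bsub>N\<^esub> h v"
proof -
  interpret M: Module.module R M by fact
  show ?thesis using module_homD(2)[OF assms(3)] module_hom_minus[OF assms(1-3)] assms(4-5)
    by (simp add: a_minus_def)
qed

lemma submodule_vimage:
  assumes "Module.module R M" "Module.module R N" "h \<in> module_hom R M N" "submodule K R N"
  shows "submodule {u \<in> carrier M. h u \<in> K} R M"
proof -
  interpret M: Module.module R M by fact
  interpret N: Module.module R N by fact
  interpret K: submodule K R N by fact
  note KE = N.submoduleE[OF assms(4)]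
  show ?thesis
  proof (rule M.submoduleI)
    show "\<zero>\<^bsub>M\<^esub> \<in> {u \<in> carrier M. h u \<in> K}"
      using K.one_closed module_hom_zero[OF assms(1-3)] by simp
  qed (use KE module_homD[OF assms(3)] module_hom_minus[OF assms(1-3)] in \<open>auto\<close>)
qed

lemma lin_comb_free_deltas:
  assumes "cring R" "c \<in> fin_supp R Y"
  shows "lin_comb R (free_module R Y) (delta R) c = c"
proof -
  interpret cring R by fact
  interpret F: rmodule R "free_module R Y" by (intro rmoduleI free_module_module assms)
  have c: "c x \<in> carrier R" for x using fin_suppD[OF assms(2)] by auto
  have d: "delta R y \<in> fin_supp R Y" if "y \<in> Y" for y using that assms by (simp add: delta_fin_supp)
  have eq: "(\<Oplus>\<^bsub>free_module R Y\<^esub>x\<in>X. c x \<odot>\<^bsub>free_module R Y\<^esub> delta R x) = (\<lambda>x. if x \<in> X then c x else \<zero>\<^bsub>R\<^esub>)"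
    if "finite X" "X \<subseteq> Y" for X
    using that
  proof (induct X rule: finite_induct)
    case empty then show ?case by simp
  next
    case (insert x X)
    have "(\<Oplus>\<^bsub>free_module R Y\<^esub>x\<in>insert x X. c x \<odot>\<^bsub>free_module R Y\<^esub> delta R x)
      = c x \<odot>\<^bsub>free_module R Y\<^esub> delta R x \<oplus>\<^bsub>free_module R Y\<^esub> (\<Oplus>\<^bsub>free_module R Y\<^esub>x\<in>X. c x \<odot>\<^bsub>free_module R Y\<^esub> delta R x)"
      using insert c d by (intro F.M.finsum_insert) (auto intro!: fin_supp_smult assms(1))
    also have "\<dots> = (\<lambda>y. if y \<in> insert x X then c y else \<zero>\<^bsub>R\<^esub>)"
      using insert c by (auto simp: delta_def fun_eq_iff)
    finally show ?case .
  qed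
  show ?thesis unfolding lin_comb_def
    by (subst eq[OF fin_suppD(3,4)[OF assms(2)]]) auto
qed

text \<open>Serves as an induction principle: a condition that cuts out a submodule of a free module
  is checked on basis vectors.\<close>

lemma free_submodule_eq_carrier:
  assumes "cring R" "submodule N R (free_module R Y)" "\<And>y. y \<in> Y \<Longrightarrow> delta R y \<in> N"
    and "c \<in> fin_supp R Y"
  shows "c \<in> N"
proof -
  interpret F: rmodule R "free_module R Y" by (intro rmoduleI free_module_module assms)
  show ?thesis
    using F.lin_comb_in_submodule[OF assms(2,4), of "delta R"] assms(3) lin_comb_free_deltas[OF assms(1,4)]
    by auto
qed

lemma module_hom_lin_comb:
  assumes "Module.module R M" "Module.module R N" "h \<in> module_hom R M N"
    and c: "c \<in> fin_supp R Y" and w: "w \<in> Y \<rightarrow> carrier M"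
  shows "h (lin_comb R M w c) = lin_comb R N (\<lambda>x. h (w x)) c"
proof -
  interpret M: Module.module R M by fact
  interpret N: Module.module R N by fact
  note hD = module_homD[OF assms(3)]
  have "h (\<Oplus>\<^bsub>M\<^esub>x\<in>X. c x \<odot>\<^bsub>M\<^esub> w x) = (\<Oplus>\<^bsub>N\<^esub>x\<in>X. c x \<odot>\<^bsub>N\<^esub> h (w x))" if "finite X" "X \<subseteq> Y" for X
    using that
  proof (induct X rule: finite_induct)
    case empty then show ?case by (simp add: module_hom_zero[OF assms(1-3)])
  next
    case (insert x X)
    have cw: "c y \<odot>\<^bsub>M\<^esub> w y \<in> carrier M" if "y \<in> insert x X" for y
      using that insert w fin_suppD(1)[OF c] by (auto simp: Pi_iff subset_iff)
    have cw': "c y \<odot>\<^bsub>N\<^esub> h (w y) \<in> carrier N" if "y \<in> insert x X" for y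
      using that insert w fin_suppD(1)[OF c] hD(1) by (auto simp: Pi_iff subset_iff)
    have "(\<Oplus>\<^bsub>M\<^esub>x\<in>insert x X. c x \<odot>\<^bsub>M\<^esub> w x) = c x \<odot>\<^bsub>M\<^esub> w x \<oplus>\<^bsub>M\<^esub> (\<Oplus>\<^bsub>M\<^esub>x\<in>X. c x \<odot>\<^bsub>M\<^esub> w x)"
      using insert cw by (intro M.M.finsum_insert) auto
    moreover have "(\<Oplus>\<^bsub>N\<^esub>x\<in>insert x X. c x \<odot>\<^bsub>N\<^esub> h (w x))
        = c x \<odot>\<^bsub>N\<^esub> h (w x) \<oplus>\<^bsub>N\<^esub> (\<Oplus>\<^bsub>N\<^esub>x\<in>X. c x \<odot>\<^bsub>N\<^esub> h (w x))"
      using insert cw' by (intro N.M.finsum_insert) auto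
    moreover have "(\<Oplus>\<^bsub>M\<^esub>x\<in>X. c x \<odot>\<^bsub>M\<^esub> w x) \<in> carrier M"
      using cw by (intro M.M.finsum_closed) auto
    ultimately show ?case
      using insert w fin_suppD(1)[OF c] hD(2)[OF cw[of x]] hD(3)[of "c x" "w x"] by (auto simp: Pi_iff)
  qed
  from this[OF fin_suppD(3,4)[OF c]] show ?thesis unfolding lin_comb_def .
qed

lemma module_hom_comp:
  "h \<in> module_hom R M N \<Longrightarrow> h' \<in> module_hom R N N' \<Longrightarrow> (\<lambda>x. h' (h x)) \<in> module_hom R M N'"
  by (auto simp: module_hom_def Pi_iff)

section \<open>Free resolutions of cyclic modules\<close>

text \<open>The module structure on the image of \<open>q\<close> for which \<open>q\<close> is linear. It serves both to form quotients
  and to move a module to another type.\<close>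

definition image_module :: "('a, 'm) module \<Rightarrow> ('m \<Rightarrow> 'n) \<Rightarrow> ('a, 'n) module"
  where "image_module L q = (let r = inv_into (carrier L) q in
    \<lparr>carrier = q ` carrier L, monoid.mult = undefined, monoid.one = undefined,
     ring.zero = q \<zero>\<^bsub>L\<^esub>, ring.add = (\<lambda>u v. q (r u \<oplus>\<^bsub>L\<^esub> r v)),
     smult = (\<lambda>a u. q (a \<odot>\<^bsub>L\<^esub> r u))\<rparr>)"

locale module_image = rmodule R L for R :: "'a ring" (structure) and L :: "('a, 'm) module" (structure) +
  fixes N :: "'m set" and q :: "'m \<Rightarrow> 'n"
  assumes N: "submodule N R L"
    and q_eq: "u \<in> carrier L \<Longrightarrow> v \<in> carrier L \<Longrightarrow> q u = q v \<longleftrightarrow> u \<ominus>\<^bsub>L\<^esub> v \<in> N"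
begin

text \<open>The operations use representatives picked by \<open>inv_into\<close>. These differ from
  \<open>u\<close> and \<open>v\<close> by elements of \<open>N\<close>, which \<open>q\<close> does
  not see.\<close>

lemma image_add:
  assumes u: "u \<in> carrier L" and v: "v \<in> carrier L"
  shows "q u \<oplus>\<^bsub>image_module L q\<^esub> q v = q (u \<oplus>\<^bsub>L\<^esub> v)"
proof -
  let ?r = "inv_into (carrier L) q"
  have r: "?r (q w) \<in> carrier L" "q (?r (q w)) = q w" if "w \<in> carrier L" for w
    using that by (auto intro: inv_into_into f_inv_into_f)
  have "?r (q w) \<ominus>\<^bsub>L\<^esub> w \<in> N" if "w \<in> carrier L" for w
    using r[OF that] q_eq that by metis
  then have "(?r (q u) \<ominus>\<^bsub>L\<^esub> u) \<oplus>\<^bsub>L\<^esub> (?r (q v) \<ominus>\<^bsub>L\<^esub> v) \<in> N"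
    using submoduleE(5)[OF N] u v by blast
  moreover have "(?r (q u) \<ominus>\<^bsub>L\<^esub> u) \<oplus>\<^bsub>L\<^esub> (?r (q v) \<ominus>\<^bsub>L\<^esub> v) = (?r (q u) \<oplus>\<^bsub>L\<^esub> ?r (q v)) \<ominus>\<^bsub>L\<^esub> (u \<oplus>\<^bsub>L\<^esub> v)"
    using r u v by (simp add: a_minus_def M.a_ac M.minus_add)
  ultimately show ?thesis
    using q_eq[of "?r (q u) \<oplus>\<^bsub>L\<^esub> ?r (q v)" "u \<oplus>\<^bsub>L\<^esub> v"] r u v by (simp add: image_module_def Let_def)
qed

lemma image_smult:
  assumes u: "u \<in> carrier L" and a: "a \<in> carrier R"
  shows "a \<odot>\<^bsub>image_module L q\<^esub> q u = q (a \<odot>\<^bsub>L\<^esub> u)"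
proof -
  let ?r = "inv_into (carrier L) q"
  have r: "?r (q u) \<in> carrier L" "q (?r (q u)) = q u"
    using u by (auto intro: inv_into_into f_inv_into_f)
  have "?r (q u) \<ominus>\<^bsub>L\<^esub> u \<in> N"
    using r q_eq u by metis
  then have "a \<odot>\<^bsub>L\<^esub> (?r (q u) \<ominus>\<^bsub>L\<^esub> u) \<in> N"
    using submoduleE(4)[OF N] a by blast
  moreover have "a \<odot>\<^bsub>L\<^esub> (?r (q u) \<ominus>\<^bsub>L\<^esub> u) = (a \<odot>\<^bsub>L\<^esub> ?r (q u)) \<ominus>\<^bsub>L\<^esub> (a \<odot>\<^bsub>L\<^esub> u)"
    using r u a by (simp add: a_minus_def smult_r_distr smult_r_minus)
  ultimately show ?thesis
    using q_eq[of "a \<odot>\<^bsub>L\<^esub> ?r (q u)" "a \<odot>\<^bsub>L\<^esub> u"] r u a by (simp add: image_module_def Let_def)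
qed

lemma image_carrier [simp]: "carrier (image_module L q) = q ` carrier L"
  and image_zero [simp]: "\<zero>\<^bsub>image_module L q\<^esub> = q \<zero>\<^bsub>L\<^esub>"
  by (simp_all add: image_module_def Let_def)

lemma image_module_module: "Module.module R (image_module L q)"
proof (rule moduleI)
  show "cring R" ..
  show "abelian_group (image_module L q)"
  proof (rule abelian_groupI)
    show "\<exists>y\<in>carrier (image_module L q). y \<oplus>\<^bsub>image_module L q\<^esub> x = \<zero>\<^bsub>image_module L q\<^esub>"
      if "x \<in> carrier (image_module L q)" for x
    proof -
      from that obtain u where "u \<in> carrier L" "x = q u" by auto
      then show ?thesis by (intro bexI[of _ "q (\<ominus>\<^bsub>L\<^esub> u)"]) (auto simp: image_add M.l_neg)
    qed
  qed (auto simp: image_add M.a_ac)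
qed (auto simp: image_add image_smult smult_l_distr smult_r_distr smult_assoc1)

lemma image_hom: "q \<in> module_hom R L (image_module L q)"
  by (auto simp: module_hom_def image_add image_smult)

lemma image_kernel: "u \<in> carrier L \<Longrightarrow> q u = \<zero>\<^bsub>image_module L q\<^esub> \<longleftrightarrow> u \<in> N"
  by (simp add: q_eq M.add.inv_one a_minus_def a_inv_def)

end

text \<open>The basis consists of the images of the basis vectors. Since \<open>is_free\<close>
  indexes coefficients by elements of the module and not by \<open>Y\<close>, the work is reindexing
  along \<open>b\<close>, whose injectivity uses that one and zero differ.\<close>

lemma is_free_image:
  assumes R: "cring R" and h: "h \<in> module_hom R (free_module R Y) M" and M: "Module.module R M"
    and inj: "inj_on h (fin_supp R Y)" and surj: "h ` fin_supp R Y = carrier M"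
    and nz: "\<one>\<^bsub>R\<^esub> \<noteq> \<zero>\<^bsub>R\<^esub>"
  shows "is_free R M"
proof -
  interpret R: cring R by fact
  note F = free_module_module[OF R, of Y]
  interpret M: rmodule R M by (rule rmoduleI[OF M])
  define b where "b = (\<lambda>y. h (delta R y))"
  have d: "delta R y \<in> fin_supp R Y" if "y \<in> Y" for y using that R by (simp add: delta_fin_supp)
  have b_carr: "b \<in> Y \<rightarrow> carrier M" using d surj by (auto simp: b_def)
  have inj_b: "inj_on b Y"
  proof (rule inj_onI)
    fix x y assume xy: "x \<in> Y" "y \<in> Y" "b x = b y"
    then have "delta R x = delta R y" using inj_onD[OF inj, of "delta R x" "delta R y"] d by (auto simp: b_def)
    then show "x = y" using nz by (metis delta_def)
  qed
  have lc: "lin_comb R M b c = h c" if "c \<in> fin_supp R Y" for c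
    using module_hom_lin_comb[OF F M h that, of "delta R"] d lin_comb_free_deltas[OF R that]
    by (auto simp: b_def)
  have re: "(\<lambda>y. if y \<in> Y then c (b y) else \<zero>\<^bsub>R\<^esub>) \<in> fin_supp R Y"
       "(\<Oplus>\<^bsub>M\<^esub>x\<in>{x. c x \<noteq> \<zero>\<^bsub>R\<^esub>}. c x \<odot>\<^bsub>M\<^esub> x) = h (\<lambda>y. if y \<in> Y then c (b y) else \<zero>\<^bsub>R\<^esub>)"
    if c: "c \<in> fin_supp R (b ` Y)" for c
  proof -
    let ?c' = "\<lambda>y. if y \<in> Y then c (b y) else \<zero>\<^bsub>R\<^esub>"
    have im: "{x. c x \<noteq> \<zero>\<^bsub>R\<^esub>} = b ` {y. ?c' y \<noteq> \<zero>\<^bsub>R\<^esub>}"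
      using fin_suppD(4)[OF c] by (auto split: if_splits)
    have inj': "inj_on b {y. ?c' y \<noteq> \<zero>\<^bsub>R\<^esub>}"
      using inj_b by (rule inj_on_subset) (auto split: if_splits)
    have "finite {y. ?c' y \<noteq> \<zero>\<^bsub>R\<^esub>}"
      using fin_suppD(3)[OF c] inj' by (simp add: im finite_image_iff)
    then show c': "?c' \<in> fin_supp R Y"
      using fin_suppD(1)[OF c] by (intro fin_suppI) auto
    have "(\<Oplus>\<^bsub>M\<^esub>x\<in>{x. c x \<noteq> \<zero>\<^bsub>R\<^esub>}. c x \<odot>\<^bsub>M\<^esub> x) = (\<Oplus>\<^bsub>M\<^esub>y\<in>{y. ?c' y \<noteq> \<zero>\<^bsub>R\<^esub>}. c (b y) \<odot>\<^bsub>M\<^esub> b y)"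
      unfolding im using b_carr fin_suppD(1)[OF c]
      by (intro M.M.finsum_reindex[OF _ inj']) (auto simp: Pi_iff split: if_splits)
    also have "\<dots> = lin_comb R M b ?c'"
      unfolding lin_comb_def using b_carr fin_suppD(1)[OF c]
      by (intro M.M.finsum_cong') (auto simp: Pi_iff split: if_splits)
    finally show "(\<Oplus>\<^bsub>M\<^esub>x\<in>{x. c x \<noteq> \<zero>\<^bsub>R\<^esub>}. c x \<odot>\<^bsub>M\<^esub> x) = h ?c'" using lc[OF c'] by simp
  qed
  show ?thesis
    unfolding is_free_def
  proof (intro exI[of _ "b ` Y"] conjI ballI)
    show "b ` Y \<subseteq> carrier M" using b_carr by auto
    fix u assume "u \<in> carrier M"
    then obtain c where c: "c \<in> fin_supp R Y" "u = h c" using surj by auto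
    define c0 where "c0 = (\<lambda>x. if x \<in> b ` Y then c (inv_into Y b x) else \<zero>\<^bsub>R\<^esub>)"
    have c0b: "c0 (b y) = c y" if "y \<in> Y" for y using that inj_b by (auto simp: c0_def)
    have c0: "c0 \<in> fin_supp R (b ` Y)"
      using fin_suppD[OF c(1)] c0b
      by (intro fin_suppI) (auto simp: c0_def intro!: finite_subset[OF _ finite_imageI[of "{y. c y \<noteq> \<zero>\<^bsub>R\<^esub>}" b]])
    have c0c: "(\<lambda>y. if y \<in> Y then c0 (b y) else \<zero>\<^bsub>R\<^esub>) = c"
      using c0b fin_suppD(2)[OF c(1)] by auto
    show "\<exists>!c. c \<in> fin_supp R (b ` Y) \<and> u = (\<Oplus>\<^bsub>M\<^esub>x\<in>{x. c x \<noteq> \<zero>\<^bsub>R\<^esub>}. c x \<odot>\<^bsub>M\<^esub> x)"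
    proof (intro ex1I[of _ c0] conjI)
      show "u = (\<Oplus>\<^bsub>M\<^esub>x\<in>{x. c0 x \<noteq> \<zero>\<^bsub>R\<^esub>}. c0 x \<odot>\<^bsub>M\<^esub> x)" using re(2)[OF c0] c0c c by simp
      fix c1 assume c1: "c1 \<in> fin_supp R (b ` Y) \<and> u = (\<Oplus>\<^bsub>M\<^esub>x\<in>{x. c1 x \<noteq> \<zero>\<^bsub>R\<^esub>}. c1 x \<odot>\<^bsub>M\<^esub> x)"
      then have "(\<lambda>y. if y \<in> Y then c1 (b y) else \<zero>\<^bsub>R\<^esub>) = c"
        using re[of c1] c inj_onD[OF inj] by auto
      then have "c1 x = c0 x" for x
        using c0b fin_suppD(2)[of c1 R "b ` Y" x] c1 by (cases "x \<in> b ` Y") (auto simp: c0_def)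
      then show "c1 = c0" by auto
    qed (rule c0)
  qed
qed

text \<open>Unique coefficients form a map \<chi>, and uniqueness also forces it to be linear. This
  turns freeness of the unknown resolution into something that maps can be built from.\<close>

lemma is_free_coordinates:
  assumes R: "cring R" and M: "Module.module R M" and free: "is_free R M"
  obtains B \<chi> where "B \<subseteq> carrier M" "\<chi> \<in> module_hom R M (free_module R B)"
    "\<And>u. u \<in> carrier M \<Longrightarrow> lin_comb R M (\<lambda>b. b) (\<chi> u) = u"
proof -
  interpret M: rmodule R M by (rule rmoduleI[OF M])
  from free obtain B where B: "B \<subseteq> carrier M"
    and ex1: "\<And>u. u \<in> carrier M \<Longrightarrow> \<exists>!c. c \<in> fin_supp R B \<and> u = lin_comb R M (\<lambda>b. b) c"
    unfolding is_free_def lin_comb_def by auto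
  define \<chi> where "\<chi> u = (THE c. c \<in> fin_supp R B \<and> u = lin_comb R M (\<lambda>b. b) c)" for u
  have \<chi>: "\<chi> u \<in> fin_supp R B" "lin_comb R M (\<lambda>b. b) (\<chi> u) = u" if "u \<in> carrier M" for u
    using theI'[OF ex1[OF that]] by (auto simp: \<chi>_def)
  have uniq: "c = \<chi> (lin_comb R M (\<lambda>b. b) c)" if "c \<in> fin_supp R B" for c
  proof -
    have "lin_comb R M (\<lambda>b. b) c \<in> carrier M" using M.lin_comb_closed[OF that, of "\<lambda>b. b"] B by auto
    from ex1[OF this] \<chi>[OF this] that show ?thesis by metis
  qed
  have idB: "(\<lambda>b. b) \<in> B \<rightarrow> carrier M" using B by auto
  have "\<chi> \<in> module_hom R M (free_module R B)"
    unfolding module_hom_def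
  proof (intro CollectI conjI ballI)
    fix u v assume uv: "u \<in> carrier M" "v \<in> carrier M"
    show "\<chi> (u \<oplus>\<^bsub>M\<^esub> v) = \<chi> u \<oplus>\<^bsub>free_module R B\<^esub> \<chi> v"
      using uniq[OF fin_supp_add[OF R \<chi>(1)[OF uv(1)] \<chi>(1)[OF uv(2)]]] uv \<chi>
      by (subst (asm) M.lin_comb_add[OF _ _ idB]) auto
  next
    fix r u assume ru: "r \<in> carrier R" "u \<in> carrier M"
    show "\<chi> (r \<odot>\<^bsub>M\<^esub> u) = r \<odot>\<^bsub>free_module R B\<^esub> \<chi> u"
      using uniq[OF fin_supp_smult[OF R \<chi>(1)[OF ru(2)] ru(1)]] ru \<chi>
      by (subst (asm) M.lin_comb_smult[OF _ idB]) auto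
  qed (use \<chi> in auto)
  then show ?thesis using that[of B \<chi>] B \<chi>(2) by blast
qed

text \<open>A finitely supported function is determined by the finite part of its graph over the
  support, and an infinite set has as many finite subsets as elements.\<close>

lemma fin_supp_lepoll:
  assumes "infinite (UNIV :: 'a set)"
  shows "fin_supp (R :: 'a ring) (UNIV :: 'a set) \<lesssim> (UNIV :: 'a set)"
proof -
  have "fin_supp R (UNIV :: 'a set) \<lesssim> Fpow ((UNIV :: 'a set) \<times> (UNIV :: 'a set))"
    by (rule lepoll_trans[OF subset_imp_lepoll
          lepoll_restricted_funspace[of "UNIV :: 'a set" "UNIV :: 'a set" "\<lambda>_. \<zero>\<^bsub>R\<^esub>"]])
      (auto simp: fin_supp_def)
  also have "\<dots> \<lesssim> (UNIV :: 'a set) \<times> (UNIV :: 'a set)"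
  proof -
    have "infinite ((UNIV :: 'a set) \<times> (UNIV :: 'a set))"
      using assms finite_cartesian_productD1 by blast
    from card_of_Fpow_infinite[OF this] show ?thesis
      by (meson eqpoll_imp_lepoll eqpoll_iff_card_of_ordIso)
  qed
  also have "\<dots> \<lesssim> (UNIV :: 'a set)"
    using card_of_Times_same_infinite[OF assms] by (meson eqpoll_imp_lepoll eqpoll_iff_card_of_ordIso)
  finally show ?thesis .
qed

text \<open>By the cardinality bound all of \<open>N\<close> can be listed as a generating family
  indexed by the type \<open>'a\<close>. Hence one and the same free module covers every syzygy
  module, and the resolution never leaves its type.\<close>

lemma submodule_is_image:
  fixes R :: "'a ring"
  assumes R: "cring R" and inf: "infinite (UNIV :: 'a set)"
    and N: "submodule N R (free_module R (UNIV :: 'a set))"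
  obtains h where "h \<in> module_hom R (free_module R (UNIV :: 'a set)) (free_module R (UNIV :: 'a set))"
    "h ` fin_supp R UNIV = N"
proof -
  let ?F = "free_module R (UNIV :: 'a set)"
  interpret F: rmodule R ?F by (intro rmoduleI free_module_module R)
  have NF: "N \<subseteq> fin_supp R UNIV" using F.submoduleE(1)[OF N] by simp
  have ne: "N \<noteq> {}" using F.submoduleE(2)[OF N] .
  have "N \<lesssim> (UNIV :: 'a set)" using subset_imp_lepoll[OF NF] fin_supp_lepoll[OF inf] lepoll_trans by blast
  then obtain f :: "('a \<Rightarrow> 'a) \<Rightarrow> 'a" where f: "inj_on f N" by (auto simp: lepoll_def)
  obtain w :: "'a \<Rightarrow> ('a \<Rightarrow> 'a)" where w: "w ` UNIV = N"
    using inj_on_iff_surj[OF ne, of UNIV] f by auto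
  have wF: "w \<in> UNIV \<rightarrow> carrier ?F" using w NF by auto
  have "lin_comb R ?F w ` fin_supp R UNIV = N"
  proof
    show "lin_comb R ?F w ` fin_supp R UNIV \<subseteq> N"
      using F.lin_comb_in_submodule[OF N, of _ UNIV w] w by auto
    show "N \<subseteq> lin_comb R ?F w ` fin_supp R UNIV"
    proof
      fix n assume "n \<in> N"
      then obtain x where "n = w x" using w by auto
      then show "n \<in> lin_comb R ?F w ` fin_supp R UNIV"
        using F.lin_comb_delta[OF _ wF, of x] delta_fin_supp[OF R, of x UNIV] by force
    qed
  qed
  with F.lin_comb_hom[OF wF] show ?thesis by (rule that)
qed

lemma has_char_zero_nat_elt_diff:
  fixes R :: "'a ring"
  assumes R: "cring R" and char: "has_char R 0" and "m < n"
  shows "nat_elt R n \<noteq> nat_elt R m"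
proof
  interpret cring R by fact
  assume eq: "nat_elt R n = nat_elt R m"
  have "m + (n - m) = n" using \<open>m < n\<close> by simp
  then have "nat_elt R m \<oplus>\<^bsub>R\<^esub> nat_elt R (n - m) = nat_elt R m \<oplus>\<^bsub>R\<^esub> \<zero>\<^bsub>R\<^esub>"
    using add.nat_pow_mult[OF one_closed, of m "n - m"] eq r_zero[OF add.nat_pow_closed[OF one_closed, of m]] by metis
  then have z: "nat_elt R (n - m) = \<zero>\<^bsub>R\<^esub>"
    using add.l_cancel[of "nat_elt R m" "nat_elt R (n - m)" "\<zero>\<^bsub>R\<^esub>"] add.nat_pow_closed[OF one_closed] zero_closed by blast
  have "nat_elt R (n - m) = \<zero>\<^bsub>R\<^esub> \<longleftrightarrow> 0 dvd (n - m)" using char unfolding has_char_def by blast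
  with z have "n - m = 0" by simp
  with \<open>m < n\<close> show False by simp
qed

lemma has_char_zero_infinite:
  fixes R :: "'a ring"
  assumes R: "cring R" and char: "has_char R 0"
  shows "infinite (UNIV :: 'a set)"
proof -
  have "inj (nat_elt R)"
    by (rule linorder_injI) (rule has_char_zero_nat_elt_diff[OF R char, symmetric])
  then have "infinite (range (nat_elt R))" by (rule range_inj_infinite)
  then show "infinite (UNIV :: 'a set)" by (metis finite_subset subset_UNIV)
qed

lemma has_char_zero_one_neq_zero:
  fixes R :: "'a ring"
  assumes R: "cring R" and char: "has_char R 0"
  shows "\<one>\<^bsub>R\<^esub> \<noteq> \<zero>\<^bsub>R\<^esub>"
proof -
  interpret cring R by fact
  have "nat_elt R 1 = \<zero>\<^bsub>R\<^esub> \<longleftrightarrow> 0 dvd (1::nat)" using char unfolding has_char_def by blast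
  moreover have "nat_elt R 1 = \<one>\<^bsub>R\<^esub>" using add.nat_pow_eone[OF one_closed] by simp
  ultimately show ?thesis by simp
qed

text \<open>Every term is a copy of the free module on the type \<open>'a\<close>, moved into the
  universe by \<open>g\<close>. The lemma guarantees that the choice operator inside
  \<open>Tor\<close> selects a genuine resolution.\<close>

lemma free_resolution_exists:
  fixes R :: "'a ring" and M :: "('a, 'a univ) module"
  assumes R: "cring R" and inf: "infinite (UNIV :: 'a set)" and nz: "\<one>\<^bsub>R\<^esub> \<noteq> \<zero>\<^bsub>R\<^esub>"
    and M: "Module.module R M" and q: "q \<in> module_hom R (self_module R) M" and surj: "q ` carrier R = carrier M"
  shows "\<exists>P \<delta> (\<epsilon> :: 'a univ \<Rightarrow> 'a univ). free_resolution R M P \<delta> \<epsilon>"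
proof -
  interpret R: cring R by fact
  let ?F = "free_module R (UNIV :: 'a set)"
  interpret F: rmodule R ?F by (intro rmoduleI free_module_module R)
  interpret M: rmodule R M by (rule rmoduleI[OF M])
  \<comment> \<open>\<open>g c\<close> codes the graph of \<open>c\<close> as a set of sequences and embeds the free module into the universe.\<close>
  define g :: "('a \<Rightarrow> 'a) \<Rightarrow> 'a univ" where "g c = {\<lambda>n. if n = 0 then x else c x |x. True}" for c
  have inj_g: "c = c'" if "g c = g c'" for c c'
  proof
    fix x
    have "(\<lambda>n::nat. if n = 0 then x else c x) \<in> g c'" using that[symmetric] by (auto simp: g_def)
    then obtain y where y: "(\<lambda>n::nat. if n = 0 then x else c x) = (\<lambda>n. if n = 0 then y else c' y)"
      by (auto simp: g_def)
    from fun_cong[OF y, of 0] fun_cong[OF y, of 1] show "c x = c' x" by auto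
  qed
  interpret P: module_image R ?F "{\<zero>\<^bsub>?F\<^esub>}" g
  proof (intro module_image.intro module_image_axioms.intro F.rmodule_axioms)
    show "submodule {\<zero>\<^bsub>?F\<^esub>} R ?F"
      using F.M.zero_closed by (intro F.submoduleI) (auto simp del: free_module_simps simp: F.M.add.inv_one a_inv_def)
    fix u v assume uv: "u \<in> carrier ?F" "v \<in> carrier ?F"
    show "g u = g v \<longleftrightarrow> u \<ominus>\<^bsub>?F\<^esub> v \<in> {\<zero>\<^bsub>?F\<^esub>}"
      using uv inj_g F.M.minus_equality[of u "\<ominus>\<^bsub>?F\<^esub> v"] F.M.r_neg[of v] F.M.a_inv_closed[of v] F.M.minus_minus[of v]
      unfolding a_minus_def by (metis singletonD singletonI)
  qed
  let ?P = "image_module ?F g"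
  let ?r = "inv_into UNIV g"
  have rg: "?r (g c) = c" for c using inj_g by (intro inv_f_f injI)
  have r_hom: "?r \<in> module_hom R ?P ?F"
  proof -
    have "?r (g c \<oplus>\<^bsub>?P\<^esub> g c') = ?r (g c) \<oplus>\<^bsub>?F\<^esub> ?r (g c')" if "c \<in> carrier ?F" "c' \<in> carrier ?F" for c c'
      using P.image_add[OF that] rg by metis
    moreover have "?r (a \<odot>\<^bsub>?P\<^esub> g c) = a \<odot>\<^bsub>?F\<^esub> ?r (g c)" if "c \<in> carrier ?F" "a \<in> carrier R" for a c
      using P.image_smult[OF that] rg by metis
    ultimately show ?thesis by (auto simp: module_hom_def rg simp del: free_module_simps(3-))
  qed
  \<comment> \<open>The basis is indexed by the whole type, so indices outside the ring need a
    value; zero does not change the image.\<close>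
  define w where "w x = (if x \<in> carrier R then q x else \<zero>\<^bsub>M\<^esub>)" for x
  have w: "w \<in> UNIV \<rightarrow> carrier M" 
    unfolding w_def using module_homD(1)[OF q, simplified] by (simp add: Pi_iff)
  define e where "e = lin_comb R M w"
  have e_hom: "e \<in> module_hom R ?F M" unfolding e_def by (rule M.lin_comb_hom[OF w])
  have e_surj: "e ` carrier ?F = carrier M"
  proof
    show "e ` carrier ?F \<subseteq> carrier M" using module_homD(1)[OF e_hom] by auto
    show "carrier M \<subseteq> e ` carrier ?F"
    proof
      fix m assume "m \<in> carrier M"
      then obtain x where "x \<in> carrier R" "m = q x" using surj by auto
      then have "m = e (delta R x)" unfolding e_def using M.lin_comb_delta[OF _ w, of x] by (simp add: w_def)
      then show "m \<in> e ` carrier ?F" using delta_fin_supp[OF R, of x UNIV] by simp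
    qed
  qed
  define ch where "ch N = (SOME h. h \<in> module_hom R ?F ?F \<and> h ` carrier ?F = N)" for N
  have ch: "ch N \<in> module_hom R ?F ?F" "ch N ` carrier ?F = N" if "submodule N R ?F" for N
  proof -
    have "\<exists>h. h \<in> module_hom R ?F ?F \<and> h ` carrier ?F = N"
      by (rule submodule_is_image[OF R inf that]) (simp, blast)
    then have "ch N \<in> module_hom R ?F ?F \<and> ch N ` carrier ?F = N" unfolding ch_def by (rule someI_ex)
    then show "ch N \<in> module_hom R ?F ?F" "ch N ` carrier ?F = N" by (rule conjunct1, rule conjunct2)
  qed
  define ker where "ker h = {u \<in> carrier ?F. h u = \<zero>\<^bsub>?F\<^esub>}" for h :: "('a \<Rightarrow> 'a) \<Rightarrow> ('a \<Rightarrow> 'a)"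
  have zero_sub: "submodule {\<zero>\<^bsub>N\<^esub>} R N" if "Module.module R N" for N :: "('a, 'm) module"
  proof -
    interpret N: Module.module R N by fact
    show ?thesis by (rule N.submoduleI) (auto simp: N.M.add.inv_one a_inv_def)
  qed
  have ker: "submodule (ker h) R ?F" if "h \<in> module_hom R ?F ?F" for h
    using submodule_vimage[OF F.is_module F.is_module that zero_sub[OF F.is_module]] by (simp add: ker_def)
  have ker_e: "submodule {u \<in> carrier ?F. e u = \<zero>\<^bsub>M\<^esub>} R ?F"
    using submodule_vimage[OF F.is_module M e_hom zero_sub[OF M]] by simp
  \<comment> \<open>Each differential is chosen to map onto the kernel of its predecessor, so
    exactness holds by construction.\<close>
  define hs where "hs = rec_nat (ch {u \<in> carrier ?F. e u = \<zero>\<^bsub>M\<^esub>}) (\<lambda>_ h. ch (ker h))"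
  have hs_hom: "hs n \<in> module_hom R ?F ?F" for n
    by (induction n) (auto simp: hs_def intro: ch ker ker_e simp del: free_module_simps)
  have hs0: "hs 0 ` carrier ?F = {u \<in> carrier ?F. e u = \<zero>\<^bsub>M\<^esub>}"
    unfolding hs_def using ch(2)[OF ker_e] by simp
  have hsS: "hs (Suc n) ` carrier ?F = ker (hs n)" for n
    using ch(2)[OF ker[OF hs_hom[of n]]] unfolding hs_def by simp
  define \<delta> where "\<delta> n u = g (hs n (?r u))" for n u
  define \<epsilon> where "\<epsilon> u = e (?r u)" for u
  have "free_resolution R M (\<lambda>_. ?P) \<delta> \<epsilon>"
    unfolding free_resolution_def
  proof (intro conjI allI)
    fix n
    show "Module.module R ?P" by (rule P.image_module_module)
    show "is_free R ?P"
      by (rule is_free_image[OF R P.image_hom P.image_module_module _ _ nz])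
        (auto intro!: inj_onI dest: inj_g)
    show "\<delta> n \<in> module_hom R ?P ?P"
      unfolding \<delta>_def by (intro module_hom_comp[OF module_hom_comp[OF r_hom hs_hom] P.image_hom])
    show "\<epsilon> \<in> module_hom R ?P M" unfolding \<epsilon>_def by (rule module_hom_comp[OF r_hom e_hom])
    show "\<epsilon> ` carrier ?P = carrier M"
      using e_surj by (simp add: \<epsilon>_def image_image rg del: free_module_simps)
    have im: "\<delta> n ` carrier ?P = g ` (hs n ` carrier ?F)" for n
      by (simp add: \<delta>_def image_image rg del: free_module_simps)
    have ker_img: "{u \<in> g ` X. Q u} = g ` {c \<in> X. Q (g c)}" for X Q by blast
    have g_iff: "g c = g c' \<longleftrightarrow> c = c'" for c c' using inj_g by metis
    show "a_kernel ?P M \<epsilon> = \<delta> 0 ` carrier ?P"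
      unfolding im hs0 unfolding a_kernel_def' P.image_carrier ker_img by (simp only: \<epsilon>_def rg)
    show "a_kernel ?P ?P (\<delta> n) = \<delta> (Suc n) ` carrier ?P"
      unfolding im hsS unfolding a_kernel_def' P.image_carrier ker_img P.image_zero by (simp only: \<delta>_def rg g_iff ker_def)
  qed
  then show ?thesis by blast
qed

text \<open>The quotient of \<open>R\<close> by \<open>K\<close>, realized inside the universe in
  which almost flatness and almost faithfulness are stated.\<close>

lemma cyclic_module_exists:
  fixes R :: "'a ring"
  assumes R: "cring R" and K: "ideal K R"
  obtains M :: "('a, 'a univ) module" and q where "Module.module R M" "q \<in> module_hom R (self_module R) M"
    "q ` carrier R = carrier M" "\<And>a. a \<in> carrier R \<Longrightarrow> q a = \<zero>\<^bsub>M\<^esub> \<longleftrightarrow> a \<in> K"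
proof -
  interpret R: cring R by fact
  interpret K: ideal K R by fact
  interpret L: rmodule R "self_module R" by (intro rmoduleI self_module_module R)
  \<comment> \<open>Elements of the universe are sets of sequences, so a coset is coded by the set
    of constant sequences with values in it.\<close>
  define q :: "'a \<Rightarrow> 'a univ" where "q a = (\<lambda>x _. x) ` (K +>\<^bsub>R\<^esub> a)" for a
  have q: "q u = q v \<longleftrightarrow> u \<ominus>\<^bsub>R\<^esub> v \<in> K" if "u \<in> carrier R" "v \<in> carrier R" for u v
  proof -
    have "inj (\<lambda>x (_::nat). x :: 'a)" by (auto simp: inj_def fun_eq_iff)
    then have "q u = q v \<longleftrightarrow> K +>\<^bsub>R\<^esub> u = K +>\<^bsub>R\<^esub> v"
      unfolding q_def by (rule inj_image_eq_iff)
    then show ?thesis using R.quotient_eq_iff_same_a_r_cos[OF K that] by simp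
  qed
  interpret Q: module_image R "self_module R" K q
  proof (intro module_image.intro module_image_axioms.intro L.rmodule_axioms)
    show "submodule K R (self_module R)"
      by (rule L.submoduleI) (auto simp: self_module_a_inv K.I_l_closed)
  qed (simp add: q a_minus_def self_module_a_inv)
  show ?thesis
    by (rule that[OF Q.image_module_module Q.image_hom])
      (use Q.image_kernel in \<open>auto simp del: Q.image_zero\<close>)
qed

section \<open>Tensor products and Tor\<close>

lemma
  assumes "cring R" "cring S" "h \<in> ring_hom R S"
  shows ring_hom_nat_elt: "h (nat_elt R n) = nat_elt S n"
    and ring_hom_nat_pow: "a \<in> carrier R \<Longrightarrow> h (a [^]\<^bsub>R\<^esub> (n::nat)) = h a [^]\<^bsub>S\<^esub> n"
proof -
  interpret R: cring R by fact
  interpret S: cring S by fact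
  interpret h: ring_hom_cring R S h
    by (intro ring_hom_cringI ring_hom_ringI2 R.ring_axioms S.ring_axioms assms)
  show "h (nat_elt R n) = nat_elt S n" by (induction n) simp_all
  show "h (a [^]\<^bsub>R\<^esub> (n::nat)) = h a [^]\<^bsub>S\<^esub> n" if "a \<in> carrier R" using that by (induction n) auto
qed

locale base_change = A?: cring A + S?: cring S for A :: "'a ring" (structure) and S :: "'s ring" (structure) +
  fixes \<phi> :: "'a \<Rightarrow> 's"
  assumes \<phi>_hom: "\<phi> \<in> ring_hom A S"
begin

sublocale \<phi>: ring_hom_cring A S \<phi>
  by (intro ring_hom_cringI ring_hom_ringI2 A.ring_axioms S.ring_axioms A.is_cring S.is_cring \<phi>_hom)

lemma free_S: "Module.module S (free_module S Y)"
  by (rule free_module_module[OF S.is_cring])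

lemma rfree_S: "rmodule S (free_module S Y)"
  by (rule rmoduleI[OF free_S])

text \<open>Each new coefficient is a linear combination of the old ones with weights zero and one,
  so linearity of \<open>push_coeffs\<close> is inherited from \<open>lin_comb\<close>.\<close>

lemma push_coeffs_eq_lin_comb:
  assumes "c \<in> fin_supp S X" "h \<in> X \<rightarrow> Y"
  shows "push_coeffs S h c v = lin_comb S (self_module S) (\<lambda>u. if h u = v then \<one>\<^bsub>S\<^esub> else \<zero>\<^bsub>S\<^esub>) c"
proof -
  interpret SM: rmodule S "self_module S" by (intro rmoduleI self_module_module S.is_cring)
  note c = fin_suppD[OF assms(1)]
  have "push_coeffs S h c v = (\<Oplus>\<^bsub>self_module S\<^esub>u\<in>{u. c u \<noteq> \<zero>\<^bsub>S\<^esub> \<and> h u = v}. c u)"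
    by (simp add: push_coeffs_def finsum_def finprod_def)
  also have "\<dots> = (\<Oplus>\<^bsub>self_module S\<^esub>u\<in>{u. c u \<noteq> \<zero>\<^bsub>S\<^esub>}. c u \<odot>\<^bsub>self_module S\<^esub> (if h u = v then \<one>\<^bsub>S\<^esub> else \<zero>\<^bsub>S\<^esub>))"
    using c by (intro SM.M.add.finprod_mono_neutral_cong_left) auto
  finally show ?thesis by (simp add: lin_comb_def)
qed

lemma push_coeffs_hom:
  assumes h: "h \<in> X \<rightarrow> Y"
  shows "push_coeffs S h \<in> module_hom S (free_module S X) (free_module S Y)"
proof -
  interpret SM: rmodule S "self_module S" by (intro rmoduleI self_module_module S.is_cring)
  have w: "(\<lambda>u. if h u = v then \<one>\<^bsub>S\<^esub> else \<zero>\<^bsub>S\<^esub>) \<in> X \<rightarrow> carrier (self_module S)" for v by auto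
  have lin: "push_coeffs S h c v \<in> carrier S" if "c \<in> fin_supp S X" for c v
    using SM.lin_comb_closed[OF that w[of v]] push_coeffs_eq_lin_comb[OF that h] by simp
  have "push_coeffs S h c \<in> fin_supp S Y" if c: "c \<in> fin_supp S X" for c
  proof (rule fin_suppI)
    let ?Z = "h ` {u. c u \<noteq> \<zero>\<^bsub>S\<^esub>}"
    have z: "push_coeffs S h c v = \<zero>\<^bsub>S\<^esub>" if "v \<notin> ?Z" for v
    proof -
      have "{u. c u \<noteq> \<zero>\<^bsub>S\<^esub> \<and> h u = v} = {}" using that by auto
      then show ?thesis unfolding push_coeffs_def by (simp only: S.finsum_empty)
    qed
    show "push_coeffs S h c v \<in> carrier S" for v by (rule lin[OF c])
    have "?Z \<subseteq> Y" using fin_suppD(4)[OF c] h by auto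
    then show "push_coeffs S h c v = \<zero>\<^bsub>S\<^esub>" if "v \<notin> Y" for v using that z by blast
    show "finite {v. push_coeffs S h c v \<noteq> \<zero>\<^bsub>S\<^esub>}"
      by (rule finite_subset[of _ ?Z]) (use z fin_suppD(3)[OF c] in auto)
  qed
  moreover have "push_coeffs S h (\<lambda>x. c x \<oplus>\<^bsub>S\<^esub> c' x) v = push_coeffs S h c v \<oplus>\<^bsub>S\<^esub> push_coeffs S h c' v"
    if "c \<in> fin_supp S X" "c' \<in> fin_supp S X" for c c' v
    using SM.lin_comb_add[OF that w[of v]] push_coeffs_eq_lin_comb[OF _ h, of _ v] that fin_supp_add[OF S.is_cring that]
    by simp
  moreover have "push_coeffs S h (\<lambda>x. r \<otimes>\<^bsub>S\<^esub> c x) v = r \<otimes>\<^bsub>S\<^esub> push_coeffs S h c v"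
    if "c \<in> fin_supp S X" "r \<in> carrier S" for c r v
    using SM.lin_comb_smult[OF that(1) w[of v] that(2)] push_coeffs_eq_lin_comb[OF _ h, of _ v] that fin_supp_smult[OF S.is_cring that]
    by simp
  ultimately show ?thesis by (auto simp: module_hom_def)
qed

lemma push_coeffs_delta:
  assumes h: "h \<in> X \<rightarrow> Y" and u: "u \<in> X"
  shows "push_coeffs S h (delta S u) = delta S (h u)"
proof
  fix v
  interpret SM: rmodule S "self_module S" by (intro rmoduleI self_module_module S.is_cring)
  have w: "(\<lambda>u. if h u = v then \<one>\<^bsub>S\<^esub> else \<zero>\<^bsub>S\<^esub>) \<in> X \<rightarrow> carrier (self_module S)" by auto
  show "push_coeffs S h (delta S u) v = delta S (h u) v"
    using SM.lin_comb_delta[OF u w] push_coeffs_eq_lin_comb[OF delta_fin_supp[OF S.is_cring u] h]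
    by (auto simp: delta_def)
qed

lemma tensor_rel_add:
  "u \<in> carrier M \<Longrightarrow> v \<in> carrier M \<Longrightarrow>
    delta S (u \<oplus>\<^bsub>M\<^esub> v) \<ominus>\<^bsub>free_module S (carrier M)\<^esub>
      (delta S u \<oplus>\<^bsub>free_module S (carrier M)\<^esub> delta S v) \<in> tensor_rel A S \<phi> M"
  by (auto simp: tensor_rel_def Let_def simp del: free_module_simps intro!: set_mp[OF rmodule.mod_span_incl[OF rfree_S]])

lemma tensor_rel_smult:
  "a \<in> carrier A \<Longrightarrow> u \<in> carrier M \<Longrightarrow>
    delta S (a \<odot>\<^bsub>M\<^esub> u) \<ominus>\<^bsub>free_module S (carrier M)\<^esub>
      (\<phi> a \<odot>\<^bsub>free_module S (carrier M)\<^esub> delta S u) \<in> tensor_rel A S \<phi> M"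
  by (auto simp: tensor_rel_def Let_def simp del: free_module_simps intro!: set_mp[OF rmodule.mod_span_incl[OF rfree_S]])

lemma tensor_rel_minimal:
  assumes "submodule N S (free_module S (carrier M))"
    and "\<And>u v. u \<in> carrier M \<Longrightarrow> v \<in> carrier M \<Longrightarrow>
      delta S (u \<oplus>\<^bsub>M\<^esub> v) \<ominus>\<^bsub>free_module S (carrier M)\<^esub>
        (delta S u \<oplus>\<^bsub>free_module S (carrier M)\<^esub> delta S v) \<in> N"
    and "\<And>a u. a \<in> carrier A \<Longrightarrow> u \<in> carrier M \<Longrightarrow>
      delta S (a \<odot>\<^bsub>M\<^esub> u) \<ominus>\<^bsub>free_module S (carrier M)\<^esub>
        (\<phi> a \<odot>\<^bsub>free_module S (carrier M)\<^esub> delta S u) \<in> N"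
  shows "tensor_rel A S \<phi> M \<subseteq> N"
  unfolding tensor_rel_def Let_def using assms
  by (intro rmodule.mod_span_minimal[OF rfree_S]) (auto simp del: free_module_simps)

lemma tensor_rel_submodule:
  assumes M: "Module.module A M"
  shows "submodule (tensor_rel A S \<phi> M) S (free_module S (carrier M))"
proof -
  interpret M: Module.module A M by fact
  let ?F = "free_module S (carrier M)"
  interpret F: rmodule S ?F by (rule rfree_S)
  have d: "delta S u \<in> carrier ?F" if "u \<in> carrier M" for u
    using delta_fin_supp[OF S.is_cring that] by simp
  show ?thesis unfolding tensor_rel_def Let_def
    by (intro F.mod_span_submodule) (auto simp del: free_module_simps intro!: F.M.minus_closed F.M.a_closed F.smult_closed d)
qed

text \<open>Functoriality of the tensor product: the coefficient families pushed to a relation form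
  a submodule, and it contains the generating relations because \<open>h\<close> is linear.\<close>

lemma push_coeffs_tensor_rel:
  assumes M: "Module.module A M" and N: "Module.module A N" and h: "h \<in> module_hom A M N"
    and c: "c \<in> tensor_rel A S \<phi> M"
  shows "push_coeffs S h c \<in> tensor_rel A S \<phi> N"
proof -
  interpret M: Module.module A M by fact
  interpret N: Module.module A N by fact
  let ?F = "free_module S (carrier M)" and ?G = "free_module S (carrier N)"
  interpret F: rmodule S ?F by (rule rfree_S)
  interpret G: rmodule S ?G by (rule rfree_S)
  have hf: "h \<in> carrier M \<rightarrow> carrier N" using module_homD(1)[OF h] by auto
  note p = push_coeffs_hom[OF hf]
  note pD = module_homD[OF p] module_hom_diff[OF free_S free_S p]
  have d: "delta S u \<in> carrier ?F" if "u \<in> carrier M" for u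
    using delta_fin_supp[OF S.is_cring that] by simp
  have "tensor_rel A S \<phi> M \<subseteq> {c \<in> carrier ?F. push_coeffs S h c \<in> tensor_rel A S \<phi> N}"
  proof (rule tensor_rel_minimal)
    show "submodule {c \<in> carrier ?F. push_coeffs S h c \<in> tensor_rel A S \<phi> N} S ?F"
      by (rule submodule_vimage[OF free_S free_S p tensor_rel_submodule[OF N]])
  next
    fix u v assume uv: "u \<in> carrier M" "v \<in> carrier M"
    have "push_coeffs S h (delta S (u \<oplus>\<^bsub>M\<^esub> v) \<ominus>\<^bsub>?F\<^esub> (delta S u \<oplus>\<^bsub>?F\<^esub> delta S v))
      = delta S (h u \<oplus>\<^bsub>N\<^esub> h v) \<ominus>\<^bsub>?G\<^esub> (delta S (h u) \<oplus>\<^bsub>?G\<^esub> delta S (h v))"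
      using uv d by (simp add: pD push_coeffs_delta[OF hf] module_homD(2)[OF h] F.M.a_closed del: free_module_simps)
    then show "delta S (u \<oplus>\<^bsub>M\<^esub> v) \<ominus>\<^bsub>?F\<^esub> (delta S u \<oplus>\<^bsub>?F\<^esub> delta S v) \<in> {c \<in> carrier ?F. push_coeffs S h c \<in> tensor_rel A S \<phi> N}"
      using uv d tensor_rel_add[of "h u" N "h v"] module_homD(1)[OF h] by (simp del: free_module_simps)
  next
    fix a u assume au: "a \<in> carrier A" "u \<in> carrier M"
    have "push_coeffs S h (delta S (a \<odot>\<^bsub>M\<^esub> u) \<ominus>\<^bsub>?F\<^esub> (\<phi> a \<odot>\<^bsub>?F\<^esub> delta S u))
      = delta S (a \<odot>\<^bsub>N\<^esub> h u) \<ominus>\<^bsub>?G\<^esub> (\<phi> a \<odot>\<^bsub>?G\<^esub> delta S (h u))"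
      using au d by (simp add: pD push_coeffs_delta[OF hf] module_homD(3)[OF h] F.smult_closed del: free_module_simps)
    then show "delta S (a \<odot>\<^bsub>M\<^esub> u) \<ominus>\<^bsub>?F\<^esub> (\<phi> a \<odot>\<^bsub>?F\<^esub> delta S u) \<in> {c \<in> carrier ?F. push_coeffs S h c \<in> tensor_rel A S \<phi> N}"
      using au d tensor_rel_smult[of a "h u" N] module_homD(1)[OF h] by (simp del: free_module_simps)
  qed
  with c show ?thesis by auto
qed

text \<open>A class in Tor is a coset of cosets of coefficient families. The statement is brought
  down to coefficient families, where a cycle and a boundary are conditions modulo
  \<open>tensor_rel\<close>.\<close>

lemma Tor_1_almost_zeroE:
  fixes M :: "('a, 'a univ) module"
  assumes res: "\<exists>P \<delta> (\<epsilon> :: 'a univ \<Rightarrow> 'a univ). free_resolution A M P \<delta> \<epsilon>"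
    and az: "almost_zero p \<kappa> (Tor A S \<phi> 1 M)" and \<kappa>: "\<And>k. \<kappa> (Kcirc_root p k) \<in> carrier S"
  obtains P \<delta> and \<epsilon> :: "'a univ \<Rightarrow> 'a univ" where "free_resolution A M P \<delta> \<epsilon>"
    "\<And>\<xi> k. \<xi> \<in> fin_supp S (carrier (P 1)) \<Longrightarrow> push_coeffs S (\<delta> 0) \<xi> \<in> tensor_rel A S \<phi> (P 0) \<Longrightarrow> k > 0 \<Longrightarrow>
      \<exists>c \<in> fin_supp S (carrier (P 2)). \<kappa> (Kcirc_root p k) \<odot>\<^bsub>free_module S (carrier (P 1))\<^esub> \<xi>
         \<ominus>\<^bsub>free_module S (carrier (P 1))\<^esub> push_coeffs S (\<delta> 1) c \<in> tensor_rel A S \<phi> (P 1)"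
proof -
  obtain P \<delta> where P\<delta>: "(SOME (P, \<delta>). \<exists>\<epsilon> :: 'a univ \<Rightarrow> 'a univ. free_resolution A M P \<delta> \<epsilon>) = (P, \<delta>)"
    by (rule prod.exhaust)
  have "case (SOME (P, \<delta>). \<exists>\<epsilon> :: 'a univ \<Rightarrow> 'a univ. free_resolution A M P \<delta> \<epsilon>) of
    (P, \<delta>) \<Rightarrow> \<exists>\<epsilon> :: 'a univ \<Rightarrow> 'a univ. free_resolution A M P \<delta> \<epsilon>"
    by (rule someI_ex) (use res in auto)
  then obtain \<epsilon> :: "'a univ \<Rightarrow> 'a univ" where fr: "free_resolution A M P \<delta> \<epsilon>" unfolding P\<delta> by auto
  have mod: "Module.module A (P n)" and \<delta>: "\<delta> n \<in> module_hom A (P (Suc n)) (P n)" for n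
    using fr by (auto simp: free_resolution_def)
  define F where "F n = free_module S (carrier (P n))" for n
  define T where "T n = tensor A S \<phi> (P n)" for n
  define r where "r n = tensor_rel A S \<phi> (P n)" for n
  define D where "D n = tensor_map A S \<phi> (P n) (\<delta> n)" for n
  have Fm: "rmodule S (F n)" for n unfolding F_def by (rule rfree_S)
  have rsub: "submodule (r n) S (F n)" for n unfolding r_def F_def by (rule tensor_rel_submodule[OF mod])
  have pn: "push_coeffs S (\<delta> n) \<in> module_hom S (F (Suc n)) (F n)" for n
    unfolding F_def using module_homD(1)[OF \<delta>] by (intro push_coeffs_hom) auto
  have T: "T n = quot_module S (F n) (r n)" for n by (simp add: T_def tensor_def F_def r_def)
  have TS: "carrier (T n) = a_rcosets\<^bsub>F n\<^esub> (r n)" "\<zero>\<^bsub>T n\<^esub> = r n" "ring.add (T n) = set_add (F n)"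
    "\<And>a U. a \<odot>\<^bsub>T n\<^esub> U = (\<Union>u\<in>U. r n +>\<^bsub>F n\<^esub> (a \<odot>\<^bsub>F n\<^esub> u))" for n
    by (simp_all add: T quot_module_def)
  have D: "D n U = (\<Union>c\<in>U. r n +>\<^bsub>F n\<^esub> push_coeffs S (\<delta> n) c)" for n U
    by (simp add: D_def tensor_map_def r_def F_def)
  define Z where "Z = a_kernel (T 1) (T 0) (D 0)"
  define N where "N = D 1 ` carrier (T 2)"
  have Tor: "Tor A S \<phi> 1 M = quot_module S ((T 1)\<lparr>carrier := Z\<rparr>) N"
    unfolding Tor_def P\<delta> T_def D_def Z_def N_def Let_def by (simp add: numeral_2_eq_2)
  interpret F1: rmodule S "F 1" by (rule Fm)
  interpret F0: rmodule S "F 0" by (rule Fm)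
  interpret F2: rmodule S "F 2" by (rule Fm)
  note r_sub = rsub[THEN submodule.axioms(1)]
  interpret r0: abelian_subgroup "r 0" "F 0" by (rule F0.submodule_abelian_subgroup[OF rsub])
  interpret r1: abelian_subgroup "r 1" "F 1" by (rule F1.submodule_abelian_subgroup[OF rsub])
  interpret r2: abelian_subgroup "r 2" "F 2" by (rule F2.submodule_abelian_subgroup[OF rsub])
  have p0: "push_coeffs S (\<delta> 0) \<in> module_hom S (F 1) (F 0)" using pn[of 0] by simp
  have p1: "push_coeffs S (\<delta> 1) \<in> module_hom S (F 2) (F 1)" using pn[of 1] by (simp add: numeral_2_eq_2)
  have prel: "push_coeffs S (\<delta> 0) c \<in> r 0" if "c \<in> r 1" for c
    using push_coeffs_tensor_rel[OF mod mod \<delta>] that unfolding r_def by simp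
  have "\<exists>c \<in> carrier (F 2). \<kappa> (Kcirc_root p k) \<odot>\<^bsub>F 1\<^esub> \<xi> \<ominus>\<^bsub>F 1\<^esub> push_coeffs S (\<delta> 1) c \<in> r 1"
    if \<xi>: "\<xi> \<in> carrier (F 1)" and cyc: "push_coeffs S (\<delta> 0) \<xi> \<in> r 0" and k: "k > 0" for \<xi> k
  proof -
    define X where "X = r 1 +>\<^bsub>F 1\<^esub> \<xi>"
    let ?s = "\<kappa> (Kcirc_root p k)"
    have \<xi>X: "\<xi> \<in> X" unfolding X_def by (rule r1.a_rcos_self[OF \<xi>])
    have X1: "X \<in> carrier (T 1)" unfolding TS X_def using \<xi> r1.a_subset by (intro F1.M.a_rcosetsI)
    have "D 0 X = r 0"
    proof -
      have "r 0 +>\<^bsub>F 0\<^esub> push_coeffs S (\<delta> 0) c = r 0" if cX: "c \<in> X" for c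
      proof -
        obtain t where t: "t \<in> r 1" "c = t \<oplus>\<^bsub>F 1\<^esub> \<xi>" using cX by (auto simp: X_def a_r_coset_def')
        then have "push_coeffs S (\<delta> 0) c = push_coeffs S (\<delta> 0) t \<oplus>\<^bsub>F 0\<^esub> push_coeffs S (\<delta> 0) \<xi>"
          using module_homD(2)[OF p0, of t \<xi>] \<xi> r1.a_subset by auto
        then show ?thesis using prel[OF t(1)] cyc by (intro r0.a_rcos_const) (simp add: r0.a_closed)
      qed
      then show ?thesis unfolding D using \<xi>X by auto
    qed
    then have XZ: "X \<in> Z" using X1 by (simp add: Z_def a_kernel_def' TS)
    let ?TZ = "(T 1)\<lparr>carrier := Z\<rparr>"
    define z where "z = N +>\<^bsub>?TZ\<^esub> X"
    have "z \<in> carrier (Tor A S \<phi> 1 M)"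
      unfolding Tor quot_module_def z_def using XZ by (auto simp: A_RCOSETS_def')
    then have "?s \<odot>\<^bsub>Tor A S \<phi> 1 M\<^esub> z = \<zero>\<^bsub>Tor A S \<phi> 1 M\<^esub>"
      using az k by (auto simp: almost_zero_def almost_zero_elt_def)
    then have kz: "(\<Union>u\<in>z. N +>\<^bsub>?TZ\<^esub> (?s \<odot>\<^bsub>T 1\<^esub> u)) = N"
      unfolding Tor quot_module_def by simp
    have cos: "N +>\<^bsub>?TZ\<^esub> U = (\<lambda>n. n <+>\<^bsub>F 1\<^esub> U) ` N" for U
      by (auto simp: a_r_coset_def' TS)
    \<comment> \<open>The boundary of the zero coset contains zero, so adding \<open>n0\<close> to a
      set keeps its elements. This carries \<xi> through the nested cosets by plain set
      membership.\<close>
    define n0 where "n0 = D 1 (r 2 +>\<^bsub>F 2\<^esub> \<zero>\<^bsub>F 2\<^esub>)"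
    have n0N: "n0 \<in> N" unfolding N_def n0_def TS
      by (intro imageI F2.M.a_rcosetsI r2.a_subset F2.M.zero_closed)
    have "\<zero>\<^bsub>F 2\<^esub> \<in> r 2 +>\<^bsub>F 2\<^esub> \<zero>\<^bsub>F 2\<^esub>" by (rule r2.a_rcos_self[OF F2.M.zero_closed])
    moreover have "\<zero>\<^bsub>F 1\<^esub> \<in> r 1 +>\<^bsub>F 1\<^esub> push_coeffs S (\<delta> 1) \<zero>\<^bsub>F 2\<^esub>"
      unfolding module_hom_zero[OF F2.is_module F1.is_module p1] by (rule r1.a_rcos_self[OF F1.M.zero_closed])
    ultimately have 0: "\<zero>\<^bsub>F 1\<^esub> \<in> n0" unfolding n0_def D by blast
    define u0 where "u0 = n0 <+>\<^bsub>F 1\<^esub> X"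
    have u0z: "u0 \<in> z" unfolding z_def cos u0_def using n0N by blast
    have add0: "x \<in> n0 <+>\<^bsub>F 1\<^esub> Y" if "x \<in> Y" "x \<in> carrier (F 1)" for x Y
    proof -
      have "x \<in> {\<zero>\<^bsub>F 1\<^esub> \<oplus>\<^bsub>F 1\<^esub> x}" using F1.M.l_zero[OF that(2)] by simp
      then show ?thesis unfolding set_add_def' using 0 that(1) by blast
    qed
    have \<xi>u0: "\<xi> \<in> u0" unfolding u0_def by (rule add0[OF \<xi>X \<xi>])
    define v0 where "v0 = ?s \<odot>\<^bsub>T 1\<^esub> u0"
    have s\<xi>: "?s \<odot>\<^bsub>F 1\<^esub> \<xi> \<in> carrier (F 1)" by (rule F1.smult_closed[OF \<kappa> \<xi>])
    have "?s \<odot>\<^bsub>F 1\<^esub> \<xi> \<in> v0" unfolding v0_def TS using r1.a_rcos_self[OF s\<xi>] \<xi>u0 by blast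
    then have "?s \<odot>\<^bsub>F 1\<^esub> \<xi> \<in> n0 <+>\<^bsub>F 1\<^esub> v0" by (rule add0[OF _ s\<xi>])
    moreover have "n0 <+>\<^bsub>F 1\<^esub> v0 \<in> N" using kz u0z n0N unfolding cos v0_def by blast
    ultimately obtain U where U: "U \<in> carrier (T 2)" "?s \<odot>\<^bsub>F 1\<^esub> \<xi> \<in> D 1 U" unfolding N_def by blast
    then obtain c where c: "c \<in> U" "?s \<odot>\<^bsub>F 1\<^esub> \<xi> \<in> r 1 +>\<^bsub>F 1\<^esub> push_coeffs S (\<delta> 1) c" unfolding D by blast
    have "c \<in> carrier (F 2)" using U(1) c(1) r2.a_rcosets_carrier unfolding TS by blast
    moreover from this have "push_coeffs S (\<delta> 1) c \<in> carrier (F 1)" by (rule module_homD(1)[OF p1])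
    then have "?s \<odot>\<^bsub>F 1\<^esub> \<xi> \<ominus>\<^bsub>F 1\<^esub> push_coeffs S (\<delta> 1) c \<in> r 1"
      using c(2) s\<xi> r1.a_rcos_module_imp unfolding a_minus_def by blast
    ultimately show ?thesis by blast
  qed
  then show ?thesis
    by (intro that[OF fr]) (simp add: F_def r_def)
qed

end

section \<open>Almost flatness and colon ideals\<close>

lemma (in cring) idealI_smult:
  assumes sub: "C \<subseteq> carrier R" and ne: "C \<noteq> {}"
    and add: "\<And>a b. a \<in> C \<Longrightarrow> b \<in> C \<Longrightarrow> a \<oplus> b \<in> C"
    and mult: "\<And>r a. r \<in> carrier R \<Longrightarrow> a \<in> C \<Longrightarrow> r \<otimes> a \<in> C"
  shows "ideal C R"
proof (rule idealI[OF ring_axioms])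
  have "\<ominus> a \<in> C" if "a \<in> C" for a
    using mult[of "\<ominus> \<one>" a] that sub l_minus[of \<one> a] by auto
  then show "subgroup C (add_monoid R)"
    using sub ne add by (intro add.subgroupI) (auto simp: a_inv_def[symmetric])
  show "x \<otimes> a \<in> C" if "a \<in> C" "x \<in> carrier R" for a x using that by (rule_tac mult)
  then show "a \<otimes> x \<in> C" if "a \<in> C" "x \<in> carrier R" for a x
    using that sub m_comm[of a x] by auto
qed

lemma submodule_self_module_iff_ideal:
  fixes R :: "'a ring"
  assumes R: "cring R"
  shows "submodule N R (self_module R) \<longleftrightarrow> ideal N R"
proof -
  interpret R: cring R by fact
  interpret L: rmodule R "self_module R" by (intro rmoduleI self_module_module R)
  show ?thesis
  proof
    assume N: "submodule N R (self_module R)"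
    note NE = L.submoduleE[OF N] L.submodule_zero[OF N]
    have NR: "N \<subseteq> carrier R" using NE(1) by simp
    show "ideal N R" using NE NR by (intro R.idealI_smult) auto
  next
    assume N: "ideal N R"
    interpret N: ideal N R by fact
    show "submodule N R (self_module R)"
      by (rule L.submoduleI) (auto simp: self_module_a_inv N.I_l_closed)
  qed
qed

lemma (in abelian_group) minus_minus_cancel_left:
  assumes "x \<in> carrier G" "y \<in> carrier G" "z \<in> carrier G"
  shows "(x \<ominus> y) \<ominus> (x \<ominus> z) = z \<ominus> y"
proof -
  have "(x \<ominus> y) \<ominus> (x \<ominus> z) = (x \<oplus> \<ominus> x) \<oplus> (z \<oplus> \<ominus> y)"
    using assms by (simp add: a_minus_def minus_add a_ac del: r_neg)
  then show ?thesis using assms by (simp add: a_minus_def r_neg)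
qed

context ideal
begin

lemma minus_mem: "a \<in> I \<Longrightarrow> b \<in> I \<Longrightarrow> a \<ominus> b \<in> I"
  by (simp add: a_minus_def)

lemma mem_if_minus_mem:
  assumes "a \<ominus> b \<in> I" "b \<in> I" "a \<in> carrier R"
  shows "a \<in> I"
proof -
  have "(a \<ominus> b) \<oplus> b \<in> I" using assms by blast
  moreover have "(a \<ominus> b) \<oplus> b = a" using assms Icarr[of b] by (simp add: a_minus_def a_assoc l_neg)
  ultimately show ?thesis by simp
qed

end

text \<open>Besides colon ideals proper, this is the device for proving a statement about all
  elements of a generated ideal: the elements satisfying it form a colon ideal, and only generators
  have to be checked.\<close>

lemma (in cring) colon_ideal:
  assumes "ideal I R" "u \<in> carrier R"
  shows "ideal {a \<in> carrier R. a \<otimes> u \<in> I} R"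
proof -
  interpret I: ideal I R by fact
  have "\<zero> \<in> {a \<in> carrier R. a \<otimes> u \<in> I}" using assms(2) by simp
  then show ?thesis using assms(2) I.I_l_closed by (intro idealI_smult) (auto simp: l_distr m_assoc)
qed

context base_change
begin

lemma \<phi>_image_carrier: "X \<subseteq> carrier A \<Longrightarrow> \<phi> ` X \<subseteq> carrier S"
  by auto

lemma ideal_extension: "ideal I A \<Longrightarrow> ideal (Idl\<^bsub>S\<^esub> (\<phi> ` I)) S"
  by (intro S.genideal_ideal \<phi>_image_carrier) (auto dest: ideal.Icarr)

lemma ideal_extension_mem: "ideal I A \<Longrightarrow> a \<in> I \<Longrightarrow> \<phi> a \<in> Idl\<^bsub>S\<^esub> (\<phi> ` I)"
  by (rule set_mp[OF S.genideal_self]) (auto dest: ideal.Icarr)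

lemma ideal_extension_mono: "I \<subseteq> J \<Longrightarrow> ideal J A \<Longrightarrow> Idl\<^bsub>S\<^esub> (\<phi> ` I) \<subseteq> Idl\<^bsub>S\<^esub> (\<phi> ` J)"
  by (intro S.genideal_minimal ideal_extension) (auto intro: ideal_extension_mem)

text \<open>A relation \<open>c \<phi>(u) = \<Sum> s\<^sub>t \<phi>(i\<^sub>t)\<close> with \<open>i\<^sub>t \<in> I\<close> gives a cycle in degree one of \<open>P \<otimes> S\<close> for any free
  resolution \<open>P\<close> of \<open>A / (I + uA)\<close>, and \<open>\<theta>\<close> is the first component of a comparison map from \<open>P\<close> to
  a resolution beginning with a surjection \<open>A \<oplus> \<dots> \<rightarrow> I + uA\<close>, reading off the coefficient of \<open>u\<close>,
  which is well defined modulo \<open>(I : u)\<close>.\<close>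

lemma almost_flat_colon:
  assumes flat: "almost_flat p A S \<kappa> \<phi>" and \<kappa>: "\<And>k. \<kappa> (Kcirc_root p k) \<in> carrier S"
    and inf: "infinite (UNIV :: 'a set)" and nz: "\<one> \<noteq> \<zero>"
    and I: "ideal I A" and u: "u \<in> carrier A" and c: "c \<in> carrier S"
    and cu: "c \<otimes>\<^bsub>S\<^esub> \<phi> u \<in> Idl\<^bsub>S\<^esub> (\<phi> ` I)" and k: "k > 0"
  shows "\<kappa> (Kcirc_root p k) \<otimes>\<^bsub>S\<^esub> c \<in> Idl\<^bsub>S\<^esub> (\<phi> ` {a \<in> carrier A. a \<otimes> u \<in> I})"
proof -
  note One_nat_def [simp del]
  define J where "J = {a \<in> carrier A. a \<otimes> u \<in> I}"
  have J: "ideal J A" unfolding J_def by (rule A.colon_ideal[OF I u])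
  interpret I: ideal I A by fact
  have J_I: "a \<in> J" if "a \<in> carrier A" "a \<otimes> u \<in> I" for a using that by (simp add: J_def)
  have IJ: "I \<subseteq> J" using I.I_r_closed[OF _ u] I.Icarr by (blast intro: J_I)
  define JS where "JS = Idl\<^bsub>S\<^esub> (\<phi> ` J)"
  have JS: "ideal JS S" unfolding JS_def by (rule ideal_extension[OF J])
  interpret JS: ideal JS S by fact
  have JJS: "\<phi> a \<in> JS" if "a \<in> J" for a unfolding JS_def by (rule ideal_extension_mem[OF J that])
  define K where "K = I <+>\<^bsub>A\<^esub> PIdl u"
  have K: "ideal K A" unfolding K_def by (rule A.add_ideals[OF I A.cgenideal_ideal[OF u]])
  interpret K: ideal K A by fact
  have K_iff: "b \<in> K \<longleftrightarrow> (\<exists>t\<in>carrier A. b \<ominus> t \<otimes> u \<in> I)" if b: "b \<in> carrier A" for b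
  proof
    assume "b \<in> K"
    then obtain i t where it: "i \<in> I" "t \<in> carrier A" "b = i \<oplus> t \<otimes> u"
      unfolding K_def set_add_def' cgenideal_def by auto
    have "b \<ominus> t \<otimes> u = i" using it u I.Icarr[OF it(1)] by (simp add: a_minus_def A.a_assoc A.r_neg)
    with it(1,2) show "\<exists>t\<in>carrier A. b \<ominus> t \<otimes> u \<in> I" by (intro bexI[of _ t]) simp_all
  next
    assume "\<exists>t\<in>carrier A. b \<ominus> t \<otimes> u \<in> I"
    then obtain t where t: "t \<in> carrier A" "b \<ominus> t \<otimes> u \<in> I" by auto
    have "b = (b \<ominus> t \<otimes> u) \<oplus> t \<otimes> u" using t b u by (simp add: a_minus_def A.a_assoc A.l_neg)
    with t show "b \<in> K" unfolding K_def set_add_def' cgenideal_def by blast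
  qed
  have IK: "i \<in> K" if "i \<in> I" for i
    using that I.Icarr[OF that] u by (subst K_iff) (auto intro!: bexI[of _ "\<zero>"] simp: a_minus_def)
  have uK: "u \<in> K"
    using u by (subst K_iff) (auto intro!: bexI[of _ "\<one>"] simp: a_minus_def A.r_neg)
  obtain M :: "('a, 'a univ) module" and q where M: "Module.module A M" and q: "q \<in> module_hom A (self_module A) M"
    and q_surj: "q ` carrier A = carrier M" and q_ker: "\<And>a. a \<in> carrier A \<Longrightarrow> q a = \<zero>\<^bsub>M\<^esub> \<longleftrightarrow> a \<in> K"
    by (rule cyclic_module_exists[OF A.is_cring K], rule that)
  have az: "almost_zero p \<kappa> (Tor A S \<phi> 1 M)" using flat M by (auto simp: almost_flat_def)
  obtain P \<delta> and \<epsilon> :: "'a univ \<Rightarrow> 'a univ" where fr: "free_resolution A M P \<delta> \<epsilon>"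
    and tor: "\<And>\<xi> k. \<xi> \<in> fin_supp S (carrier (P 1)) \<Longrightarrow> push_coeffs S (\<delta> 0) \<xi> \<in> tensor_rel A S \<phi> (P 0) \<Longrightarrow> k > 0 \<Longrightarrow>
      \<exists>c \<in> fin_supp S (carrier (P 2)). \<kappa> (Kcirc_root p k) \<odot>\<^bsub>free_module S (carrier (P 1))\<^esub> \<xi>
         \<ominus>\<^bsub>free_module S (carrier (P 1))\<^esub> push_coeffs S (\<delta> 1) c \<in> tensor_rel A S \<phi> (P 1)"
    by (rule Tor_1_almost_zeroE[OF free_resolution_exists[OF A.is_cring inf nz M q q_surj] az \<kappa>], rule that)
  have mod: "Module.module A (P n)" and \<delta>: "\<delta> n \<in> module_hom A (P (Suc n)) (P n)" and free: "is_free A (P n)" for n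
    using fr by (auto simp: free_resolution_def)
  have \<epsilon>: "\<epsilon> \<in> module_hom A (P 0) M" and \<epsilon>_surj: "\<epsilon> ` carrier (P 0) = carrier M"
    and ex0: "a_kernel (P 0) M \<epsilon> = \<delta> 0 ` carrier (P 1)"
    and ex1: "a_kernel (P 1) (P 0) (\<delta> 0) = \<delta> 1 ` carrier (P 2)"
    using fr by (auto simp: free_resolution_def numeral_2_eq_2 One_nat_def)
  have \<delta>0: "\<delta> 0 \<in> module_hom A (P 1) (P 0)" and \<delta>1: "\<delta> 1 \<in> module_hom A (P 2) (P 1)"
    using \<delta>[of 0] \<delta>[of 1] by (auto simp: numeral_2_eq_2 One_nat_def)
  interpret P0: rmodule A "P 0" by (rule rmoduleI[OF mod])
  interpret P1: rmodule A "P 1" by (rule rmoduleI[OF mod])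
  interpret P2: rmodule A "P 2" by (rule rmoduleI[OF mod])
  interpret AM: rmodule A "self_module A" by (intro rmoduleI self_module_module A.is_cring)
  interpret SM: rmodule S "self_module S" by (intro rmoduleI self_module_module S.is_cring)
  obtain B \<chi> where B: "B \<subseteq> carrier (P 0)" and \<chi>: "\<chi> \<in> module_hom A (P 0) (free_module A B)"
    and \<chi>_eq: "\<And>v. v \<in> carrier (P 0) \<Longrightarrow> lin_comb A (P 0) (\<lambda>b. b) (\<chi> v) = v"
    by (rule is_free_coordinates[OF A.is_cring mod free], rule that)
  \<comment> \<open>Projectivity of \<open>P 0\<close> by hand: \<epsilon> is lifted along the
    surjection \<open>q\<close> on a basis, which yields \<open>l\<close> with
    \<open>q (l v) = \<epsilon> v\<close>.\<close>
  define w where "w b = (SOME a. a \<in> carrier A \<and> q a = \<epsilon> b)" for b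
  have w: "w b \<in> carrier A" "q (w b) = \<epsilon> b" if "b \<in> B" for b
  proof -
    have "\<epsilon> b \<in> q ` carrier A" using that B module_homD(1)[OF \<epsilon>] q_surj by auto
    then have "\<exists>a. a \<in> carrier A \<and> q a = \<epsilon> b" by auto
    then have "w b \<in> carrier A \<and> q (w b) = \<epsilon> b" unfolding w_def by (rule someI_ex)
    then show "w b \<in> carrier A" "q (w b) = \<epsilon> b" by auto
  qed
  define l where "l v = lin_comb A (self_module A) w (\<chi> v)" for v
  have l: "l \<in> module_hom A (P 0) (self_module A)"
    unfolding l_def by (intro module_hom_comp[OF \<chi> AM.lin_comb_hom]) (auto simp: w)
  note lD = module_homD[OF l, simplified]
  have ql: "q (l v) = \<epsilon> v" if v: "v \<in> carrier (P 0)" for v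
  proof -
    have \<chi>v: "\<chi> v \<in> fin_supp A B" using module_homD(1)[OF \<chi> v] by simp
    have "q (l v) = lin_comb A M (\<lambda>b. q (w b)) (\<chi> v)"
      unfolding l_def using w by (intro module_hom_lin_comb[OF AM.is_module M q \<chi>v]) auto
    also have "\<dots> = lin_comb A M (\<lambda>b. \<epsilon> b) (\<chi> v)"
    proof -
      interpret M: rmodule A M by (rule rmoduleI[OF M])
      show ?thesis unfolding lin_comb_def
        using w B fin_suppD[OF \<chi>v] module_homD(1)[OF \<epsilon>] by (intro M.M.finsum_cong') auto
    qed
    also have "\<dots> = \<epsilon> (lin_comb A (P 0) (\<lambda>b. b) (\<chi> v))"
      using B by (intro module_hom_lin_comb[OF mod M \<epsilon> \<chi>v, symmetric]) auto
    finally show ?thesis by (simp add: \<chi>_eq[OF v])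
  qed
  have q1: "q \<one> \<in> carrier M" using q_surj by auto
  \<comment> \<open>A lift of the generator in the opposite direction. By exactness every
    \<open>a\<close> in \<open>K\<close> then appears in the unknown resolution as some
    \<open>v\<close> with \<open>\<delta> 0 v = a e0\<close>.\<close>
  then obtain e0 where e0: "e0 \<in> carrier (P 0)" "\<epsilon> e0 = q \<one>" using \<epsilon>_surj by (metis imageE)
  have \<epsilon>a: "\<epsilon> (a \<odot>\<^bsub>P 0\<^esub> e0) = q a" if "a \<in> carrier A" for a
    using module_homD(3)[OF \<epsilon> that e0(1)] module_homD(3)[OF q that, of "\<one>"] that e0(2) by simp
  have lift: "\<exists>v \<in> carrier (P 1). \<delta> 0 v = a \<odot>\<^bsub>P 0\<^esub> e0" if a: "a \<in> K" for a
  proof -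
    have "a \<odot>\<^bsub>P 0\<^esub> e0 \<in> a_kernel (P 0) M \<epsilon>"
      using K.Icarr[OF a] \<epsilon>a q_ker a e0 by (simp add: a_kernel_def')
    then show ?thesis unfolding ex0 by auto
  qed
  have lK: "l (\<delta> 0 v) \<in> K" if v: "v \<in> carrier (P 1)" for v
  proof -
    have "\<delta> 0 v \<in> a_kernel (P 0) M \<epsilon>" using v unfolding ex0 by blast
    then have "\<epsilon> (\<delta> 0 v) = \<zero>\<^bsub>M\<^esub>" "\<delta> 0 v \<in> carrier (P 0)" by (auto simp: a_kernel_def')
    with ql show ?thesis using q_ker lD(1) by metis
  qed
  define \<theta> where "\<theta> v = (SOME t. t \<in> carrier A \<and> l (\<delta> 0 v) \<ominus> t \<otimes> u \<in> I)" for v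
  have d0: "\<delta> 0 v \<in> carrier (P 0)" if "v \<in> carrier (P 1)" for v using module_homD(1)[OF \<delta>0 that] .
  have \<theta>: "\<theta> v \<in> carrier A" "l (\<delta> 0 v) \<ominus> \<theta> v \<otimes> u \<in> I" if v: "v \<in> carrier (P 1)" for v
  proof -
    have "\<exists>t. t \<in> carrier A \<and> l (\<delta> 0 v) \<ominus> t \<otimes> u \<in> I"
      using lK[OF v] K_iff[of "l (\<delta> 0 v)"] lD(1)[OF d0[OF v]] by blast
    then have "\<theta> v \<in> carrier A \<and> l (\<delta> 0 v) \<ominus> \<theta> v \<otimes> u \<in> I" unfolding \<theta>_def by (rule someI_ex)
    then show "\<theta> v \<in> carrier A" "l (\<delta> 0 v) \<ominus> \<theta> v \<otimes> u \<in> I" by auto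
  qed
  \<comment> \<open>Two expressions of \<open>l (\<delta> 0 v)\<close> as a multiple of
    \<open>u\<close> modulo \<open>I\<close> are subtracted; the difference of the coefficients
    multiplies \<open>u\<close> into \<open>I\<close>. Linearity of \<theta> modulo \<open>J\<close>
    follows by exhibiting the expected coefficient.\<close>
  have \<theta>_unique: "\<theta> v \<ominus> t \<in> J" if v: "v \<in> carrier (P 1)" and t: "t \<in> carrier A" "l (\<delta> 0 v) \<ominus> t \<otimes> u \<in> I" for v t
  proof -
    have lv: "l (\<delta> 0 v) \<in> carrier A" by (rule lD(1)[OF d0[OF v]])
    have "(l (\<delta> 0 v) \<ominus> t \<otimes> u) \<ominus> (l (\<delta> 0 v) \<ominus> \<theta> v \<otimes> u) \<in> I"
      by (rule I.minus_mem[OF t(2) \<theta>(2)[OF v]])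
    moreover have "(l (\<delta> 0 v) \<ominus> t \<otimes> u) \<ominus> (l (\<delta> 0 v) \<ominus> \<theta> v \<otimes> u) = (\<theta> v \<ominus> t) \<otimes> u"
      using lv t(1) u \<theta>(1)[OF v] A.minus_minus_cancel_left[of "l (\<delta> 0 v)" "t \<otimes> u" "\<theta> v \<otimes> u"]
      by (simp add: a_minus_def A.l_distr A.l_minus)
    ultimately show ?thesis using \<theta>(1)[OF v] t(1) by (intro J_I) auto
  qed
  have \<theta>_add: "\<theta> (v \<oplus>\<^bsub>P 1\<^esub> v') \<ominus> (\<theta> v \<oplus> \<theta> v') \<in> J" if v: "v \<in> carrier (P 1)" "v' \<in> carrier (P 1)" for v v'
  proof (rule \<theta>_unique)
    have l2: "l (\<delta> 0 (v \<oplus>\<^bsub>P 1\<^esub> v')) = l (\<delta> 0 v) \<oplus> l (\<delta> 0 v')"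
      using module_homD(2)[OF \<delta>0 v] lD(2) d0 v by simp
    have "(l (\<delta> 0 v) \<ominus> \<theta> v \<otimes> u) \<oplus> (l (\<delta> 0 v') \<ominus> \<theta> v' \<otimes> u) \<in> I"
      using \<theta>(2)[OF v(1)] \<theta>(2)[OF v(2)] by blast
    moreover have "(l (\<delta> 0 v) \<ominus> \<theta> v \<otimes> u) \<oplus> (l (\<delta> 0 v') \<ominus> \<theta> v' \<otimes> u)
      = (l (\<delta> 0 v) \<oplus> l (\<delta> 0 v')) \<ominus> (\<theta> v \<oplus> \<theta> v') \<otimes> u"
      using lD(1)[OF d0[OF v(1)]] lD(1)[OF d0[OF v(2)]] \<theta>(1)[OF v(1)] \<theta>(1)[OF v(2)] u
      by (simp add: a_minus_def A.ring_simprules)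
    ultimately show "l (\<delta> 0 (v \<oplus>\<^bsub>P 1\<^esub> v')) \<ominus> (\<theta> v \<oplus> \<theta> v') \<otimes> u \<in> I" by (simp only: l2)
  qed (use v \<theta> in auto)
  have \<theta>_smult: "\<theta> (a \<odot>\<^bsub>P 1\<^esub> v) \<ominus> a \<otimes> \<theta> v \<in> J" if a: "a \<in> carrier A" and v: "v \<in> carrier (P 1)" for a v
  proof (rule \<theta>_unique)
    have l2: "l (\<delta> 0 (a \<odot>\<^bsub>P 1\<^esub> v)) = a \<otimes> l (\<delta> 0 v)"
      using module_homD(3)[OF \<delta>0 a v] lD(3) d0 a v by simp
    have "a \<otimes> (l (\<delta> 0 v) \<ominus> \<theta> v \<otimes> u) \<in> I" by (rule I.I_l_closed[OF \<theta>(2)[OF v] a])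
    moreover have "a \<otimes> (l (\<delta> 0 v) \<ominus> \<theta> v \<otimes> u) = a \<otimes> l (\<delta> 0 v) \<ominus> (a \<otimes> \<theta> v) \<otimes> u"
      using lD(1)[OF d0[OF v]] \<theta>(1)[OF v] u a by (simp add: a_minus_def A.ring_simprules)
    ultimately show "l (\<delta> 0 (a \<odot>\<^bsub>P 1\<^esub> v)) \<ominus> (a \<otimes> \<theta> v) \<otimes> u \<in> I" by (simp only: l2)
  qed (use a v \<theta> in auto)
  have \<theta>_J: "\<theta> v \<in> J" if v: "v \<in> carrier (P 1)" and "l (\<delta> 0 v) \<in> I" for v
    using \<theta>_unique[OF v, of "\<zero>"] that \<theta>(1)[OF v] lD(1)[OF d0[OF v]] u by (simp add: a_minus_def)
  let ?F0 = "free_module S (carrier (P 0))" and ?F1 = "free_module S (carrier (P 1))" and ?F2 = "free_module S (carrier (P 2))"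
  let ?p0 = "push_coeffs S (\<delta> 0)" and ?p1 = "push_coeffs S (\<delta> 1)" and ?e0 = "delta S e0"
  interpret F0: rmodule S ?F0 by (rule rfree_S)
  interpret F1: rmodule S ?F1 by (rule rfree_S)
  define \<Theta> where "\<Theta> = lin_comb S (self_module S) (\<lambda>v. \<phi> (\<theta> v))"
  have w\<Theta>: "(\<lambda>v. \<phi> (\<theta> v)) \<in> carrier (P 1) \<rightarrow> carrier (self_module S)" using \<theta>(1) by auto
  have \<Theta>: "\<Theta> \<in> module_hom S ?F1 (self_module S)" unfolding \<Theta>_def by (rule SM.lin_comb_hom[OF w\<Theta>])
  note \<Theta>D = module_homD[OF \<Theta>, unfolded self_module_simps]
  have \<Theta>_diff: "\<Theta> (x \<ominus>\<^bsub>?F1\<^esub> y) = \<Theta> x \<ominus>\<^bsub>S\<^esub> \<Theta> y" if "x \<in> carrier ?F1" "y \<in> carrier ?F1" for x y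
    using module_hom_diff[OF free_S SM.is_module \<Theta> that] by (simp add: a_minus_def self_module_a_inv)
  have \<Theta>_delta: "\<Theta> (delta S v) = \<phi> (\<theta> v)" if "v \<in> carrier (P 1)" for v
    unfolding \<Theta>_def by (rule SM.lin_comb_delta[OF that w\<Theta>])
  have d1: "delta S v \<in> carrier ?F1" if "v \<in> carrier (P 1)" for v using delta_fin_supp[OF S.is_cring that] by simp
  have dd0: "delta S v \<in> carrier ?F0" if "v \<in> carrier (P 0)" for v using delta_fin_supp[OF S.is_cring that] by simp
  \<comment> \<open>\<open>W\<close> is where \<Theta> vanishes modulo \<open>JS\<close>. It
    contains the tensor relations because \<theta> is linear modulo \<open>J\<close>, and the
    boundaries because \<open>\<delta> 0\<close> after \<open>\<delta> 1\<close> is zero; so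
    \<Theta> modulo \<open>JS\<close> is insensitive to both.\<close>
  define W where "W = {c \<in> carrier ?F1. \<Theta> c \<in> JS}"
  have W: "submodule W S ?F1"
    unfolding W_def by (rule submodule_vimage[OF free_S SM.is_module \<Theta>])
      (simp add: submodule_self_module_iff_ideal[OF S.is_cring] JS)
  have relW: "tensor_rel A S \<phi> (P 1) \<subseteq> W"
  proof (rule tensor_rel_minimal[OF W])
    fix v v' assume v: "v \<in> carrier (P 1)" "v' \<in> carrier (P 1)"
    have "\<Theta> (delta S (v \<oplus>\<^bsub>P 1\<^esub> v') \<ominus>\<^bsub>?F1\<^esub> (delta S v \<oplus>\<^bsub>?F1\<^esub> delta S v')) = \<phi> (\<theta> (v \<oplus>\<^bsub>P 1\<^esub> v') \<ominus> (\<theta> v \<oplus> \<theta> v'))"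
    proof -
      have "\<Theta> (delta S (v \<oplus>\<^bsub>P 1\<^esub> v') \<ominus>\<^bsub>?F1\<^esub> (delta S v \<oplus>\<^bsub>?F1\<^esub> delta S v'))
          = \<phi> (\<theta> (v \<oplus>\<^bsub>P 1\<^esub> v')) \<ominus>\<^bsub>S\<^esub> (\<phi> (\<theta> v) \<oplus>\<^bsub>S\<^esub> \<phi> (\<theta> v'))"
        using v d1 by (simp add: \<Theta>_diff \<Theta>D(2) \<Theta>_delta F1.M.a_closed del: free_module_simps)
      then show ?thesis using v \<theta>(1) by (simp add: a_minus_def del: free_module_simps)
    qed
    with JJS[OF \<theta>_add[OF v]] v d1 show "delta S (v \<oplus>\<^bsub>P 1\<^esub> v') \<ominus>\<^bsub>?F1\<^esub> (delta S v \<oplus>\<^bsub>?F1\<^esub> delta S v') \<in> W"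
      by (simp add: W_def del: free_module_simps)
  next
    fix a v assume av: "a \<in> carrier A" "v \<in> carrier (P 1)"
    have "\<Theta> (delta S (a \<odot>\<^bsub>P 1\<^esub> v) \<ominus>\<^bsub>?F1\<^esub> \<phi> a \<odot>\<^bsub>?F1\<^esub> delta S v) = \<phi> (\<theta> (a \<odot>\<^bsub>P 1\<^esub> v) \<ominus> a \<otimes> \<theta> v)"
    proof -
      have "\<Theta> (delta S (a \<odot>\<^bsub>P 1\<^esub> v) \<ominus>\<^bsub>?F1\<^esub> \<phi> a \<odot>\<^bsub>?F1\<^esub> delta S v)
          = \<phi> (\<theta> (a \<odot>\<^bsub>P 1\<^esub> v)) \<ominus>\<^bsub>S\<^esub> \<phi> a \<otimes>\<^bsub>S\<^esub> \<phi> (\<theta> v)"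
        using av d1 by (simp add: \<Theta>_diff \<Theta>D(3) \<Theta>_delta F1.smult_closed del: free_module_simps)
      then show ?thesis using av \<theta>(1) by (simp add: a_minus_def del: free_module_simps)
    qed
    with JJS[OF \<theta>_smult[OF av]] av d1 show "delta S (a \<odot>\<^bsub>P 1\<^esub> v) \<ominus>\<^bsub>?F1\<^esub> \<phi> a \<odot>\<^bsub>?F1\<^esub> delta S v \<in> W"
      by (simp add: W_def del: free_module_simps)
  qed
  have df: "\<delta> 0 \<in> carrier (P 1) \<rightarrow> carrier (P 0)" "\<delta> 1 \<in> carrier (P 2) \<rightarrow> carrier (P 1)"
    using module_homD(1)[OF \<delta>0] module_homD(1)[OF \<delta>1] by auto
  note p0 = push_coeffs_hom[OF df(1)] and p1 = push_coeffs_hom[OF df(2)]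
  have bdW: "?p1 c \<in> W" if c: "c \<in> fin_supp S (carrier (P 2))" for c
  proof -
    have "c \<in> {c \<in> carrier ?F2. ?p1 c \<in> W}"
    proof (rule free_submodule_eq_carrier[OF S.is_cring _ _ c])
      show "submodule {c \<in> carrier ?F2. ?p1 c \<in> W} S ?F2"
        by (rule submodule_vimage[OF free_S free_S p1 W])
      fix v assume v: "v \<in> carrier (P 2)"
      have \<delta>v: "\<delta> 1 v \<in> carrier (P 1)" using df v by auto
      have "\<delta> 1 v \<in> a_kernel (P 1) (P 0) (\<delta> 0)" unfolding ex1 using v by blast
      then have "\<delta> 0 (\<delta> 1 v) = \<zero>\<^bsub>P 0\<^esub>" by (simp add: a_kernel_def')
      then have "l (\<delta> 0 (\<delta> 1 v)) \<in> I" using module_hom_zero[OF mod AM.is_module l] by simp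
      from \<theta>_J[OF \<delta>v this] have "delta S (\<delta> 1 v) \<in> W" using JJS \<Theta>_delta[OF \<delta>v] d1[OF \<delta>v] by (simp add: W_def)
      then show "delta S v \<in> {c \<in> carrier ?F2. ?p1 c \<in> W}"
        using push_coeffs_delta[OF df(2) v] delta_fin_supp[OF S.is_cring v] by simp
    qed
    then show ?thesis by simp
  qed
  let ?r0 = "tensor_rel A S \<phi> (P 0)"
  have r0: "submodule ?r0 S ?F0" by (rule tensor_rel_submodule[OF mod])
  note r0E = F0.submoduleE[OF r0] F0.submodule_zero[OF r0]
  note WE = F1.submoduleE[OF W] F1.submodule_zero[OF W]
  \<comment> \<open>The scalars \<open>s\<close> for which \<open>s e0\<close> is, up to tensor
    relations, the image of an element of \<open>W\<close>. They form an ideal containing the image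
    of \<open>I\<close>, so the sum expressing \<open>c u\<close> in the extension of
    \<open>I\<close> never has to be written down.\<close>
  define C where "C = {s \<in> carrier S. \<exists>\<zeta>\<in>W. ?p0 \<zeta> \<ominus>\<^bsub>?F0\<^esub> s \<odot>\<^bsub>?F0\<^esub> ?e0 \<in> ?r0}"
  have e0d: "?e0 \<in> carrier ?F0" by (rule dd0[OF e0(1)])
  have W1: "\<zeta> \<in> carrier ?F1" "\<Theta> \<zeta> \<in> JS" if "\<zeta> \<in> W" for \<zeta> using that by (auto simp: W_def)
  have pF0: "?p0 \<zeta> \<in> carrier ?F0" if "\<zeta> \<in> W" for \<zeta> by (rule module_homD(1)[OF p0 W1(1)[OF that]])
  have C_I: "s \<in> C" if "\<zeta> \<in> W" "s \<in> carrier S" "?p0 \<zeta> \<ominus>\<^bsub>?F0\<^esub> s \<odot>\<^bsub>?F0\<^esub> ?e0 \<in> ?r0" for s \<zeta>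
    unfolding C_def using that by blast
  have C: "ideal C S"
  proof (rule S.idealI_smult)
    show "C \<subseteq> carrier S" by (auto simp: C_def)
    have "?p0 \<zero>\<^bsub>?F1\<^esub> \<ominus>\<^bsub>?F0\<^esub> \<zero>\<^bsub>S\<^esub> \<odot>\<^bsub>?F0\<^esub> ?e0 = \<zero>\<^bsub>?F0\<^esub>"
      using e0d module_hom_zero[OF free_S free_S p0] by (simp add: F0.smult_l_null F0.M.r_neg a_minus_def del: free_module_simps)
    with r0E(7) have "\<zero>\<^bsub>S\<^esub> \<in> C" by (intro C_I[OF WE(7)]) (simp_all del: free_module_simps)
    then show "C \<noteq> {}" by blast
  next
    fix s s' assume "s \<in> C" "s' \<in> C"
    then obtain \<zeta> \<zeta>' where s: "s \<in> carrier S" "s' \<in> carrier S" and \<zeta>: "\<zeta> \<in> W" "\<zeta>' \<in> W"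
      and r: "?p0 \<zeta> \<ominus>\<^bsub>?F0\<^esub> s \<odot>\<^bsub>?F0\<^esub> ?e0 \<in> ?r0"
        "?p0 \<zeta>' \<ominus>\<^bsub>?F0\<^esub> s' \<odot>\<^bsub>?F0\<^esub> ?e0 \<in> ?r0"
      by (auto simp: C_def simp del: free_module_simps)
    have "?p0 (\<zeta> \<oplus>\<^bsub>?F1\<^esub> \<zeta>') \<ominus>\<^bsub>?F0\<^esub> (s \<oplus>\<^bsub>S\<^esub> s') \<odot>\<^bsub>?F0\<^esub> ?e0
      = (?p0 \<zeta> \<ominus>\<^bsub>?F0\<^esub> s \<odot>\<^bsub>?F0\<^esub> ?e0)
        \<oplus>\<^bsub>?F0\<^esub> (?p0 \<zeta>' \<ominus>\<^bsub>?F0\<^esub> s' \<odot>\<^bsub>?F0\<^esub> ?e0)"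
      using s e0d pF0[OF \<zeta>(1)] pF0[OF \<zeta>(2)] module_homD(2)[OF p0 W1(1)[OF \<zeta>(1)] W1(1)[OF \<zeta>(2)]]
      by (simp add: a_minus_def F0.smult_l_distr F0.M.minus_add F0.M.a_ac del: free_module_simps)
    with r0E(5)[OF r] s show "s \<oplus>\<^bsub>S\<^esub> s' \<in> C" by (intro C_I[OF WE(5)[OF \<zeta>]]) (simp_all del: free_module_simps)
  next
    fix t s assume t: "t \<in> carrier S" and "s \<in> C"
    then obtain \<zeta> where s: "s \<in> carrier S" and \<zeta>: "\<zeta> \<in> W"
      and r: "?p0 \<zeta> \<ominus>\<^bsub>?F0\<^esub> s \<odot>\<^bsub>?F0\<^esub> ?e0 \<in> ?r0"
      by (auto simp: C_def simp del: free_module_simps)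
    have "?p0 (t \<odot>\<^bsub>?F1\<^esub> \<zeta>) \<ominus>\<^bsub>?F0\<^esub> (t \<otimes>\<^bsub>S\<^esub> s) \<odot>\<^bsub>?F0\<^esub> ?e0
      = t \<odot>\<^bsub>?F0\<^esub> (?p0 \<zeta> \<ominus>\<^bsub>?F0\<^esub> s \<odot>\<^bsub>?F0\<^esub> ?e0)"
      using s t e0d pF0[OF \<zeta>] module_homD(3)[OF p0 t W1(1)[OF \<zeta>]]
      by (simp add: a_minus_def F0.smult_r_distr F0.smult_r_minus F0.smult_assoc1 del: free_module_simps)
    with r0E(4)[OF t r] s t show "t \<otimes>\<^bsub>S\<^esub> s \<in> C" by (intro C_I[OF WE(4)[OF t \<zeta>]]) (simp_all del: free_module_simps)
  qed
  have "\<phi> i \<in> C" if i: "i \<in> I" for i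
  proof -
    have iA: "i \<in> carrier A" by (rule I.Icarr[OF i])
    obtain v where v: "v \<in> carrier (P 1)" "\<delta> 0 v = i \<odot>\<^bsub>P 0\<^esub> e0" using lift[OF IK[OF i]] by blast
    have "l (\<delta> 0 v) = i \<otimes> l e0" using v lD(3)[OF iA e0(1)] by simp
    then have "l (\<delta> 0 v) \<in> I" using I.I_r_closed[OF i lD(1)[OF e0(1)]] by simp
    from JJS[OF \<theta>_J[OF v(1) this]] have "delta S v \<in> W" using v d1 \<Theta>_delta by (simp add: W_def)
    moreover have "?p0 (delta S v) \<ominus>\<^bsub>?F0\<^esub> \<phi> i \<odot>\<^bsub>?F0\<^esub> ?e0 \<in> ?r0"
      using push_coeffs_delta[OF df(1) v(1)] v(2) tensor_rel_smult[OF iA e0(1)] by simp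
    ultimately show ?thesis using iA by (intro C_I) (simp_all del: free_module_simps)
  qed
  then have "Idl\<^bsub>S\<^esub> (\<phi> ` I) \<subseteq> C" by (intro S.genideal_minimal[OF C]) auto
  with cu obtain \<zeta> where \<zeta>: "\<zeta> \<in> W"
    and \<zeta>r: "?p0 \<zeta> \<ominus>\<^bsub>?F0\<^esub> (c \<otimes>\<^bsub>S\<^esub> \<phi> u) \<odot>\<^bsub>?F0\<^esub> ?e0 \<in> ?r0"
    unfolding C_def by blast
  obtain v where v: "v \<in> carrier (P 1)" "\<delta> 0 v = u \<odot>\<^bsub>P 0\<^esub> e0" using lift[OF uK] by blast
  \<comment> \<open>A cycle: modulo tensor relations, \<open>c v\<close> and \<zeta> both map to
    \<open>c u e0\<close>, the former through \<open>u\<close> itself, the latter through elements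
    of \<open>I\<close>.\<close>
  define \<xi> where "\<xi> = c \<odot>\<^bsub>?F1\<^esub> delta S v \<ominus>\<^bsub>?F1\<^esub> \<zeta>"
  have cv: "c \<odot>\<^bsub>?F1\<^esub> delta S v \<in> carrier ?F1" by (rule F1.smult_closed[OF c d1[OF v(1)]])
  have \<xi>: "\<xi> \<in> carrier ?F1" unfolding \<xi>_def by (rule F1.M.minus_closed[OF cv W1(1)[OF \<zeta>]])
  have "?p0 \<xi> \<in> ?r0"
  proof -
    have due: "delta S (u \<odot>\<^bsub>P 0\<^esub> e0) \<in> carrier ?F0" using u e0 by (intro dd0) simp
    have "?p0 \<xi> = c \<odot>\<^bsub>?F0\<^esub> delta S (u \<odot>\<^bsub>P 0\<^esub> e0) \<ominus>\<^bsub>?F0\<^esub> ?p0 \<zeta>"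
      unfolding \<xi>_def module_hom_diff[OF free_S free_S p0 cv W1(1)[OF \<zeta>]] module_homD(3)[OF p0 c d1[OF v(1)]]
      by (simp add: push_coeffs_delta[OF df(1) v(1)] v(2) del: free_module_simps)
    also have "\<dots> = c \<odot>\<^bsub>?F0\<^esub> (delta S (u \<odot>\<^bsub>P 0\<^esub> e0) \<ominus>\<^bsub>?F0\<^esub> \<phi> u \<odot>\<^bsub>?F0\<^esub> ?e0)
        \<oplus>\<^bsub>?F0\<^esub> \<ominus>\<^bsub>?F0\<^esub> (?p0 \<zeta> \<ominus>\<^bsub>?F0\<^esub> (c \<otimes>\<^bsub>S\<^esub> \<phi> u) \<odot>\<^bsub>?F0\<^esub> ?e0)"
      using due c u e0d pF0[OF \<zeta>]
      by (simp add: a_minus_def F0.smult_r_distr F0.smult_r_minus F0.smult_assoc1 F0.M.minus_add F0.M.a_ac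
          F0.M.r_neg F0.M.r_neg1 F0.M.r_neg2 del: free_module_simps)
    also have "\<dots> \<in> ?r0"
      by (intro r0E(3,4,5) c \<zeta>r tensor_rel_smult u e0)
    finally show ?thesis .
  qed
  from tor[OF _ this k] \<xi> obtain c' where c': "c' \<in> fin_supp S (carrier (P 2))"
    "\<kappa> (Kcirc_root p k) \<odot>\<^bsub>?F1\<^esub> \<xi> \<ominus>\<^bsub>?F1\<^esub> ?p1 c' \<in> tensor_rel A S \<phi> (P 1)" by auto
  let ?s = "\<kappa> (Kcirc_root p k)"
  have s: "?s \<in> carrier S" by (rule \<kappa>)
  have \<theta>v: "\<theta> v \<in> carrier A" by (rule \<theta>(1)[OF v(1)])
  have s\<xi>: "?s \<odot>\<^bsub>?F1\<^esub> \<xi> \<in> carrier ?F1" by (rule F1.smult_closed[OF s \<xi>])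
  have "?s \<odot>\<^bsub>?F1\<^esub> \<xi> \<ominus>\<^bsub>?F1\<^esub> ?p1 c' \<in> W" using c'(2) relW by blast
  from W1(2)[OF this] have "\<Theta> (?s \<odot>\<^bsub>?F1\<^esub> \<xi>) \<ominus>\<^bsub>S\<^esub> \<Theta> (?p1 c') \<in> JS"
    unfolding \<Theta>_diff[OF s\<xi> W1(1)[OF bdW[OF c'(1)]]] .
  then have "\<Theta> (?s \<odot>\<^bsub>?F1\<^esub> \<xi>) \<in> JS"
    by (rule JS.mem_if_minus_mem[OF _ W1(2)[OF bdW[OF c'(1)]] \<Theta>D(1)[OF s\<xi>]])
  moreover have "\<Theta> (?s \<odot>\<^bsub>?F1\<^esub> \<xi>) = ?s \<otimes>\<^bsub>S\<^esub> (c \<otimes>\<^bsub>S\<^esub> \<phi> (\<theta> v)) \<ominus>\<^bsub>S\<^esub> ?s \<otimes>\<^bsub>S\<^esub> \<Theta> \<zeta>"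
  proof -
    have "\<Theta> (?s \<odot>\<^bsub>?F1\<^esub> \<xi>) = ?s \<otimes>\<^bsub>S\<^esub> (c \<otimes>\<^bsub>S\<^esub> \<phi> (\<theta> v) \<ominus>\<^bsub>S\<^esub> \<Theta> \<zeta>)"
      unfolding \<Theta>D(3)[OF s \<xi>] unfolding \<xi>_def \<Theta>_diff[OF cv W1(1)[OF \<zeta>]] \<Theta>D(3)[OF c d1[OF v(1)]] \<Theta>_delta[OF v(1)] ..
    then show ?thesis using s c \<theta>v \<Theta>D(1)[OF W1(1)[OF \<zeta>]] by (simp add: a_minus_def S.r_distr S.r_minus)
  qed
  ultimately have sc\<theta>: "?s \<otimes>\<^bsub>S\<^esub> (c \<otimes>\<^bsub>S\<^esub> \<phi> (\<theta> v)) \<in> JS"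
    using JS.mem_if_minus_mem[OF _ JS.I_l_closed[OF W1(2)[OF \<zeta>] s]] s c \<theta>v by simp
  \<comment> \<open>\<open>q\<close> takes the same value at \<open>l e0\<close> and at one, so
    their difference lies in \<open>K\<close>, the sum of \<open>I\<close> and the multiples of
    \<open>u\<close>.\<close>
  obtain a where a: "a \<in> carrier A" "(l e0 \<ominus> \<one>) \<ominus> a \<otimes> u \<in> I"
  proof -
    have le0: "l e0 \<in> carrier A" by (rule lD(1)[OF e0(1)])
    have "q (l e0 \<ominus> \<one>) = \<zero>\<^bsub>M\<^esub>"
    proof -
      interpret M: rmodule A M by (rule rmoduleI[OF M])
      have "q (l e0 \<ominus>\<^bsub>self_module A\<^esub> \<one>) = q (l e0) \<ominus>\<^bsub>M\<^esub> q \<one>"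
        using le0 by (intro module_hom_diff[OF AM.is_module M q]) auto
      then show ?thesis using ql[OF e0(1)] e0(2) q1 by (simp add: a_minus_def self_module_a_inv M.M.r_neg)
    qed
    then have "l e0 \<ominus> \<one> \<in> K" using q_ker le0 by simp
    then show ?thesis using K_iff le0 that by auto
  qed
  have le0: "l e0 \<in> carrier A" by (rule lD(1)[OF e0(1)])
  \<comment> \<open>The lifts \<open>l\<close> and \<open>e0\<close> are mutually inverse only
    modulo \<open>K\<close>, so the coefficient read off at \<open>v\<close> is
    \<open>1 + a u\<close> and not one.\<close>
  have "\<theta> v \<ominus> (\<one> \<oplus> a \<otimes> u) \<in> J"
  proof (rule \<theta>_unique[OF v(1)])
    have "l (\<delta> 0 v) = u \<otimes> l e0" using v lD(3)[OF u e0(1)] by simp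
    then have "l (\<delta> 0 v) \<ominus> (\<one> \<oplus> a \<otimes> u) \<otimes> u = u \<otimes> ((l e0 \<ominus> \<one>) \<ominus> a \<otimes> u)"
      using le0 a(1) u by (simp add: a_minus_def A.ring_simprules A.m_lcomm)
    then show "l (\<delta> 0 v) \<ominus> (\<one> \<oplus> a \<otimes> u) \<otimes> u \<in> I"
      using I.I_l_closed[OF a(2) u] by simp
  qed (use a u in auto)
  from JJS[OF this] have "\<phi> (\<theta> v) \<ominus>\<^bsub>S\<^esub> (\<one>\<^bsub>S\<^esub> \<oplus>\<^bsub>S\<^esub> \<phi> a \<otimes>\<^bsub>S\<^esub> \<phi> u) \<in> JS"
    using \<theta>v a u by (simp add: a_minus_def)
  from JS.I_l_closed[OF this S.m_closed[OF s c]]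
  have 1: "(?s \<otimes>\<^bsub>S\<^esub> c) \<otimes>\<^bsub>S\<^esub> (\<phi> (\<theta> v) \<ominus>\<^bsub>S\<^esub> (\<one>\<^bsub>S\<^esub> \<oplus>\<^bsub>S\<^esub> \<phi> a \<otimes>\<^bsub>S\<^esub> \<phi> u)) \<in> JS" .
  \<comment> \<open>This disposes of the correction \<open>a u\<close>: its product with
    \<open>c\<close> already lies in the extension of \<open>I\<close>, hence in
    \<open>JS\<close>.\<close>
  have "c \<otimes>\<^bsub>S\<^esub> \<phi> u \<in> JS" using cu ideal_extension_mono[OF IJ J] unfolding JS_def by blast
  from JS.I_l_closed[OF this S.m_closed[OF s \<phi>.hom_closed[OF a(1)]]]
  have 2: "(?s \<otimes>\<^bsub>S\<^esub> \<phi> a) \<otimes>\<^bsub>S\<^esub> (c \<otimes>\<^bsub>S\<^esub> \<phi> u) \<in> JS" .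
  have "?s \<otimes>\<^bsub>S\<^esub> c = (?s \<otimes>\<^bsub>S\<^esub> (c \<otimes>\<^bsub>S\<^esub> \<phi> (\<theta> v)) \<ominus>\<^bsub>S\<^esub> (?s \<otimes>\<^bsub>S\<^esub> c) \<otimes>\<^bsub>S\<^esub> (\<phi> (\<theta> v) \<ominus>\<^bsub>S\<^esub> (\<one>\<^bsub>S\<^esub> \<oplus>\<^bsub>S\<^esub> \<phi> a \<otimes>\<^bsub>S\<^esub> \<phi> u)))
      \<ominus>\<^bsub>S\<^esub> (?s \<otimes>\<^bsub>S\<^esub> \<phi> a) \<otimes>\<^bsub>S\<^esub> (c \<otimes>\<^bsub>S\<^esub> \<phi> u)"
    using s c \<phi>.hom_closed[OF \<theta>v] \<phi>.hom_closed[OF a(1)] \<phi>.hom_closed[OF u]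
    by (simp add: a_minus_def S.ring_simprules S.m_lcomm del: \<phi>.hom_closed)
  then show ?thesis using JS.minus_mem[OF JS.minus_mem[OF sc\<theta> 1] 2] unfolding JS_def J_def by simp
qed

end

section \<open>Maximal ideals, powers of ideals, and almost faithful contraction\<close>

lemma (in noetherian_ring) exists_maximalideal:
  assumes "ideal J R" "J \<noteq> carrier R"
  obtains \<mm> where "maximalideal \<mm> R" "J \<subseteq> \<mm>"
proof -
  let ?A = "{I. ideal I R \<and> J \<subseteq> I \<and> I \<noteq> carrier R}"
  have "\<exists>M\<in>?A. \<forall>X\<in>?A. M \<subseteq> X \<longrightarrow> X = M"
  proof (rule subset_Zorn_nonempty)
    show "?A \<noteq> {}" using assms by blast
    fix C assume C: "C \<noteq> {}" "subset.chain ?A C"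
    then have "subset.chain {I. ideal I R} C" by (auto simp: pred_on.chain_def)
    \<comment> \<open>In a noetherian ring a nonempty chain of ideals contains its own union, so the
      upper bound required by Zorn is a member of the chain and in particular proper.\<close>
    then have "\<Union>C \<in> C" by (rule ideal_chain_is_trivial[OF C(1)])
    then show "\<Union>C \<in> ?A" using C(2) by (auto simp: pred_on.chain_def)
  qed
  then obtain M where "M \<in> ?A" and max: "\<forall>X\<in>?A. M \<subseteq> X \<longrightarrow> X = M" by (elim bexE)
  then have M: "ideal M R" "J \<subseteq> M" "M \<noteq> carrier R" by auto
  have "maximalideal M R"
  proof (rule maximalidealI[OF M(1)])
    show "carrier R \<noteq> M" using M(3) by simp
    show "X = M \<or> X = carrier R" if "ideal X R" "M \<subseteq> X" for X
      using max that M(2) by (metis (mono_tags, lifting) mem_Collect_eq subset_trans)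
  qed
  then show ?thesis using M(2) by (rule that)
qed

lemma local_ring_proper_ideal:
  assumes "local_ring R \<mm>" "noetherian_ring R" "ideal J R" "J \<noteq> carrier R"
  shows "J \<subseteq> \<mm>"
  using noetherian_ring.exists_maximalideal[OF assms(2-4)] assms(1) by (metis local_ring_def)

lemma ideals_set_simps:
  "I \<otimes>\<^bsub>ideals_set R\<^esub> J = ideal_prod R I J" "\<one>\<^bsub>ideals_set R\<^esub> = carrier R"
  by (simp_all add: ideals_set_def)

lemma ideal_pow_ideal:
  assumes "cring R" "ideal I R"
  shows "ideal (ideal_pow R I n) R"
proof -
  interpret cring R by fact
  show ?thesis by (induction n) (auto simp: ideals_set_simps oneideal ideal_prod_is_ideal assms)
qed

lemma ideal_pow_Suc_subset:
  assumes "cring R" "ideal I R"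
  shows "ideal_pow R I (Suc n) \<subseteq> ideal_pow R I n"
proof -
  interpret cring R by fact
  show ?thesis using ideal_prod_inter[OF ideal_pow_ideal[OF assms] assms(2)] by (auto simp: ideals_set_simps)
qed

lemma ideal_pow_antimono:
  assumes "cring R" "ideal I R" "m \<le> n"
  shows "ideal_pow R I n \<subseteq> ideal_pow R I m"
  using assms(3) by (induction rule: dec_induct) (use ideal_pow_Suc_subset[OF assms(1,2)] in blast)+

lemma pow_mem_ideal_pow:
  assumes "cring R" "ideal I R" "a \<in> I"
  shows "a [^]\<^bsub>R\<^esub> n \<in> ideal_pow R I n"
proof -
  interpret cring R by fact
  show ?thesis using assms(3) by (induction n) (auto simp: ideals_set_simps intro: ideal_prod.prod)
qed

context base_change
begin

text \<open>Products of generators lie in the extension of the product ideal by definition. Two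
  colon ideals, first for a fixed \<open>i\<close> and then for the fixed \<open>t\<close>, replace
  generators by arbitrary elements in each factor.\<close>

lemma ideal_extension_prod:
  assumes I: "ideal I A" and J: "ideal J A"
    and s: "s \<in> Idl\<^bsub>S\<^esub> (\<phi> ` I)" and t: "t \<in> Idl\<^bsub>S\<^esub> (\<phi> ` J)"
  shows "s \<otimes>\<^bsub>S\<^esub> t \<in> Idl\<^bsub>S\<^esub> (\<phi> ` (ideal_prod A I J))"
proof -
  let ?K = "Idl\<^bsub>S\<^esub> (\<phi> ` (ideal_prod A I J))"
  have K: "ideal ?K S" by (rule ideal_extension[OF A.ideal_prod_is_ideal[OF I J]])
  interpret I: ideal I A by fact
  interpret J: ideal J A by fact
  have 1: "\<phi> i \<otimes>\<^bsub>S\<^esub> t \<in> ?K" if i: "i \<in> I" for i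
  proof -
    have "Idl\<^bsub>S\<^esub> (\<phi> ` J) \<subseteq> {a \<in> carrier S. a \<otimes>\<^bsub>S\<^esub> \<phi> i \<in> ?K}"
    proof (rule S.genideal_minimal[OF S.colon_ideal[OF K]])
      show "\<phi> ` J \<subseteq> {a \<in> carrier S. a \<otimes>\<^bsub>S\<^esub> \<phi> i \<in> ?K}"
      proof clarsimp
        fix j assume j: "j \<in> J"
        have "\<phi> (i \<otimes> j) \<in> ?K"
          using i j by (intro ideal_extension_mem A.ideal_prod_is_ideal I J ideal_prod.prod)
        then show "\<phi> j \<otimes>\<^bsub>S\<^esub> \<phi> i \<in> ?K" using i j by (simp add: S.m_comm)
      qed
    qed (use i in simp)
    with t show ?thesis using i S.m_comm[of t "\<phi> i"] by auto
  qed
  have tS: "t \<in> carrier S" using t ideal.Icarr[OF ideal_extension[OF J]] by blast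
  have "Idl\<^bsub>S\<^esub> (\<phi> ` I) \<subseteq> {a \<in> carrier S. a \<otimes>\<^bsub>S\<^esub> t \<in> ?K}"
    by (rule S.genideal_minimal[OF S.colon_ideal[OF K tS]]) (use 1 in auto)
  with s show ?thesis by auto
qed

lemma ideal_extension_pow:
  assumes I: "ideal I A" and s: "s \<in> Idl\<^bsub>S\<^esub> (\<phi> ` I)"
  shows "s [^]\<^bsub>S\<^esub> n \<in> Idl\<^bsub>S\<^esub> (\<phi> ` ideal_pow A I n)"
proof (induction n)
  case 0
  have "\<phi> \<one> \<in> Idl\<^bsub>S\<^esub> (\<phi> ` carrier A)" by (rule ideal_extension_mem[OF A.oneideal]) simp
  then show ?case by (simp add: ideals_set_simps)
next
  case (Suc n)
  then show ?case
    using ideal_extension_prod[OF ideal_pow_ideal[OF A.is_cring I] I Suc s] by (simp add: ideals_set_simps)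
qed

text \<open>With \<open>J = (I : v)\<close>, the colon statement for \<open>c = 1\<close> puts all
  the roots of \<open>p\<close> of positive index into the extension of \<open>J\<close>. They
  therefore annihilate the base change of the cyclic module \<open>A / J\<close>, which must then be
  zero, so one lies in \<open>J\<close>.\<close>

lemma almost_faithful_contraction:
  assumes flat: "almost_flat p A S \<kappa> \<phi>" and faith: "almost_faithful p A S \<kappa> \<phi>"
    and \<kappa>: "\<And>k. \<kappa> (Kcirc_root p k) \<in> carrier S"
    and inf: "infinite (UNIV :: 'a set)" and nz: "\<one> \<noteq> \<zero>"
    and I: "ideal I A" and v: "v \<in> carrier A" and vI: "\<phi> v \<in> Idl\<^bsub>S\<^esub> (\<phi> ` I)"
  shows "v \<in> I"
proof -
  define J where "J = {a \<in> carrier A. a \<otimes> v \<in> I}"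
  have J: "ideal J A" unfolding J_def by (rule A.colon_ideal[OF I v])
  have \<kappa>J: "\<kappa> (Kcirc_root p k) \<in> Idl\<^bsub>S\<^esub> (\<phi> ` J)" if "k > 0" for k
    using almost_flat_colon[OF flat \<kappa> inf nz I v S.one_closed _ that] vI v \<kappa> unfolding J_def by simp
  obtain M :: "('a, 'a univ) module" and q where M: "Module.module A M" and q: "q \<in> module_hom A (self_module A) M"
    and q_surj: "q ` carrier A = carrier M" and q_ker: "\<And>a. a \<in> carrier A \<Longrightarrow> q a = \<zero>\<^bsub>M\<^esub> \<longleftrightarrow> a \<in> J"
    by (rule cyclic_module_exists[OF A.is_cring J], rule that)
  interpret M: rmodule A M by (rule rmoduleI[OF M])
  let ?F = "free_module S (carrier M)" and ?r = "tensor_rel A S \<phi> M"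
  let ?q1 = "delta S (q \<one>)"
  interpret F: rmodule S ?F by (rule rfree_S)
  have r: "submodule ?r S ?F" by (rule tensor_rel_submodule[OF M])
  note rE = F.submoduleE[OF r] F.submodule_zero[OF r]
  interpret r: abelian_subgroup ?r ?F by (rule F.submodule_abelian_subgroup[OF r])
  have d: "delta S u \<in> carrier ?F" if "u \<in> carrier M" for u using delta_fin_supp[OF S.is_cring that] by simp
  have mem: "x \<in> ?r" if "x \<ominus>\<^bsub>?F\<^esub> y \<in> ?r" "y \<in> ?r" "x \<in> carrier ?F" for x y
  proof -
    have yF: "y \<in> carrier ?F" using that(2) rE(1) by blast
    have "(x \<ominus>\<^bsub>?F\<^esub> y) \<oplus>\<^bsub>?F\<^esub> y \<in> ?r" by (rule rE(5)[OF that(1,2)])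
    then show ?thesis using that(3) yF by (simp add: a_minus_def F.M.a_assoc F.M.l_neg del: free_module_simps)
  qed
  have mem': "y \<in> ?r" if "x \<ominus>\<^bsub>?F\<^esub> y \<in> ?r" "x \<in> ?r" "y \<in> carrier ?F" for x y
  proof -
    have xF: "x \<in> carrier ?F" using that(2) rE(1) by blast
    have "x \<oplus>\<^bsub>?F\<^esub> \<ominus>\<^bsub>?F\<^esub> (x \<ominus>\<^bsub>?F\<^esub> y) \<in> ?r" by (rule rE(5)[OF that(2) rE(3)[OF that(1)]])
    then show ?thesis using that(3) xF by (simp add: a_minus_def F.M.minus_add F.M.r_neg1 F.M.r_neg2 del: free_module_simps)
  qed
  have q1: "q \<one> \<in> carrier M" using q_surj by auto
  have qa: "q a = a \<odot>\<^bsub>M\<^esub> q \<one>" if "a \<in> carrier A" for a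
    using module_homD(3)[OF q that, of "\<one>"] that by simp
  have d0: "delta S \<zero>\<^bsub>M\<^esub> \<in> ?r"
  proof (rule mem)
    show "delta S \<zero>\<^bsub>M\<^esub> \<ominus>\<^bsub>?F\<^esub> \<phi> \<zero> \<odot>\<^bsub>?F\<^esub> delta S \<zero>\<^bsub>M\<^esub> \<in> ?r"
      using tensor_rel_smult[OF A.zero_closed M.M.zero_closed] by (simp del: free_module_simps)
    show "\<phi> \<zero> \<odot>\<^bsub>?F\<^esub> delta S \<zero>\<^bsub>M\<^esub> \<in> ?r"
      using d[OF M.M.zero_closed] rE(7) by (simp add: F.smult_l_null del: free_module_simps)
  qed (rule d[OF M.M.zero_closed])
  \<comment> \<open>The annihilator of the generator of the base change; containing the image of
    \<open>J\<close>, it contains the whole extension of \<open>J\<close>.\<close>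
  let ?C = "{s \<in> carrier S. s \<odot>\<^bsub>?F\<^esub> ?q1 \<in> ?r}"
  have dq: "?q1 \<in> carrier ?F" by (rule d[OF q1])
  have C: "ideal ?C S"
  proof (rule S.idealI_smult)
    have "\<zero>\<^bsub>S\<^esub> \<in> ?C" using rE(7) dq by (simp add: F.smult_l_null del: free_module_simps)
    then show "?C \<noteq> {}" by blast
  qed (use dq in \<open>auto simp: F.smult_l_distr F.smult_assoc1 simp del: free_module_simps intro: rE(4,5)\<close>)
  have "\<phi> ` J \<subseteq> ?C"
  proof clarify
    fix a assume a: "a \<in> J"
    then have aA: "a \<in> carrier A" by (rule ideal.Icarr[OF J])
    have 1: "delta S (q a) \<in> ?r" using a q_ker[OF aA] d0 by simp
    have 2: "delta S (q a) \<ominus>\<^bsub>?F\<^esub> \<phi> a \<odot>\<^bsub>?F\<^esub> ?q1 \<in> ?r"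
      using tensor_rel_smult[OF aA q1] qa[OF aA] by simp
    have "\<phi> a \<odot>\<^bsub>?F\<^esub> ?q1 \<in> ?r"
      by (rule mem'[OF 2 1 F.smult_closed[OF \<phi>.hom_closed[OF aA] dq]])
    then show "\<phi> a \<in> carrier S \<and> \<phi> a \<odot>\<^bsub>?F\<^esub> ?q1 \<in> ?r" using aA by auto
  qed
  then have JC: "Idl\<^bsub>S\<^esub> (\<phi> ` J) \<subseteq> ?C" by (rule S.genideal_minimal[OF C])
  \<comment> \<open>Modulo relations every symbol \<open>q a\<close> is the multiple by
    \<open>\<phi> a\<close> of the symbol \<open>q 1\<close>, so a scalar that annihilates this one
    generator annihilates everything.\<close>
  have kill: "\<kappa> (Kcirc_root p k) \<odot>\<^bsub>?F\<^esub> x \<in> ?r" if k: "k > 0" and x: "x \<in> carrier ?F" for k x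
  proof -
    let ?s = "\<kappa> (Kcirc_root p k)"
    have sq: "?s \<odot>\<^bsub>?F\<^esub> ?q1 \<in> ?r" using \<kappa>J[OF k] JC by blast
    have h: "(\<lambda>x. ?s \<odot>\<^bsub>?F\<^esub> x) \<in> module_hom S ?F ?F"
      using \<kappa> by (auto simp: module_hom_def F.smult_r_distr F.smult_assoc1[symmetric] S.m_comm simp del: free_module_simps)
    have "x \<in> {x \<in> carrier ?F. ?s \<odot>\<^bsub>?F\<^esub> x \<in> ?r}"
    proof (rule free_submodule_eq_carrier[OF S.is_cring submodule_vimage[OF free_S free_S h r]])
      fix y assume "y \<in> carrier M"
      then obtain a where a: "a \<in> carrier A" "y = q a" using q_surj by auto
      have y: "delta S y \<in> carrier ?F" by (rule d) fact
      have 1: "?s \<odot>\<^bsub>?F\<^esub> (delta S (q a) \<ominus>\<^bsub>?F\<^esub> \<phi> a \<odot>\<^bsub>?F\<^esub> ?q1) \<in> ?r"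
        using tensor_rel_smult[OF a(1) q1] qa[OF a(1)] by (intro rE(4) \<kappa>) simp
      have eq: "?s \<odot>\<^bsub>?F\<^esub> (delta S (q a) \<ominus>\<^bsub>?F\<^esub> \<phi> a \<odot>\<^bsub>?F\<^esub> ?q1)
         = ?s \<odot>\<^bsub>?F\<^esub> delta S (q a) \<ominus>\<^bsub>?F\<^esub> ?s \<odot>\<^bsub>?F\<^esub> (\<phi> a \<odot>\<^bsub>?F\<^esub> ?q1)"
        using \<kappa> y a dq by (simp add: a_minus_def F.smult_r_distr F.smult_r_minus del: free_module_simps)
      have "?s \<odot>\<^bsub>?F\<^esub> (\<phi> a \<odot>\<^bsub>?F\<^esub> ?q1) = \<phi> a \<odot>\<^bsub>?F\<^esub> (?s \<odot>\<^bsub>?F\<^esub> ?q1)"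
        using \<kappa> a dq by (simp add: F.smult_assoc1[symmetric] S.m_comm del: free_module_simps)
      then have 2: "?s \<odot>\<^bsub>?F\<^esub> (\<phi> a \<odot>\<^bsub>?F\<^esub> ?q1) \<in> ?r"
        using rE(4)[OF \<phi>.hom_closed[OF a(1)] sq] by simp
      have "delta S (q a) \<in> carrier ?F" using y a by simp
      from mem[OF 1[unfolded eq] 2 F.smult_closed[OF \<kappa> this]]
      have "?s \<odot>\<^bsub>?F\<^esub> delta S (q a) \<in> ?r" .
      then show "delta S y \<in> {x \<in> carrier ?F. ?s \<odot>\<^bsub>?F\<^esub> x \<in> ?r}" using y a by (simp del: free_module_simps)
    qed (use x in simp)
    then show ?thesis by simp
  qed
  have "almost_zero p \<kappa> (tensor A S \<phi> M)"
    unfolding almost_zero_def almost_zero_elt_def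
  proof (intro ballI allI impI)
    fix z and k :: nat assume z: "z \<in> carrier (tensor A S \<phi> M)" and k: "k > 0"
    then have z': "z \<in> a_rcosets\<^bsub>?F\<^esub> ?r" by (simp add: tensor_def quot_module_def)
    then obtain x where x: "x \<in> carrier ?F" "z = ?r +>\<^bsub>?F\<^esub> x" by (auto simp: A_RCOSETS_def')
    have "x \<in> z" unfolding x(2) by (rule r.a_rcos_self[OF x(1)])
    moreover have "?r +>\<^bsub>?F\<^esub> (\<kappa> (Kcirc_root p k) \<odot>\<^bsub>?F\<^esub> y) = ?r" if "y \<in> z" for y
    proof -
      have "y \<in> carrier ?F" using r.a_rcosets_carrier[OF z'] that by blast
      from r.a_rcos_const[OF kill[OF k this]] show ?thesis .
    qed
    ultimately show "\<kappa> (Kcirc_root p k) \<odot>\<^bsub>tensor A S \<phi> M\<^esub> z = \<zero>\<^bsub>tensor A S \<phi> M\<^esub>"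
      by (auto simp: tensor_def quot_module_def simp del: free_module_simps)
  qed
  then have "carrier M = {\<zero>\<^bsub>M\<^esub>}" using faith M unfolding almost_faithful_def by blast
  then have "\<one> \<in> J" using q1 q_ker[OF A.one_closed] by simp
  then show ?thesis using v by (simp add: J_def)
qed

text \<open>If \<open>u\<close> were outside \<open>I\<close>, then \<open>(I : u)\<close> would be
  a proper ideal, hence inside the maximal ideal. Raising an element of its extension to the power
  \<open>p^e\<close> turns the root \<open>g\<close> back into an element of \<open>A\<close>, where
  almost faithful contraction applies.\<close>

lemma almost_perfect_root_colon:
  assumes flat: "almost_flat p A S \<kappa> \<phi>" and faith: "almost_faithful p A S \<kappa> \<phi>"
    and \<kappa>: "\<And>k. \<kappa> (Kcirc_root p k) \<in> carrier S"
    and \<kappa>p: "\<And>k. \<kappa> (Kcirc_root p k) [^]\<^bsub>S\<^esub> (p ^ k) = nat_elt S p"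
    and p: "p \<ge> 2"
    and inf: "infinite (UNIV :: 'a set)" and nz: "\<one> \<noteq> \<zero>"
    and loc: "local_ring A \<mm>" and noeth: "noetherian_ring A"
    and f: "f \<in> carrier A" "nat_elt A p \<otimes> f \<notin> ideal_pow A \<mm> (p ^ e)"
    and g: "g \<in> carrier S" "g [^]\<^bsub>S\<^esub> (p ^ e) = \<phi> f"
    and I: "ideal I A" and u: "u \<in> carrier A"
    and gu: "\<kappa> (Kcirc_root p (Suc e)) \<otimes>\<^bsub>S\<^esub> g \<otimes>\<^bsub>S\<^esub> \<phi> u \<in> Idl\<^bsub>S\<^esub> (\<phi> ` I)"
  shows "u \<in> I"
proof (rule ccontr)
  assume "u \<notin> I"
  define J where "J = {a \<in> carrier A. a \<otimes> u \<in> I}"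
  have J: "ideal J A" unfolding J_def by (rule A.colon_ideal[OF I u])
  have "\<one> \<notin> J" using \<open>u \<notin> I\<close> u by (simp add: J_def)
  then have "J \<noteq> carrier A" by blast
  then have Jm: "J \<subseteq> \<mm>" by (rule local_ring_proper_ideal[OF loc noeth J])
  have m: "ideal \<mm> A" using loc by (auto simp: local_ring_def intro: maximalideal.axioms)
  let ?s = "\<kappa> (Kcirc_root p (Suc e))"
  have s: "?s \<in> carrier S" by (rule \<kappa>)
  \<comment> \<open>One factor \<open>?s\<close> is present in the hypothesis, the second is the
    price of almost flatness.\<close>
  have "?s \<otimes>\<^bsub>S\<^esub> (?s \<otimes>\<^bsub>S\<^esub> g) \<in> Idl\<^bsub>S\<^esub> (\<phi> ` J)"
    using almost_flat_colon[OF flat \<kappa> inf nz I u _ gu, of "Suc e"] s g unfolding J_def by simp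
  then have "?s \<otimes>\<^bsub>S\<^esub> (?s \<otimes>\<^bsub>S\<^esub> g) \<in> Idl\<^bsub>S\<^esub> (\<phi> ` \<mm>)" using ideal_extension_mono[OF Jm m] by blast
  from ideal_extension_pow[OF m this, of "p ^ e"]
  have mem: "(?s \<otimes>\<^bsub>S\<^esub> (?s \<otimes>\<^bsub>S\<^esub> g)) [^]\<^bsub>S\<^esub> (p ^ e) \<in> Idl\<^bsub>S\<^esub> (\<phi> ` ideal_pow A \<mm> (p ^ e))" .
  have mpow: "ideal (ideal_pow A \<mm> (p ^ e)) A" by (rule ideal_pow_ideal[OF A.is_cring m])
  \<comment> \<open>The two factors \<open>?s\<close> contribute \<open>2 * p^e\<close> to the
    power; \<open>n\<close> is what is missing to reach \<open>p^(e+1)\<close>, the power of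
    \<open>?s\<close> that equals \<open>p\<close>. The subtraction is exact because
    \<open>p >= 2\<close>.\<close>
  define n where "n = p ^ Suc e - 2 * p ^ e"
  have n: "n + (p ^ e + p ^ e) = p ^ Suc e" using p mult_le_mono1[of 2 p "p ^ e"] by (simp add: n_def)
  have "?s [^]\<^bsub>S\<^esub> n \<otimes>\<^bsub>S\<^esub> (?s \<otimes>\<^bsub>S\<^esub> (?s \<otimes>\<^bsub>S\<^esub> g)) [^]\<^bsub>S\<^esub> (p ^ e) \<in> Idl\<^bsub>S\<^esub> (\<phi> ` ideal_pow A \<mm> (p ^ e))"
    using s by (intro ideal.I_l_closed[OF ideal_extension[OF mpow] mem]) simp
  also have "?s [^]\<^bsub>S\<^esub> n \<otimes>\<^bsub>S\<^esub> (?s \<otimes>\<^bsub>S\<^esub> (?s \<otimes>\<^bsub>S\<^esub> g)) [^]\<^bsub>S\<^esub> (p ^ e)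
     = (?s [^]\<^bsub>S\<^esub> n \<otimes>\<^bsub>S\<^esub> (?s [^]\<^bsub>S\<^esub> (p ^ e) \<otimes>\<^bsub>S\<^esub> ?s [^]\<^bsub>S\<^esub> (p ^ e))) \<otimes>\<^bsub>S\<^esub> g [^]\<^bsub>S\<^esub> (p ^ e)"
    using s g(1) by (simp add: S.nat_pow_distrib S.m_assoc)
  also have "\<dots> = ?s [^]\<^bsub>S\<^esub> (p ^ Suc e) \<otimes>\<^bsub>S\<^esub> \<phi> f" using s by (simp only: S.nat_pow_mult n g(2))
  also have "\<dots> = \<phi> (nat_elt A p \<otimes> f)"
    using f(1) ring_hom_nat_elt[OF A.is_cring S.is_cring \<phi>_hom] by (simp only: \<kappa>p) simp
  finally have "nat_elt A p \<otimes> f \<in> ideal_pow A \<mm> (p ^ e)"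
    using f(1) by (intro almost_faithful_contraction[OF flat faith \<kappa> inf nz mpow]) auto
  with f(2) show False by blast
qed

end

section \<open>Top local cohomology\<close>

text \<open>Scalar multiplication on cosets is a union over all representatives; each of them gives
  the same coset, so the union collapses.\<close>

lemma (in rmodule) quot_module_smult:
  assumes N: "submodule N R M" and r: "r \<in> carrier R" and u: "u \<in> carrier M"
  shows "r \<odot>\<^bsub>quot_module R M N\<^esub> (N +>\<^bsub>M\<^esub> u) = N +>\<^bsub>M\<^esub> (r \<odot>\<^bsub>M\<^esub> u)"
proof -
  interpret N: abelian_subgroup N M by (rule submodule_abelian_subgroup[OF N])
  have "N +>\<^bsub>M\<^esub> (r \<odot>\<^bsub>M\<^esub> v) = N +>\<^bsub>M\<^esub> (r \<odot>\<^bsub>M\<^esub> u)" if "v \<in> N +>\<^bsub>M\<^esub> u" for v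
  proof -
    obtain n where n: "n \<in> N" "v = n \<oplus>\<^bsub>M\<^esub> u" using \<open>v \<in> N +>\<^bsub>M\<^esub> u\<close> by (auto simp: a_r_coset_def')
    have nM: "n \<in> carrier M" using n(1) by simp
    have "r \<odot>\<^bsub>M\<^esub> v = r \<odot>\<^bsub>M\<^esub> n \<oplus>\<^bsub>M\<^esub> r \<odot>\<^bsub>M\<^esub> u" using n r u nM by (simp add: smult_r_distr)
    moreover have "r \<odot>\<^bsub>M\<^esub> n \<in> N" by (rule submoduleE(4)[OF N r n(1)])
    ultimately have "r \<odot>\<^bsub>M\<^esub> v \<in> N +>\<^bsub>M\<^esub> (r \<odot>\<^bsub>M\<^esub> u)" by (auto simp: a_r_coset_def')
    then show ?thesis using r u by (intro N.a_repr_independence'[symmetric]) auto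
  qed
  moreover have "N +>\<^bsub>M\<^esub> u \<noteq> {}" using N.a_rcos_self[OF u] by blast
  ultimately have "(\<Union>v\<in>N +>\<^bsub>M\<^esub> u. N +>\<^bsub>M\<^esub> (r \<odot>\<^bsub>M\<^esub> v)) = N +>\<^bsub>M\<^esub> (r \<odot>\<^bsub>M\<^esub> u)"
    by (intro SUP_eq_const)
  then show ?thesis by (simp add: quot_module_def)
qed

lemma (in rmodule) coset_eq_iff:
  assumes N: "submodule N R M" and uv: "u \<in> carrier M" "v \<in> carrier M"
  shows "N +>\<^bsub>M\<^esub> u = N +>\<^bsub>M\<^esub> v \<longleftrightarrow> u \<ominus>\<^bsub>M\<^esub> v \<in> N"
proof -
  interpret N: abelian_subgroup N M by (rule submodule_abelian_subgroup[OF N])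
  show ?thesis
    using N.a_rcos_module[OF uv(2,1)] N.a_repr_independence'[of u v] N.a_rcos_self[OF uv(1)] uv
    unfolding a_minus_def by metis
qed

lemma (in rmodule) coset_eq_zero_iff:
  assumes N: "submodule N R M" and u: "u \<in> carrier M"
  shows "N +>\<^bsub>M\<^esub> u = N \<longleftrightarrow> u \<in> N"
proof -
  interpret N: abelian_subgroup N M by (rule submodule_abelian_subgroup[OF N])
  show ?thesis using N.a_rcos_const N.a_rcos_self[OF u] by metis
qed

section \<open>Fractions and the cokernel of the last Cech differential\<close>

locale cech = cring R for R :: "'a ring" (structure) +
  fixes d :: nat and x :: "nat \<Rightarrow> 'a"
  assumes x_carrier: "x \<in> {..<d} \<rightarrow> carrier R"
begin

abbreviation "y \<equiv> finprod R x {..<d}"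
abbreviation "fr \<equiv> frac R (self_module R) y"
abbreviation "L \<equiv> cech_top R (self_module R) d x"
abbreviation "B \<equiv> cech_boundaries R (self_module R) d x"
abbreviation "pow_ideal k \<equiv> Idl\<^bsub>R\<^esub> ((\<lambda>i. x i [^]\<^bsub>R\<^esub> (k::nat)) ` {..<d})"

lemma y_carrier [simp]: "y \<in> carrier R"
  using x_carrier by (intro finprod_closed)

lemma x_pow_carrier: "i < d \<Longrightarrow> x i [^] (k::nat) \<in> carrier R"
  using x_carrier by auto

lemma y_pow_mult: "m \<in> carrier R \<Longrightarrow> y [^] (a::nat) \<otimes> (y [^] (b::nat) \<otimes> m) = y [^] (a + b) \<otimes> m"
  by (simp add: m_assoc[symmetric] nat_pow_mult)

lemma scale:
  assumes "y [^] (a::nat) \<otimes> m = y [^] (b::nat) \<otimes> n" "m \<in> carrier R" "n \<in> carrier R"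
  shows "y [^] (a + t) \<otimes> m = y [^] (b + t) \<otimes> n"
proof -
  have "y [^] t \<otimes> (y [^] a \<otimes> m) = y [^] t \<otimes> (y [^] b \<otimes> n)" using assms(1) by simp
  then show ?thesis using assms(2,3) by (simp add: y_pow_mult add.commute)
qed

lemma mem_frac_iff:
  "m \<in> carrier R \<Longrightarrow> (m', k') \<in> fr m k \<longleftrightarrow> m' \<in> carrier R \<and> (\<exists>l::nat. y [^] (l + k') \<otimes> m = y [^] (l + k) \<otimes> m')"
  by (auto simp: frac_def y_pow_mult)

lemma frac_self: "m \<in> carrier R \<Longrightarrow> (m, k) \<in> fr m k"
  by (auto simp: mem_frac_iff)

text \<open>Transitivity of the relation behind fractions: the two witnessing equations are scaled
  by powers of \<open>y\<close> until they can be chained.\<close>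

lemma frac_eq:
  assumes m: "m \<in> carrier R" and m': "(m', k') \<in> fr m k"
  shows "fr m' k' = fr m k"
proof -
  from m' m obtain l where m'R: "m' \<in> carrier R" and l: "y [^] (l + k') \<otimes> m = y [^] (l + k) \<otimes> m'"
    by (auto simp: mem_frac_iff)
  have iff: "(\<exists>j::nat. y [^] (j + k'') \<otimes> m' = y [^] (j + k') \<otimes> n) \<longleftrightarrow> (\<exists>j::nat. y [^] (j + k'') \<otimes> m = y [^] (j + k) \<otimes> n)"
    if n: "n \<in> carrier R" for n k''
  proof
    assume "\<exists>j::nat. y [^] (j + k'') \<otimes> m' = y [^] (j + k') \<otimes> n"
    then obtain j :: nat where j: "y [^] (j + k'') \<otimes> m' = y [^] (j + k') \<otimes> n" by auto
    have "y [^] ((l + k') + (j + k'')) \<otimes> m = y [^] ((l + k) + (j + k'')) \<otimes> m'" by (rule scale[OF l m m'R])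
    moreover have "y [^] ((j + k'') + (l + k)) \<otimes> m' = y [^] ((j + k') + (l + k)) \<otimes> n" by (rule scale[OF j m'R n])
    ultimately have "y [^] ((l + j + k') + k'') \<otimes> m = y [^] ((l + j + k') + k) \<otimes> n" by (simp add: ac_simps)
    then show "\<exists>j::nat. y [^] (j + k'') \<otimes> m = y [^] (j + k) \<otimes> n" by blast
  next
    assume "\<exists>j::nat. y [^] (j + k'') \<otimes> m = y [^] (j + k) \<otimes> n"
    then obtain j :: nat where j: "y [^] (j + k'') \<otimes> m = y [^] (j + k) \<otimes> n" by auto
    have "y [^] ((l + k') + (j + k'')) \<otimes> m = y [^] ((l + k) + (j + k'')) \<otimes> m'" by (rule scale[OF l m m'R])
    moreover have "y [^] ((j + k'') + (l + k')) \<otimes> m = y [^] ((j + k) + (l + k')) \<otimes> n" by (rule scale[OF j m n])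
    ultimately have "y [^] ((l + j + k) + k'') \<otimes> m' = y [^] ((l + j + k) + k') \<otimes> n" by (simp add: ac_simps)
    then show "\<exists>j::nat. y [^] (j + k'') \<otimes> m' = y [^] (j + k') \<otimes> n" by blast
  qed
  show ?thesis
  proof (rule Set.set_eqI)
    fix z :: "'a \<times> nat"
    obtain n k'' where z: "z = (n, k'')" by (cases z)
    show "z \<in> fr m' k' \<longleftrightarrow> z \<in> fr m k"
      unfolding z mem_frac_iff[OF m] mem_frac_iff[OF m'R] using iff[of n k''] by blast
  qed
qed

lemma frac_eq_iff:
  assumes "m \<in> carrier R" "m' \<in> carrier R"
  shows "fr m k = fr m' k' \<longleftrightarrow> (\<exists>l::nat. y [^] (l + k') \<otimes> m = y [^] (l + k) \<otimes> m')"
proof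
  assume "fr m k = fr m' k'"
  then have "(m', k') \<in> fr m k" using frac_self[OF assms(2), of k'] by simp
  then show "\<exists>l::nat. y [^] (l + k') \<otimes> m = y [^] (l + k) \<otimes> m'" using mem_frac_iff[OF assms(1)] by blast
next
  assume "\<exists>l::nat. y [^] (l + k') \<otimes> m = y [^] (l + k) \<otimes> m'"
  then have "(m', k') \<in> fr m k" using mem_frac_iff[OF assms(1)] assms(2) by blast
  then show "fr m k = fr m' k'" using frac_eq[OF assms(1)] by simp
qed

lemma frac_scale: "m \<in> carrier R \<Longrightarrow> fr (y [^] l \<otimes> m) (k + l) = fr m k"
  by (auto simp: frac_eq_iff y_pow_mult ac_simps intro!: exI[of _ "0::nat"])

lemma L_carrier: "carrier L = {fr m k | m k. m \<in> carrier R}"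
  and L_zero: "\<zero>\<^bsub>L\<^esub> = fr \<zero> 0"
  by (simp_all add: cech_top_def localization_def)

lemma frac_carrier [simp]: "m \<in> carrier R \<Longrightarrow> fr m k \<in> carrier L"
  by (auto simp: L_carrier)

text \<open>The sum is defined as a union over all pairs of representatives; the content is that
  each pair yields the same fraction.\<close>

lemma L_add:
  assumes m: "m \<in> carrier R" and n: "n \<in> carrier R"
  shows "fr m k \<oplus>\<^bsub>L\<^esub> fr n l = fr (y [^] l \<otimes> m \<oplus> y [^] k \<otimes> n) (k + l)"
proof -
  have "fr (y [^] l' \<otimes> m' \<oplus> y [^] k' \<otimes> n') (k' + l') = fr (y [^] l \<otimes> m \<oplus> y [^] k \<otimes> n) (k + l)"
    if m': "(m', k') \<in> fr m k" and n': "(n', l') \<in> fr n l" for m' k' n' l'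
  proof -
    from m' m obtain a :: nat where a: "m' \<in> carrier R" "y [^] (a + k') \<otimes> m = y [^] (a + k) \<otimes> m'" by (auto simp: mem_frac_iff)
    from n' n obtain b :: nat where b: "n' \<in> carrier R" "y [^] (b + l') \<otimes> n = y [^] (b + l) \<otimes> n'" by (auto simp: mem_frac_iff)
    have 1: "y [^] ((a + k') + (b + l + l')) \<otimes> m = y [^] ((a + k) + (b + l + l')) \<otimes> m'" by (rule scale[OF a(2) m a(1)])
    have 2: "y [^] ((b + l') + (a + k + k')) \<otimes> n = y [^] ((b + l) + (a + k + k')) \<otimes> n'" by (rule scale[OF b(2) n b(1)])
    have "y [^] ((a + b) + (k' + l')) \<otimes> (y [^] l \<otimes> m \<oplus> y [^] k \<otimes> n)
      = y [^] ((a + k') + (b + l + l')) \<otimes> m \<oplus> y [^] ((b + l') + (a + k + k')) \<otimes> n"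
      using m n by (simp add: r_distr y_pow_mult ac_simps)
    also have "\<dots> = y [^] ((a + b) + (k + l)) \<otimes> (y [^] l' \<otimes> m' \<oplus> y [^] k' \<otimes> n')"
      unfolding 1 2 using a(1) b(1) by (simp add: r_distr y_pow_mult ac_simps)
    finally show ?thesis using m n a(1) b(1) by (subst frac_eq_iff) (auto intro!: exI[of _ "a + b"] simp del: nat_pow_0)
  qed
  then have eq: "(case U of (m, k) \<Rightarrow> case V of (n, l) \<Rightarrow> fr (y [^] l \<otimes> m \<oplus> y [^] k \<otimes> n) (k + l))
      = fr (y [^] l \<otimes> m \<oplus> y [^] k \<otimes> n) (k + l)" if "U \<in> fr m k" "V \<in> fr n l" for U V
    using that by (cases U, cases V) (simp only: prod.case)
  have ne: "fr m k \<noteq> {}" "fr n l \<noteq> {}" using frac_self[OF m, of k] frac_self[OF n, of l] by blast+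
  have "(\<Union>U\<in>fr m k. \<Union>V\<in>fr n l. case U of (m, k) \<Rightarrow> case V of (n, l) \<Rightarrow> fr (y [^] l \<otimes> m \<oplus> y [^] k \<otimes> n) (k + l))
      = fr (y [^] l \<otimes> m \<oplus> y [^] k \<otimes> n) (k + l)"
    by (rule SUP_eq_const[OF ne(1)], rule SUP_eq_const[OF ne(2)], rule eq)
  then show ?thesis by (simp add: cech_top_def localization_def case_prod_unfold)
qed

lemma L_smult:
  assumes m: "m \<in> carrier R" and r: "r \<in> carrier R"
  shows "r \<odot>\<^bsub>L\<^esub> fr m k = fr (r \<otimes> m) k"
proof -
  have "fr (r \<otimes> m') k' = fr (r \<otimes> m) k" if m': "(m', k') \<in> fr m k" for m' k'
  proof -
    from m' m obtain a :: nat where a: "m' \<in> carrier R" "y [^] (a + k') \<otimes> m = y [^] (a + k) \<otimes> m'" by (auto simp: mem_frac_iff)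
    have "y [^] (a + k') \<otimes> (r \<otimes> m) = r \<otimes> (y [^] (a + k') \<otimes> m)" using m r by (simp add: m_lcomm)
    also have "\<dots> = y [^] (a + k) \<otimes> (r \<otimes> m')" unfolding a(2) using a(1) r by (simp add: m_lcomm)
    finally show ?thesis using m r a(1) by (subst frac_eq_iff) (auto intro!: exI[of _ a])
  qed
  then have eq: "(case U of (m, k) \<Rightarrow> fr (r \<otimes> m) k) = fr (r \<otimes> m) k" if "U \<in> fr m k" for U
    using that by (cases U) (simp only: prod.case)
  have ne: "fr m k \<noteq> {}" using frac_self[OF m, of k] by blast
  have "(\<Union>U\<in>fr m k. case U of (m, k) \<Rightarrow> fr (r \<otimes> m) k) = fr (r \<otimes> m) k"
    by (rule SUP_eq_const[OF ne eq])
  then show ?thesis by (simp add: cech_top_def localization_def)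
qed

lemma L_add_same: "m \<in> carrier R \<Longrightarrow> n \<in> carrier R \<Longrightarrow> fr m k \<oplus>\<^bsub>L\<^esub> fr n k = fr (m \<oplus> n) k"
  using frac_scale[of "m \<oplus> n" k k] by (simp add: L_add r_distr)

lemma frac_zero: "fr \<zero> k = \<zero>\<^bsub>L\<^esub>"
  by (simp add: L_zero frac_eq_iff)

lemma L_module: "Module.module R L"
proof (rule moduleI)
  show "cring R" by (rule is_cring)
  have E: "\<exists>m k. u = fr m k \<and> m \<in> carrier R" if "u \<in> carrier L" for u using that by (auto simp: L_carrier)
  show "abelian_group L"
  proof (rule abelian_groupI)
    fix u v assume "u \<in> carrier L" "v \<in> carrier L"
    then obtain m k n l where e: "u = fr m k" "m \<in> carrier R" "v = fr n l" "n \<in> carrier R" using E by metis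
    then show "u \<oplus>\<^bsub>L\<^esub> v \<in> carrier L" by (simp add: L_add)
    show "u \<oplus>\<^bsub>L\<^esub> v = v \<oplus>\<^bsub>L\<^esub> u" using e by (simp add: L_add a_comm add.commute)
    fix w assume "w \<in> carrier L"
    then obtain n' j where w: "w = fr n' j" "n' \<in> carrier R" using E by metis
    show "u \<oplus>\<^bsub>L\<^esub> v \<oplus>\<^bsub>L\<^esub> w = u \<oplus>\<^bsub>L\<^esub> (v \<oplus>\<^bsub>L\<^esub> w)"
      using e w by (simp add: L_add r_distr y_pow_mult a_assoc ac_simps)
  next
    fix u assume "u \<in> carrier L"
    then obtain m k where e: "u = fr m k" "m \<in> carrier R" using E by metis
    show "\<zero>\<^bsub>L\<^esub> \<oplus>\<^bsub>L\<^esub> u = u" using e frac_zero[of k, symmetric] by (simp add: L_add_same)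
    show "\<exists>v\<in>carrier L. v \<oplus>\<^bsub>L\<^esub> u = \<zero>\<^bsub>L\<^esub>"
      using e frac_zero[of k] by (intro bexI[of _ "fr (\<ominus> m) k"]) (auto simp: L_add_same l_neg)
  qed (simp add: L_zero)
  fix a b u assume ab: "a \<in> carrier R" "b \<in> carrier R" and "u \<in> carrier L"
  then obtain m k where e: "u = fr m k" "m \<in> carrier R" using E by metis
  show "a \<odot>\<^bsub>L\<^esub> u \<in> carrier L" "(a \<oplus> b) \<odot>\<^bsub>L\<^esub> u = a \<odot>\<^bsub>L\<^esub> u \<oplus>\<^bsub>L\<^esub> b \<odot>\<^bsub>L\<^esub> u"
    "a \<otimes> b \<odot>\<^bsub>L\<^esub> u = a \<odot>\<^bsub>L\<^esub> (b \<odot>\<^bsub>L\<^esub> u)"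
    using e ab by (simp_all add: L_smult L_add_same l_distr m_assoc)
  fix v assume "v \<in> carrier L"
  then obtain n l where e': "v = fr n l" "n \<in> carrier R" using E by metis
  show "a \<odot>\<^bsub>L\<^esub> (u \<oplus>\<^bsub>L\<^esub> v) = a \<odot>\<^bsub>L\<^esub> u \<oplus>\<^bsub>L\<^esub> a \<odot>\<^bsub>L\<^esub> v"
    using e e' ab by (simp add: L_smult L_add r_distr m_lcomm)
next
  show "\<one> \<odot>\<^bsub>L\<^esub> u = u" if "u \<in> carrier L" for u
    using that by (auto simp: L_carrier L_smult)
qed

sublocale L: rmodule R L
  by (rule rmoduleI[OF L_module])

lemma L_uminus: "m \<in> carrier R \<Longrightarrow> \<ominus>\<^bsub>L\<^esub> fr m k = fr (\<ominus> m) k"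
  using frac_zero[of k] by (intro L.M.minus_equality) (simp_all add: L_add_same l_neg)

lemma pow_ideal_ideal: "ideal (pow_ideal k) R"
  using x_pow_carrier by (intro genideal_ideal) auto

lemma pow_ideal_gen: "i < d \<Longrightarrow> x i [^] (k::nat) \<in> pow_ideal k"
  using x_pow_carrier by (intro set_mp[OF genideal_self]) auto

text \<open>Each \<open>x i\<close> divides \<open>y\<close>, so \<open>y^l\<close> contributes the
  missing \<open>l\<close> factors to \<open>x i ^ k\<close>. Multiplication by \<open>y^l\<close>
  is the transition map between the quotients by \<open>pow_ideal k\<close> and
  \<open>pow_ideal (k + l)\<close>.\<close>

lemma y_pow_mem:
  assumes "m \<in> pow_ideal k"
  shows "y [^] (l::nat) \<otimes> m \<in> pow_ideal (k + l)"
proof -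
  have "pow_ideal k \<subseteq> {a \<in> carrier R. a \<otimes> y [^] l \<in> pow_ideal (k + l)}"
  proof (rule genideal_minimal[OF colon_ideal[OF pow_ideal_ideal]])
    show "(\<lambda>i. x i [^] k) ` {..<d} \<subseteq> {a \<in> carrier R. a \<otimes> y [^] l \<in> pow_ideal (k + l)}"
    proof (rule image_subsetI)
      fix i assume "i \<in> {..<d}"
      then have i: "i < d" by simp
      define z where "z = finprod R x ({..<d} - {i})"
      have z: "z \<in> carrier R" unfolding z_def using x_carrier by (intro finprod_closed) auto
      have xi: "x i \<in> carrier R" using i x_carrier by auto
      have "{..<d} = insert i ({..<d} - {i})" using i by auto
      then have "y = finprod R x (insert i ({..<d} - {i}))" by simp
      also have "\<dots> = x i \<otimes> z" unfolding z_def using x_carrier xi by (intro finprod_insert) auto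
      finally have "x i [^] k \<otimes> y [^] l = (x i [^] k \<otimes> x i [^] l) \<otimes> z [^] l"
        using z xi by (simp add: nat_pow_distrib m_assoc)
      also have "\<dots> = x i [^] (k + l) \<otimes> z [^] l" using xi by (simp add: nat_pow_mult)
      also have "\<dots> \<in> pow_ideal (k + l)"
        using z by (intro ideal.I_r_closed[OF pow_ideal_ideal pow_ideal_gen[OF i]]) simp
      finally show "x i [^] k \<in> {a \<in> carrier R. a \<otimes> y [^] l \<in> pow_ideal (k + l)}"
        using xi by simp
    qed
  qed simp
  with assms have "m \<in> carrier R" "m \<otimes> y [^] l \<in> pow_ideal (k + l)" by auto
  then show ?thesis by (simp add: m_comm)
qed

lemma B_submodule: "submodule B R L"
  unfolding cech_boundaries_def using x_pow_carrier by (intro L.mod_span_submodule) auto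

lemma frac_B_ideal: "ideal {m \<in> carrier R. fr m k \<in> B} R"
proof (rule idealI_smult)
  note BE = L.submoduleE[OF B_submodule] L.submodule_zero[OF B_submodule]
  have "\<zero> \<in> {m \<in> carrier R. fr m k \<in> B}" using BE(7) by (simp add: frac_zero)
  then show "{m \<in> carrier R. fr m k \<in> B} \<noteq> {}" by blast
qed (auto simp: L_add_same[symmetric] L_smult[symmetric] intro: L.submoduleE(4,5)[OF B_submodule])

lemma frac_mem_B:
  assumes "m \<in> pow_ideal k"
  shows "fr m k \<in> B"
proof -
  have "fr (x i [^] k) k \<in> B" if "i < d" for i
  proof -
    have "fr (x i [^] k \<odot>\<^bsub>self_module R\<^esub> \<one>) k \<in> B"
      unfolding cech_boundaries_def
      by (intro set_mp[OF L.mod_span_incl] CollectI exI conjI, rule refl) (use that in auto)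
    then show ?thesis using x_pow_carrier[OF that] by simp
  qed
  then have "pow_ideal k \<subseteq> {m \<in> carrier R. fr m k \<in> B}"
    using x_pow_carrier by (intro genideal_minimal[OF frac_B_ideal]) auto
  with assms show ?thesis by blast
qed

text \<open>The fractions with numerator in the ideal of the matching stage contain the generators
  and are closed under addition after passing to a common denominator, so they exhaust the
  span.\<close>

lemma B_eq: "B = {fr m k | m k. m \<in> pow_ideal k}"
proof
  have car: "m \<in> carrier R" if "m \<in> pow_ideal k" for m k using ideal.Icarr[OF pow_ideal_ideal that] .
  note idl = pow_ideal_ideal[THEN ideal.axioms(1)]
  have sub: "submodule {fr m k | m k. m \<in> pow_ideal k} R L"
  proof (rule L.submoduleI)
    have "\<zero> \<in> pow_ideal 0" by (rule additive_subgroup.zero_closed[OF idl])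
    then show "\<zero>\<^bsub>L\<^esub> \<in> {fr m k | m k. m \<in> pow_ideal k}" unfolding L_zero by blast
  next
    fix u assume "u \<in> {fr m k | m k. m \<in> pow_ideal k}"
    then obtain m k where u: "u = fr m k" "m \<in> pow_ideal k" by auto
    then have "\<ominus> m \<in> pow_ideal k" by (intro additive_subgroup.a_inv_closed[OF idl])
    then show "\<ominus>\<^bsub>L\<^esub> u \<in> {fr m k | m k. m \<in> pow_ideal k}"
      unfolding u(1) L_uminus[OF car[OF u(2)]] by blast
    fix r assume r: "r \<in> carrier R"
    have "r \<otimes> m \<in> pow_ideal k" by (rule ideal.I_l_closed[OF pow_ideal_ideal u(2) r])
    then show "r \<odot>\<^bsub>L\<^esub> u \<in> {fr m k | m k. m \<in> pow_ideal k}"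
      unfolding u(1) L_smult[OF car[OF u(2)] r] by blast
  next
    fix u v assume "u \<in> {fr m k | m k. m \<in> pow_ideal k}" "v \<in> {fr m k | m k. m \<in> pow_ideal k}"
    then obtain m k n l where u: "u = fr m k" "m \<in> pow_ideal k" and v: "v = fr n l" "n \<in> pow_ideal l" by blast
    \<comment> \<open>Both numerators are moved to the common stage \<open>k + l\<close> by
      \<open>y_pow_mem\<close>.\<close>
    have "y [^] l \<otimes> m \<oplus> y [^] k \<otimes> n \<in> pow_ideal (k + l)"
      using y_pow_mem[OF u(2), of l] y_pow_mem[OF v(2), of k]
      by (intro additive_subgroup.a_closed[OF idl]) (simp_all add: add.commute)
    then show "u \<oplus>\<^bsub>L\<^esub> v \<in> {fr m k | m k. m \<in> pow_ideal k}"
      unfolding u(1) v(1) L_add[OF car[OF u(2)] car[OF v(2)]] by blast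
  qed (auto dest: car)
  have gens: "fr (x i [^] k \<otimes> m) k \<in> {fr m k | m k. m \<in> pow_ideal k}" if "i < d" "m \<in> carrier R" for i m k
    using ideal.I_r_closed[OF pow_ideal_ideal pow_ideal_gen[OF that(1)] that(2), of k] by blast
  show "B \<subseteq> {fr m k | m k. m \<in> pow_ideal k}"
    unfolding cech_boundaries_def using gens by (intro L.mod_span_minimal[OF sub]) auto
  show "{fr m k | m k. m \<in> pow_ideal k} \<subseteq> B" using frac_mem_B by blast
qed

text \<open>The cokernel is the direct limit of the quotients by \<open>pow_ideal k\<close>, and a
  class in a direct limit vanishes exactly when it vanishes at some later stage. This is the form in
  which cohomology enters the colon argument.\<close>

lemma frac_mem_B_iff:
  assumes m: "m \<in> carrier R"
  shows "fr m k \<in> B \<longleftrightarrow> (\<exists>l::nat. y [^] l \<otimes> m \<in> pow_ideal (k + l))"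
proof
  assume "fr m k \<in> B"
  then obtain n j where n: "fr m k = fr n j" "n \<in> pow_ideal j" unfolding B_eq by auto
  have nR: "n \<in> carrier R" using ideal.Icarr[OF pow_ideal_ideal n(2)] .
  obtain l :: nat where l: "y [^] (l + j) \<otimes> m = y [^] (l + k) \<otimes> n" using n(1) frac_eq_iff[OF m nR] by auto
  have "y [^] (l + j) \<otimes> m \<in> pow_ideal (k + (l + j))"
    unfolding l using y_pow_mem[OF n(2), of "l + k"] by (simp add: ac_simps)
  then show "\<exists>l::nat. y [^] l \<otimes> m \<in> pow_ideal (k + l)" by blast
next
  assume "\<exists>l::nat. y [^] l \<otimes> m \<in> pow_ideal (k + l)"
  then obtain l :: nat where "y [^] l \<otimes> m \<in> pow_ideal (k + l)" by auto
  from frac_mem_B[OF this] show "fr m k \<in> B" using m by (simp add: frac_scale)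
qed

abbreviation "H \<equiv> local_coh R (self_module R) d x"
abbreviation "coh \<equiv> coh_class R (self_module R) d x"

lemma H_carrierE:
  assumes "\<eta> \<in> carrier H"
  obtains m k where "m \<in> carrier R" "\<eta> = coh m k"
  using assms by (auto simp: local_coh_def quot_module_def A_RCOSETS_def' L_carrier coh_class_def)

lemma coh_eq_zero_iff:
  assumes "m \<in> carrier R"
  shows "coh m k = \<zero>\<^bsub>H\<^esub> \<longleftrightarrow> (\<exists>l::nat. y [^] l \<otimes> m \<in> pow_ideal (k + l))"
  using assms L.coset_eq_zero_iff[OF B_submodule, of "fr m k"]
  by (simp add: coh_class_def local_coh_def quot_module_def frac_mem_B_iff)

lemma coh_smult:
  assumes "m \<in> carrier R" "r \<in> carrier R"
  shows "r \<odot>\<^bsub>H\<^esub> coh m k = coh (r \<otimes> m) k"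
  using assms L.quot_module_smult[OF B_submodule assms(2), of "fr m k"]
  by (simp add: coh_class_def local_coh_def L_smult)

lemma coh_eq_iff:
  assumes m: "m \<in> carrier R" and m': "m' \<in> carrier R"
  shows "coh m k = coh m' k' \<longleftrightarrow> (\<exists>l::nat. y [^] l \<otimes> (y [^] k' \<otimes> m \<ominus> y [^] k \<otimes> m') \<in> pow_ideal (k + k' + l))"
proof -
  have "coh m k = coh m' k' \<longleftrightarrow> fr m k \<ominus>\<^bsub>L\<^esub> fr m' k' \<in> B"
    unfolding coh_class_def using m m' by (intro L.coset_eq_iff[OF B_submodule]) auto
  also have "fr m k \<ominus>\<^bsub>L\<^esub> fr m' k' = fr (y [^] k' \<otimes> m \<ominus> y [^] k \<otimes> m') (k + k')"
    using m m' by (simp add: a_minus_def L_uminus L_add r_minus)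
  finally show ?thesis using m m' by (simp add: frac_mem_B_iff)
qed

end

section \<open>Base change of top local cohomology\<close>

locale cech_base_change = base_change A S \<phi> + cech A d x
  for A :: "'a ring" (structure) and S :: "'s ring" (structure) and \<phi> and d x
begin

sublocale S: cech S d "\<lambda>i. \<phi> (x i)"
  by unfold_locales (use x_carrier in auto)

lemma \<phi>_y: "\<phi> y = S.y"
  using \<phi>.hom_finprod[OF x_carrier] by (simp add: comp_def)

lemma \<phi>_pow: "a \<in> carrier A \<Longrightarrow> \<phi> (a [^] (n::nat)) = \<phi> a [^]\<^bsub>S\<^esub> n"
  by (induction n) auto

lemma \<phi>_pow_ideal:
  assumes "m \<in> pow_ideal k"
  shows "\<phi> m \<in> S.pow_ideal k"
proof -
  interpret P: ideal "S.pow_ideal k" S by (rule S.pow_ideal_ideal)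
  have I: "ideal {a \<in> carrier A. \<phi> a \<in> S.pow_ideal k} A"
  proof (rule A.idealI_smult)
    have "\<zero> \<in> {a \<in> carrier A. \<phi> a \<in> S.pow_ideal k}" by simp
    then show "{a \<in> carrier A. \<phi> a \<in> S.pow_ideal k} \<noteq> {}" by blast
  qed (auto intro: P.I_l_closed)
  have "pow_ideal k \<subseteq> {a \<in> carrier A. \<phi> a \<in> S.pow_ideal k}"
    using S.pow_ideal_gen x_carrier x_pow_carrier by (intro A.genideal_minimal[OF I]) (auto simp: \<phi>_pow Pi_iff)
  with assms show ?thesis by blast
qed

text \<open>Vanishing of a class over \<open>S\<close> yields the ideal of powers of the images of
  the \<open>x i\<close>, while the colon results speak of ideals extended from \<open>A\<close>;
  this inclusion passes from the first to the second.\<close>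

lemma S_pow_ideal_subset: "S.pow_ideal k \<subseteq> Idl\<^bsub>S\<^esub> (\<phi> ` pow_ideal k)"
proof (rule S.genideal_minimal[OF ideal_extension[OF pow_ideal_ideal]])
  show "(\<lambda>i. \<phi> (x i) [^]\<^bsub>S\<^esub> k) ` {..<d} \<subseteq> Idl\<^bsub>S\<^esub> (\<phi> ` pow_ideal k)"
  proof (rule image_subsetI)
    fix i assume i: "i \<in> {..<d}"
    then have "\<phi> (x i [^] k) \<in> Idl\<^bsub>S\<^esub> (\<phi> ` pow_ideal k)"
      by (intro ideal_extension_mem[OF pow_ideal_ideal] pow_ideal_gen) auto
    then show "\<phi> (x i) [^]\<^bsub>S\<^esub> k \<in> Idl\<^bsub>S\<^esub> (\<phi> ` pow_ideal k)" using i x_carrier by (auto simp: \<phi>_pow Pi_iff)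
  qed
qed

text \<open>The description in \<open>H_map\<close> is independent of the fraction chosen: two
  fractions of the same class differ by a boundary at some finite stage, and \<phi> carries that
  stage to \<open>S\<close>.\<close>

lemma H_map_coh:
  assumes m: "m \<in> carrier A"
  shows "H_map A S \<phi> d x (coh m k) = S.coh (\<phi> m) k"
  unfolding H_map_def
proof (rule the_equality)
  show "\<exists>m' k'. m' \<in> carrier A \<and> coh m k = coh m' k' \<and> S.coh (\<phi> m) k = S.coh (\<phi> m') k'" using m by blast
  fix \<xi> assume "\<exists>m' k'. m' \<in> carrier A \<and> coh m k = coh m' k' \<and> \<xi> = S.coh (\<phi> m') k'"
  then obtain m' k' where m': "m' \<in> carrier A" "coh m k = coh m' k'" "\<xi> = S.coh (\<phi> m') k'" by blast
  then obtain l :: nat where l: "y [^] l \<otimes> (y [^] k' \<otimes> m \<ominus> y [^] k \<otimes> m') \<in> pow_ideal (k + k' + l)"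
    using coh_eq_iff[OF m m'(1)] by auto
  have "S.y [^]\<^bsub>S\<^esub> l \<otimes>\<^bsub>S\<^esub> (S.y [^]\<^bsub>S\<^esub> k' \<otimes>\<^bsub>S\<^esub> \<phi> m \<ominus>\<^bsub>S\<^esub> S.y [^]\<^bsub>S\<^esub> k \<otimes>\<^bsub>S\<^esub> \<phi> m') \<in> S.pow_ideal (k + k' + l)"
    using \<phi>_pow_ideal[OF l] m m'(1) by (simp add: a_minus_def \<phi>_pow \<phi>_y)
  then show "\<xi> = S.coh (\<phi> m) k"
    unfolding m'(3) using S.coh_eq_iff[of "\<phi> m" "\<phi> m'" k k'] m m'(1) by auto
qed

text \<open>The stage \<open>l\<close> at which the class vanishes may depend on the root
  \<open>j\<close>. Later a single root is selected, so one stage is enough there.\<close>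

lemma almost_kills_coh_iff:
  assumes m: "m \<in> carrier A" and g: "g \<in> carrier S" and \<kappa>: "\<And>j. \<kappa> (Kcirc_root p j) \<in> carrier S"
  shows "almost_kills p A S \<kappa> \<phi> d x g (coh m k) \<longleftrightarrow>
    (\<forall>j>0. \<exists>l. S.y [^]\<^bsub>S\<^esub> l \<otimes>\<^bsub>S\<^esub> (\<kappa> (Kcirc_root p j) \<otimes>\<^bsub>S\<^esub> (g \<otimes>\<^bsub>S\<^esub> \<phi> m)) \<in> S.pow_ideal (k + l))"
  unfolding almost_kills_def almost_zero_elt_def H_ext_def H_map_coh[OF m]
  using m g \<kappa> by (simp add: S.coh_smult S.coh_eq_zero_iff)

end

section \<open>Completions and roots of \<open>p\<close>\<close>

text \<open>Applied twice: to the integers for the ring of \<open>p\<close>-adic integers, and to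
  the algebra with adjoined roots of \<open>p\<close> for the base ring.\<close>

locale completion_setup = cring R for R :: "'a ring" (structure) +
  fixes I :: "'a set"
  assumes I: "ideal I R"
begin

abbreviation "P n \<equiv> ideal_pow R I n"
abbreviation "C \<equiv> completion R I"

lemma P_ideal: "ideal (P n) R"
  by (rule ideal_pow_ideal[OF is_cring I])

lemma P_Suc: "P (Suc n) \<subseteq> P n"
  by (rule ideal_pow_Suc_subset[OF is_cring I])

lemma Q_cring: "cring (R Quot P n)"
  by (rule ideal.quotient_is_cring[OF P_ideal is_cring])

lemma Q_simps:
  "carrier (R Quot J) = a_rcosets J" "X \<otimes>\<^bsub>R Quot J\<^esub> Y = rcoset_mult R J X Y"
  "\<one>\<^bsub>R Quot J\<^esub> = J +> \<one>" "\<zero>\<^bsub>R Quot J\<^esub> = J" "X \<oplus>\<^bsub>R Quot J\<^esub> Y = X <+> Y"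
  by (simp_all add: FactRing_def)

lemma C_simps:
  "u \<in> carrier C \<longleftrightarrow> (\<forall>n. u n \<in> carrier (R Quot P n) \<and> u (Suc n) \<subseteq> u n)"
  "u \<otimes>\<^bsub>C\<^esub> v = (\<lambda>n. u n \<otimes>\<^bsub>R Quot P n\<^esub> v n)" "\<one>\<^bsub>C\<^esub> = (\<lambda>n. \<one>\<^bsub>R Quot P n\<^esub>)"
  "\<zero>\<^bsub>C\<^esub> = (\<lambda>n. \<zero>\<^bsub>R Quot P n\<^esub>)" "u \<oplus>\<^bsub>C\<^esub> v = (\<lambda>n. u n \<oplus>\<^bsub>R Quot P n\<^esub> v n)"
  by (simp_all add: completion_def)

lemma coset_Suc: "P (Suc n) +> a \<subseteq> P n +> a"
  using P_Suc by (auto simp: a_r_coset_def')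

lemma C_add_closed: "u \<in> carrier C \<Longrightarrow> v \<in> carrier C \<Longrightarrow> u \<oplus>\<^bsub>C\<^esub> v \<in> carrier C"
  unfolding C_simps
proof (intro allI conjI)
  fix n assume uv: "\<forall>n. u n \<in> carrier (R Quot P n) \<and> u (Suc n) \<subseteq> u n"
    "\<forall>n. v n \<in> carrier (R Quot P n) \<and> v (Suc n) \<subseteq> v n"
  interpret Q: cring "R Quot P n" by (rule Q_cring)
  show "u n \<oplus>\<^bsub>R Quot P n\<^esub> v n \<in> carrier (R Quot P n)" using uv by blast
  show "u (Suc n) \<oplus>\<^bsub>R Quot P (Suc n)\<^esub> v (Suc n) \<subseteq> u n \<oplus>\<^bsub>R Quot P n\<^esub> v n"
    unfolding Q_simps set_add_def' using uv by blast
qed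

lemma C_mult_closed: "u \<in> carrier C \<Longrightarrow> v \<in> carrier C \<Longrightarrow> u \<otimes>\<^bsub>C\<^esub> v \<in> carrier C"
  unfolding C_simps
proof (intro allI conjI)
  fix n assume uv: "\<forall>n. u n \<in> carrier (R Quot P n) \<and> u (Suc n) \<subseteq> u n"
    "\<forall>n. v n \<in> carrier (R Quot P n) \<and> v (Suc n) \<subseteq> v n"
  interpret Q: cring "R Quot P n" by (rule Q_cring)
  show "u n \<otimes>\<^bsub>R Quot P n\<^esub> v n \<in> carrier (R Quot P n)" using uv by blast
  show "u (Suc n) \<otimes>\<^bsub>R Quot P (Suc n)\<^esub> v (Suc n) \<subseteq> u n \<otimes>\<^bsub>R Quot P n\<^esub> v n"
    unfolding Q_simps rcoset_mult_def by (intro UN_mono coset_Suc) (use uv in blast)+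
qed

lemma C_one_closed: "\<one>\<^bsub>C\<^esub> \<in> carrier C"
  unfolding C_simps
proof (intro allI conjI)
  fix n
  interpret Q: cring "R Quot P n" by (rule Q_cring)
  show "\<one>\<^bsub>R Quot P n\<^esub> \<in> carrier (R Quot P n)" by (rule Q.one_closed)
  show "\<one>\<^bsub>R Quot P (Suc n)\<^esub> \<subseteq> \<one>\<^bsub>R Quot P n\<^esub>" unfolding Q_simps by (rule coset_Suc)
qed

lemma C_zero_closed: "\<zero>\<^bsub>C\<^esub> \<in> carrier C"
  unfolding C_simps
proof (intro allI conjI)
  fix n
  interpret Q: cring "R Quot P n" by (rule Q_cring)
  show "\<zero>\<^bsub>R Quot P n\<^esub> \<in> carrier (R Quot P n)" by (rule Q.zero_closed)
  show "\<zero>\<^bsub>R Quot P (Suc n)\<^esub> \<subseteq> \<zero>\<^bsub>R Quot P n\<^esub>" unfolding Q_simps by (rule P_Suc)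
qed

text \<open>Sums and products of cosets are monotone as sets, whereas the negative is only given
  abstractly by the quotient ring. So a representative at level \<open>n + 1\<close> is taken; it
  also represents level \<open>n\<close>, and the quotient maps compute both negatives from
  it.\<close>

lemma C_uminus_closed:
  assumes "u \<in> carrier C"
  shows "(\<lambda>n. \<ominus>\<^bsub>R Quot P n\<^esub> u n) \<in> carrier C"
  unfolding C_simps
proof (intro allI conjI)
  fix n
  have u: "u n \<in> carrier (R Quot P n)" "u (Suc n) \<in> carrier (R Quot P (Suc n))" "u (Suc n) \<subseteq> u n"
    using assms unfolding C_simps by blast+
  interpret Q: cring "R Quot P n" by (rule Q_cring)
  show "\<ominus>\<^bsub>R Quot P n\<^esub> u n \<in> carrier (R Quot P n)" using u(1) by (rule Q.a_inv_closed)
  obtain a where a: "a \<in> carrier R" "u (Suc n) = P (Suc n) +> a"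
    using u(2) unfolding Q_simps by (auto simp: A_RCOSETS_def')
  interpret P0: ideal "P n" R by (rule P_ideal)
  interpret P1: ideal "P (Suc n)" R by (rule P_ideal)
  interpret h0: ring_hom_ring R "R Quot P n" "(+>) (P n)" by (rule P0.rcos_ring_hom_ring)
  interpret h1: ring_hom_ring R "R Quot P (Suc n)" "(+>) (P (Suc n))" by (rule P1.rcos_ring_hom_ring)
  have "a \<in> u (Suc n)" unfolding a(2) by (rule P1.a_rcos_self[OF a(1)])
  then have "a \<in> u n" using u(3) by blast
  obtain b where b: "b \<in> carrier R" "u n = P n +> b" using u(1) unfolding Q_simps by (auto simp: A_RCOSETS_def')
  have "u n = P n +> a"
    unfolding b(2) by (rule P0.a_repr_independence'[OF \<open>a \<in> u n\<close>[unfolded b(2)] b(1)])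
  then show "\<ominus>\<^bsub>R Quot P (Suc n)\<^esub> u (Suc n) \<subseteq> \<ominus>\<^bsub>R Quot P n\<^esub> u n"
    by (simp only: a(2) h0.hom_a_inv[OF a(1), symmetric] h1.hom_a_inv[OF a(1), symmetric] coset_Suc)
qed

text \<open>The inverse limit sits inside a product of quotient rings, so each law is checked level
  by level through \<open>ext\<close>; compatibility between levels matters for closure
  alone.\<close>

lemma C_cring: "cring C"
proof -
  have C: "u n \<in> carrier (R Quot P n)" if "u \<in> carrier C" for u n using that by (simp add: C_simps)
  have ext: "u = v" if "\<And>n. cring (R Quot P n) \<Longrightarrow> u n = v n" for u v :: "nat \<Rightarrow> 'a set"
    using that Q_cring by auto
  show ?thesis
  proof (rule cringI)
    show "abelian_group C"
    proof (rule abelian_groupI)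
      fix u v w assume C3: "u \<in> carrier C" "v \<in> carrier C" "w \<in> carrier C"
      show "u \<oplus>\<^bsub>C\<^esub> v \<oplus>\<^bsub>C\<^esub> w = u \<oplus>\<^bsub>C\<^esub> (v \<oplus>\<^bsub>C\<^esub> w)"
        by (rule ext) (simp add: C_simps(2-) cring_def ring.ring_simprules(7) C C3)
    next
      fix u v assume C2: "u \<in> carrier C" "v \<in> carrier C"
      show "u \<oplus>\<^bsub>C\<^esub> v = v \<oplus>\<^bsub>C\<^esub> u"
        by (rule ext) (simp add: C_simps(2-) cring_def ring.ring_simprules(10) C C2)
    next
      fix u assume u: "u \<in> carrier C"
      show "\<zero>\<^bsub>C\<^esub> \<oplus>\<^bsub>C\<^esub> u = u"
        by (rule ext) (simp add: C_simps(2-) cring_def ring.ring_simprules(8) C u)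
      have "(\<lambda>n. \<ominus>\<^bsub>R Quot P n\<^esub> u n) \<oplus>\<^bsub>C\<^esub> u = \<zero>\<^bsub>C\<^esub>"
        by (rule ext) (simp add: C_simps(2-) cring_def ring.ring_simprules(9) C u)
      with C_uminus_closed[OF u] show "\<exists>v\<in>carrier C. v \<oplus>\<^bsub>C\<^esub> u = \<zero>\<^bsub>C\<^esub>" by blast
    qed (simp_all add: C_add_closed C_zero_closed)
    show "comm_monoid C"
    proof (rule comm_monoidI)
      fix u v w assume C3: "u \<in> carrier C" "v \<in> carrier C" "w \<in> carrier C"
      show "u \<otimes>\<^bsub>C\<^esub> v \<otimes>\<^bsub>C\<^esub> w = u \<otimes>\<^bsub>C\<^esub> (v \<otimes>\<^bsub>C\<^esub> w)"
        by (rule ext) (simp add: C_simps(2-) cring_def ring.ring_simprules(11) C C3)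
    next
      fix u v assume C2: "u \<in> carrier C" "v \<in> carrier C"
      show "u \<otimes>\<^bsub>C\<^esub> v = v \<otimes>\<^bsub>C\<^esub> u"
        by (rule ext) (simp add: C_simps(2-) cring.cring_simprules(14) C C2)
    next
      fix u assume u: "u \<in> carrier C"
      show "\<one>\<^bsub>C\<^esub> \<otimes>\<^bsub>C\<^esub> u = u"
        by (rule ext) (simp add: C_simps(2-) cring.cring_simprules(12) C u)
    qed (simp_all add: C_mult_closed C_one_closed)
    fix u v w assume C3: "u \<in> carrier C" "v \<in> carrier C" "w \<in> carrier C"
    show "(u \<oplus>\<^bsub>C\<^esub> v) \<otimes>\<^bsub>C\<^esub> w = u \<otimes>\<^bsub>C\<^esub> w \<oplus>\<^bsub>C\<^esub> v \<otimes>\<^bsub>C\<^esub> w"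
      by (rule ext) (simp add: C_simps(2-) cring.cring_simprules(13) C C3)
  qed
qed

lemma to_completion_hom: "to_completion R I \<in> ring_hom R C"
proof (rule ring_hom_memI)
  fix a b assume a: "a \<in> carrier R" and b: "b \<in> carrier R"
  note h = P_ideal[THEN ideal.rcos_ring_hom]
  show "to_completion R I a \<in> carrier C"
    using ring_hom_closed[OF h a] coset_Suc by (simp add: C_simps to_completion_def)
  show "to_completion R I (a \<otimes> b) = to_completion R I a \<otimes>\<^bsub>C\<^esub> to_completion R I b"
    using ring_hom_mult[OF h a b] by (simp add: C_simps to_completion_def)
  show "to_completion R I (a \<oplus> b) = to_completion R I a \<oplus>\<^bsub>C\<^esub> to_completion R I b"
    using ring_hom_add[OF h a b] by (simp add: C_simps to_completion_def)
next
  note h = P_ideal[THEN ideal.rcos_ring_hom]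
  show "to_completion R I \<one> = \<one>\<^bsub>C\<^esub>"
    using ring_hom_one[OF h] by (simp add: C_simps to_completion_def)
qed

end

text \<open>An element of all powers has the same cosets as zero, and completeness includes
  injectivity of the map to the completion. This supplies separatedness of \<open>A\<close>.\<close>

lemma adically_complete_separated:
  assumes R: "cring R" and I: "ideal I R" and complete: "adically_complete R I"
    and a: "a \<in> carrier R" and mem: "\<And>n. a \<in> ideal_pow R I n"
  shows "a = \<zero>\<^bsub>R\<^esub>"
proof -
  interpret cring R by fact
  have "ideal_pow R I n +>\<^bsub>R\<^esub> a = ideal_pow R I n +>\<^bsub>R\<^esub> \<zero>\<^bsub>R\<^esub>" for n
  proof -
    interpret P: ideal "ideal_pow R I n" R by (rule ideal_pow_ideal[OF R I])
    show ?thesis using P.a_rcos_const[OF mem] P.a_rcos_const[OF P.zero_closed] by simp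
  qed
  then have "to_completion R I a = to_completion R I \<zero>\<^bsub>R\<^esub>" by (simp add: to_completion_def)
  then show ?thesis
    using complete a unfolding adically_complete_def bij_betw_def by (auto dest: inj_onD)
qed

lemma finsum_self_module: "finsum (self_module R) = finsum R"
  by (simp add: finsum_def finprod_def fun_eq_iff)

text \<open>Linear maps on a free module are compared on basis vectors; this is what reduces
  associativity in \<open>T\<close> to monomials.\<close>

lemma module_hom_free_eq:
  assumes R: "cring R" and M: "Module.module R M"
    and h: "h \<in> module_hom R (free_module R Y) M" and h': "h' \<in> module_hom R (free_module R Y) M"
    and eq: "\<And>y. y \<in> Y \<Longrightarrow> h (delta R y) = h' (delta R y)" and c: "c \<in> fin_supp R Y"
  shows "h c = h' c"
proof -
  interpret M: rmodule R M by (rule rmoduleI[OF M])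
  note F = free_module_module[OF R, of Y]
  have d: "delta R \<in> Y \<rightarrow> carrier (free_module R Y)" using delta_fin_supp[OF R] by auto
  have "lin_comb R M (\<lambda>y. h (delta R y)) c = lin_comb R M (\<lambda>y. h' (delta R y)) c"
    unfolding lin_comb_def
  proof (rule M.M.finsum_cong')
    fix y assume "y \<in> {x. c x \<noteq> \<zero>\<^bsub>R\<^esub>}"
    then show "c y \<odot>\<^bsub>M\<^esub> h (delta R y) = c y \<odot>\<^bsub>M\<^esub> h' (delta R y)" using eq fin_suppD(4)[OF c] by auto
  next
    show "(\<lambda>y. c y \<odot>\<^bsub>M\<^esub> h' (delta R y)) \<in> {x. c x \<noteq> \<zero>\<^bsub>R\<^esub>} \<rightarrow> carrier M"
    proof
      fix y assume "y \<in> {x. c x \<noteq> \<zero>\<^bsub>R\<^esub>}"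
      then have "y \<in> Y" using fin_suppD(4)[OF c] by blast
      then have "h' (delta R y) \<in> carrier M" using module_homD(1)[OF h'] d by blast
      then show "c y \<odot>\<^bsub>M\<^esub> h' (delta R y) \<in> carrier M" using fin_suppD(1)[OF c] by blast
    qed
  qed simp
  then show ?thesis
    using module_hom_lin_comb[OF F M h c d] module_hom_lin_comb[OF F M h' c d] lin_comb_free_deltas[OF R c] by simp
qed

section \<open>Polynomials with exponents in the nonnegative part of Z[1/p]\<close>

locale perfect_poly = cring R for R :: "'a ring" (structure) +
  fixes p :: nat
  assumes p_pos: "p > 0"
begin

abbreviation "E \<equiv> p_exponents p"
abbreviation "T \<equiv> perfect_poly_ring p R"

lemma E_add: "a \<in> E \<Longrightarrow> b \<in> E \<Longrightarrow> a + b \<in> E"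
proof -
  assume "a \<in> E" "b \<in> E"
  then obtain k l :: nat where ab: "a \<ge> 0" "b \<ge> 0" "a * of_nat p ^ k \<in> \<int>" "b * of_nat p ^ l \<in> \<int>"
    by (auto simp: p_exponents_def)
  have "(a + b) * of_nat p ^ (k + l) = (a * of_nat p ^ k) * of_nat (p ^ l) + (b * of_nat p ^ l) * of_nat (p ^ k)"
    by (simp add: power_add algebra_simps)
  also have "\<dots> \<in> \<int>" by (intro Ints_add Ints_mult[OF ab(3)] Ints_mult[OF ab(4)]) auto
  finally show "a + b \<in> E" using ab by (auto simp: p_exponents_def)
qed

lemma E_zero: "0 \<in> E" and E_one: "1 \<in> E"
  by (auto simp: p_exponents_def intro!: exI[of _ 0])

lemma E_root: "1 / of_nat (p ^ k) \<in> E"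
  using p_pos by (auto simp: p_exponents_def intro!: exI[of _ k])

interpretation SM: rmodule R "self_module R"
  by (intro rmoduleI self_module_module is_cring)

lemma T_simps:
  "carrier T = fin_supp R E" "\<one>\<^bsub>T\<^esub> = delta R 0" "\<zero>\<^bsub>T\<^esub> = (\<lambda>_. \<zero>)" "f \<oplus>\<^bsub>T\<^esub> g = (\<lambda>q. f q \<oplus> g q)"
  by (simp_all add: perfect_poly_ring_def)

text \<open>With the weights \<open>g (q - a)\<close> the convolution becomes a linear combination,
  from which additivity in \<open>f\<close> follows. A shift that leaves the exponent set
  contributes nothing since \<open>g\<close> is zero there.\<close>

lemma T_mult:
  assumes f: "f \<in> fin_supp R E" and g: "g \<in> fin_supp R E"
  shows "(f \<otimes>\<^bsub>T\<^esub> g) q = lin_comb R (self_module R) (\<lambda>a. g (q - a)) f"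
proof -
  note fD = fin_suppD[OF f] and gD = fin_suppD[OF g]
  let ?X = "{a. f a \<noteq> \<zero> \<and> g (q - a) \<noteq> \<zero>}"
  have im: "{(a, b). f a \<noteq> \<zero> \<and> g b \<noteq> \<zero> \<and> a + b = q} = (\<lambda>a. (a, q - a)) ` ?X" by force
  have "(f \<otimes>\<^bsub>T\<^esub> g) q = (\<Oplus>ab\<in>(\<lambda>a. (a, q - a)) ` ?X. f (fst ab) \<otimes> g (snd ab))"
    unfolding im[symmetric] by (simp add: perfect_poly_ring_def)
  also have "\<dots> = (\<Oplus>a\<in>?X. f (fst (a, q - a)) \<otimes> g (snd (a, q - a)))"
    using fD gD by (intro finsum_reindex inj_onI) auto
  also have "\<dots> = (\<Oplus>a\<in>{a. f a \<noteq> \<zero>}. f a \<otimes> g (q - a))"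
    using fD gD by (intro add.finprod_mono_neutral_cong_left) auto
  finally show ?thesis by (simp add: lin_comb_def finsum_self_module)
qed

lemma T_mult_comm:
  assumes f: "f \<in> fin_supp R E" and g: "g \<in> fin_supp R E"
  shows "f \<otimes>\<^bsub>T\<^esub> g = g \<otimes>\<^bsub>T\<^esub> f"
proof
  fix q
  note fD = fin_suppD[OF f] and gD = fin_suppD[OF g]
  let ?X = "{(a, b). g a \<noteq> \<zero> \<and> f b \<noteq> \<zero> \<and> a + b = q}"
  have im: "{(a, b). f a \<noteq> \<zero> \<and> g b \<noteq> \<zero> \<and> a + b = q} = prod.swap ` ?X" by (force simp: add.commute)
  have "(f \<otimes>\<^bsub>T\<^esub> g) q = (\<Oplus>ab\<in>prod.swap ` ?X. f (fst ab) \<otimes> g (snd ab))"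
    unfolding im[symmetric] by (simp add: perfect_poly_ring_def)
  also have "\<dots> = (\<Oplus>ab\<in>?X. f (fst (prod.swap ab)) \<otimes> g (snd (prod.swap ab)))"
    using fD gD by (intro finsum_reindex) auto
  also have "\<dots> = (\<Oplus>ab\<in>?X. g (fst ab) \<otimes> f (snd ab))"
    using fD gD by (intro finsum_cong') (auto simp: m_comm)
  finally show "(f \<otimes>\<^bsub>T\<^esub> g) q = (g \<otimes>\<^bsub>T\<^esub> f) q" by (simp add: perfect_poly_ring_def)
qed

lemma shift_w: "g \<in> fin_supp R E \<Longrightarrow> (\<lambda>a. g (q - a)) \<in> E \<rightarrow> carrier (self_module R)"
  using fin_suppD(1)[of g R E] by auto

lemma T_mult_closed:
  assumes f: "f \<in> fin_supp R E" and g: "g \<in> fin_supp R E"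
  shows "f \<otimes>\<^bsub>T\<^esub> g \<in> fin_supp R E"
proof -
  note fD = fin_suppD[OF f] and gD = fin_suppD[OF g]
  let ?X = "(\<lambda>(a, b). a + b) ` ({a. f a \<noteq> \<zero>} \<times> {b. g b \<noteq> \<zero>})"
  have z: "(f \<otimes>\<^bsub>T\<^esub> g) q = \<zero>" if "q \<notin> ?X" for q
  proof -
    have "{(a, b). f a \<noteq> \<zero> \<and> g b \<noteq> \<zero> \<and> a + b = q} = {}" using that by force
    then have "(f \<otimes>\<^bsub>T\<^esub> g) q = (\<Oplus>ab\<in>{}. f (fst ab) \<otimes> g (snd ab))" by (simp only: perfect_poly_ring_def monoid.simps)
    then show ?thesis by simp
  qed
  have XE: "?X \<subseteq> E" using fD(4) gD(4) by (auto intro!: E_add)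
  show ?thesis
  proof (rule fin_suppI)
    show "(f \<otimes>\<^bsub>T\<^esub> g) q \<in> carrier R" for q
      using SM.lin_comb_closed[OF f shift_w[OF g, of q]] by (simp add: T_mult[OF f g])
    show "(f \<otimes>\<^bsub>T\<^esub> g) q = \<zero>" if "q \<notin> E" for q using that XE z by blast
    have "{q. (f \<otimes>\<^bsub>T\<^esub> g) q \<noteq> \<zero>} \<subseteq> ?X" using z by blast
    moreover have "finite ?X" using fD(3) gD(3) by simp
    ultimately show "finite {q. (f \<otimes>\<^bsub>T\<^esub> g) q \<noteq> \<zero>}" by (rule finite_subset)
  qed
qed

lemma T_mult_hom:
  assumes g: "g \<in> fin_supp R E"
  shows "(\<lambda>f. f \<otimes>\<^bsub>T\<^esub> g) \<in> module_hom R (free_module R E) (free_module R E)"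
proof -
  have "(\<lambda>q. f q \<oplus> f' q) \<otimes>\<^bsub>T\<^esub> g = (\<lambda>q. (f \<otimes>\<^bsub>T\<^esub> g) q \<oplus> (f' \<otimes>\<^bsub>T\<^esub> g) q)"
    if "f \<in> fin_supp R E" "f' \<in> fin_supp R E" for f f'
    using that by (intro ext) (simp add: T_mult[OF _ g] fin_supp_add[OF is_cring] SM.lin_comb_add[OF that shift_w[OF g]])
  moreover have "(\<lambda>q. r \<otimes> f q) \<otimes>\<^bsub>T\<^esub> g = (\<lambda>q. r \<otimes> (f \<otimes>\<^bsub>T\<^esub> g) q)"
    if "f \<in> fin_supp R E" "r \<in> carrier R" for f r
    using that by (intro ext) (simp add: T_mult[OF _ g] fin_supp_smult[OF is_cring] SM.lin_comb_smult[OF that(1) shift_w[OF g] that(2)])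
  ultimately show ?thesis using g by (auto simp: module_hom_def T_mult_closed)
qed

lemma delta_E: "a \<in> E \<Longrightarrow> delta R a \<in> fin_supp R E"
  by (rule delta_fin_supp[OF is_cring])

lemma T_delta_mult:
  assumes a: "a \<in> E" and g: "g \<in> fin_supp R E"
  shows "(delta R a \<otimes>\<^bsub>T\<^esub> g) q = g (q - a)"
  using SM.lin_comb_delta[OF a shift_w[OF g]] by (simp add: T_mult[OF delta_E[OF a] g])

text \<open>Both sides are linear in \<open>f\<close>, so \<open>f\<close> may be taken to be a
  monomial. Multiplying by a monomial is a shift of exponents, and shifts commute with
  convolution.\<close>

lemma T_mult_assoc:
  assumes f: "f \<in> fin_supp R E" and g: "g \<in> fin_supp R E" and h: "h \<in> fin_supp R E"
  shows "(f \<otimes>\<^bsub>T\<^esub> g) \<otimes>\<^bsub>T\<^esub> h = f \<otimes>\<^bsub>T\<^esub> (g \<otimes>\<^bsub>T\<^esub> h)"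
proof (rule module_hom_free_eq[OF is_cring free_module_module[OF is_cring] _ _ _ f])
  show "(\<lambda>f. (f \<otimes>\<^bsub>T\<^esub> g) \<otimes>\<^bsub>T\<^esub> h) \<in> module_hom R (free_module R E) (free_module R E)"
    by (rule module_hom_comp[OF T_mult_hom[OF g] T_mult_hom[OF h]])
  show "(\<lambda>f. f \<otimes>\<^bsub>T\<^esub> (g \<otimes>\<^bsub>T\<^esub> h)) \<in> module_hom R (free_module R E) (free_module R E)"
    by (rule T_mult_hom[OF T_mult_closed[OF g h]])
  fix a assume a: "a \<in> E"
  show "(delta R a \<otimes>\<^bsub>T\<^esub> g) \<otimes>\<^bsub>T\<^esub> h = delta R a \<otimes>\<^bsub>T\<^esub> (g \<otimes>\<^bsub>T\<^esub> h)"
  proof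
    fix q
    have shift: "(\<lambda>b. g (q - b - a)) = (\<lambda>b. g (q - a - b))" by (intro ext arg_cong[of _ _ g]) simp
    have "((delta R a \<otimes>\<^bsub>T\<^esub> g) \<otimes>\<^bsub>T\<^esub> h) q = (h \<otimes>\<^bsub>T\<^esub> (delta R a \<otimes>\<^bsub>T\<^esub> g)) q"
      by (simp add: T_mult_comm[OF T_mult_closed[OF delta_E[OF a] g] h])
    also have "\<dots> = (h \<otimes>\<^bsub>T\<^esub> g) (q - a)"
      by (simp add: T_mult[OF h T_mult_closed[OF delta_E[OF a] g]] T_mult[OF h g] T_delta_mult[OF a g] shift)
    also have "\<dots> = (delta R a \<otimes>\<^bsub>T\<^esub> (g \<otimes>\<^bsub>T\<^esub> h)) q"
      unfolding T_mult_comm[OF g h] by (rule T_delta_mult[OF a T_mult_closed[OF h g], symmetric])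
    finally show "((delta R a \<otimes>\<^bsub>T\<^esub> g) \<otimes>\<^bsub>T\<^esub> h) q = (delta R a \<otimes>\<^bsub>T\<^esub> (g \<otimes>\<^bsub>T\<^esub> h)) q" .
  qed
qed

lemma T_cring: "cring T"
proof (rule cringI)
  interpret F: rmodule R "free_module R E" by (intro rmoduleI free_module_module is_cring)
  show "abelian_group T"
  proof (rule abelian_groupI)
    fix f assume "f \<in> carrier T"
    then have f: "f \<in> carrier (free_module R E)" by (simp add: T_simps)
    show "\<exists>g\<in>carrier T. g \<oplus>\<^bsub>T\<^esub> f = \<zero>\<^bsub>T\<^esub>"
      using F.M.a_inv_closed[OF f] F.M.l_neg[OF f] by (auto simp: T_simps)
  qed (auto simp: T_simps fin_supp_add fin_supp_zero is_cring a_ac fin_suppD(1))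
  show "comm_monoid T"
  proof (rule comm_monoidI)
    fix f assume "f \<in> carrier T"
    then show "\<one>\<^bsub>T\<^esub> \<otimes>\<^bsub>T\<^esub> f = f" by (intro ext) (simp add: T_simps T_delta_mult[OF E_zero])
  next
    fix f g assume "f \<in> carrier T" "g \<in> carrier T"
    then show "f \<otimes>\<^bsub>T\<^esub> g = g \<otimes>\<^bsub>T\<^esub> f" unfolding T_simps by (rule T_mult_comm)
  qed (simp_all add: T_simps T_mult_closed T_mult_assoc delta_E E_zero)
  fix f g h assume "f \<in> carrier T" "g \<in> carrier T" "h \<in> carrier T"
  then show "(f \<oplus>\<^bsub>T\<^esub> g) \<otimes>\<^bsub>T\<^esub> h = f \<otimes>\<^bsub>T\<^esub> h \<oplus>\<^bsub>T\<^esub> g \<otimes>\<^bsub>T\<^esub> h"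
    using module_homD(2)[OF T_mult_hom[of h], of f g] by (simp add: T_simps)
qed

text \<open>Membership of the exponent is carried along because the induction step multiplies by the
  monomial already built.\<close>

lemma delta_pow:
  assumes a: "a \<in> E"
  shows "delta R a [^]\<^bsub>T\<^esub> (n::nat) = delta R (of_nat n * a) \<and> of_nat n * a \<in> E"
proof (induction n)
  case 0
  then show ?case using E_zero by (simp add: T_simps)
next
  case (Suc n)
  then have n: "of_nat n * a \<in> E" by blast
  have "delta R a [^]\<^bsub>T\<^esub> Suc n = delta R (of_nat n * a) \<otimes>\<^bsub>T\<^esub> delta R a" using Suc by simp
  also have "\<dots> = delta R (of_nat (Suc n) * a)"
    unfolding fun_eq_iff T_delta_mult[OF n delta_E[OF a]] by (auto simp: delta_def algebra_simps)
  finally show ?case using E_add[OF a n] by (simp add: algebra_simps)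
qed

end

text \<open>In the monoid algebra the monomial of exponent \<open>1/p^k\<close> has
  \<open>p^k\<close>-th power \<open>X\<close>, and \<open>X\<close> becomes \<open>p\<close> modulo
  the root ideal. A ring homomorphism through the quotient into the completion preserves this
  identity.\<close>

lemma Kcirc_facts:
  assumes "p > 0"
  shows "cring (Kcirc p)" "Kcirc_root p k \<in> carrier (Kcirc p)"
    "Kcirc_root p k [^]\<^bsub>Kcirc p\<^esub> (p ^ k) = nat_elt (Kcirc p) p"
proof -
  interpret Z: cring int_ring by (rule int_is_cring)
  have pI: "ideal (p_ideal p R) R" if "cring R" for R :: "'a ring"
  proof -
    interpret cring R by fact
    show ?thesis unfolding p_ideal_def by (intro cgenideal_ideal) simp
  qed
  interpret ZC: completion_setup int_ring "p_ideal p int_ring"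
    by (intro completion_setup.intro completion_setup_axioms.intro int_is_cring pI)
  have Zp: "cring (Zp p)" unfolding Zp_def by (rule ZC.C_cring)
  interpret T: perfect_poly "Zp p" p
    by (intro perfect_poly.intro perfect_poly_axioms.intro Zp assms)
  let ?T = "perfect_poly_ring p (Zp p)" and ?P = "p_root_ideal p (Zp p)" and ?B = "adjoin_p_roots p (Zp p)"
  interpret TR: cring ?T by (rule T.T_cring)
  define r where "r = delta (Zp p) (1 :: rat) \<ominus>\<^bsub>?T\<^esub> nat_elt ?T p"
  have d1: "delta (Zp p) 1 \<in> carrier ?T" by (simp add: T.T_simps T.delta_E T.E_one)
  have r: "r \<in> carrier ?T" unfolding r_def using d1 by simp
  have P_eq: "?P = PIdl\<^bsub>?T\<^esub> r" by (simp add: p_root_ideal_def Let_def r_def)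
  have P: "ideal ?P ?T" unfolding P_eq by (rule TR.cgenideal_ideal[OF r])
  have rP: "r \<in> ?P" unfolding P_eq by (rule TR.cgenideal_self[OF r])
  interpret P: ideal ?P ?T by fact
  have B: "cring ?B" unfolding adjoin_p_roots_def by (rule P.quotient_is_cring[OF T.T_cring])
  have h1: "(\<lambda>f. ?P +>\<^bsub>?T\<^esub> f) \<in> ring_hom ?T ?B" unfolding adjoin_p_roots_def by (rule P.rcos_ring_hom)
  interpret BC: completion_setup ?B "p_ideal p ?B"
    by (intro completion_setup.intro completion_setup_axioms.intro B pI)
  have K_eq: "Kcirc p = completion ?B (p_ideal p ?B)" by (simp add: Kcirc_def Let_def)
  show K: "cring (Kcirc p)" unfolding K_eq by (rule BC.C_cring)
  \<comment> \<open>The quotient by the root ideal followed by the map to the completion, so that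
    all computations take place with monomials.\<close>
  define h where "h f = to_completion ?B (p_ideal p ?B) (?P +>\<^bsub>?T\<^esub> f)" for f
  have h: "h \<in> ring_hom ?T (Kcirc p)"
    using ring_hom_trans[OF h1 BC.to_completion_hom] unfolding K_eq h_def by (simp add: comp_def)
  have root: "Kcirc_root p k = h (delta (Zp p) (1 / of_nat (p ^ k)))"
    by (simp add: Kcirc_root_def Let_def h_def)
  have dk: "delta (Zp p) (1 / of_nat (p ^ k)) \<in> carrier ?T" unfolding T.T_simps by (rule T.delta_E[OF T.E_root])
  show "Kcirc_root p k \<in> carrier (Kcirc p)" unfolding root by (rule ring_hom_closed[OF h dk])
  have "Kcirc_root p k [^]\<^bsub>Kcirc p\<^esub> (p ^ k) = h (delta (Zp p) (1 / of_nat (p ^ k)) [^]\<^bsub>?T\<^esub> (p ^ k))"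
    unfolding root by (rule ring_hom_nat_pow[OF T.T_cring K h dk, symmetric])
  also have "delta (Zp p) (1 / of_nat (p ^ k)) [^]\<^bsub>?T\<^esub> (p ^ k) = delta (Zp p) 1"
    using T.delta_pow[OF T.E_root, of k "p ^ k"] assms by simp
  also have "h (delta (Zp p) 1) = h (nat_elt ?T p)"
  proof -
    have "?P +>\<^bsub>?T\<^esub> delta (Zp p) 1 = ?P +>\<^bsub>?T\<^esub> nat_elt ?T p"
      using TR.quotient_eq_iff_same_a_r_cos[OF P d1, of "nat_elt ?T p"] rP by (simp add: r_def)
    then show ?thesis by (simp add: h_def)
  qed
  also have "\<dots> = nat_elt (Kcirc p) p" by (rule ring_hom_nat_elt[OF T.T_cring K h])
  finally show "Kcirc_root p k [^]\<^bsub>Kcirc p\<^esub> (p ^ k) = nat_elt (Kcirc p) p" .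
qed

section \<open>Test ideals\<close>

lemma compatible_roots_pow:
  assumes "cring S" "compatible_roots p S g \<sigma>"
  shows "\<sigma> e [^]\<^bsub>S\<^esub> (p ^ e) = g"
proof -
  interpret cring S by fact
  have \<sigma>: "\<sigma> e \<in> carrier S" "\<sigma> (Suc e) [^]\<^bsub>S\<^esub> p = \<sigma> e" "\<sigma> 0 = g" for e
    using assms(2) by (auto simp: compatible_roots_def)
  show ?thesis
  proof (induction e)
    case 0
    show ?case using \<sigma>(1)[of 0] \<sigma>(3) by simp
  next
    case (Suc e)
    have "\<sigma> (Suc e) [^]\<^bsub>S\<^esub> (p ^ Suc e) = (\<sigma> (Suc e) [^]\<^bsub>S\<^esub> p) [^]\<^bsub>S\<^esub> (p ^ e)"
      using \<sigma>(1) by (simp add: nat_pow_pow)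
    then show ?case using Suc \<sigma>(2) by simp
  qed
qed

lemma compatible_roots_nat_pow:
  assumes "cring S" "compatible_roots p S g \<sigma>"
  shows "compatible_roots p S (g [^]\<^bsub>S\<^esub> n) (\<lambda>e. \<sigma> e [^]\<^bsub>S\<^esub> (n::nat))"
proof -
  interpret cring S by fact
  have \<sigma>: "\<sigma> e \<in> carrier S" "\<sigma> (Suc e) [^]\<^bsub>S\<^esub> p = \<sigma> e" "\<sigma> 0 = g" for e
    using assms(2) by (auto simp: compatible_roots_def)
  have "(\<sigma> (Suc e) [^]\<^bsub>S\<^esub> n) [^]\<^bsub>S\<^esub> p = \<sigma> e [^]\<^bsub>S\<^esub> n" for e
  proof -
    have "(\<sigma> (Suc e) [^]\<^bsub>S\<^esub> n) [^]\<^bsub>S\<^esub> p = (\<sigma> (Suc e) [^]\<^bsub>S\<^esub> p) [^]\<^bsub>S\<^esub> n"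
      using \<sigma>(1) by (simp add: nat_pow_pow mult.commute)
    then show ?thesis using \<sigma>(2) by simp
  qed
  then show ?thesis using \<sigma> by (simp add: compatible_roots_def)
qed

context cech
begin

text \<open>For a class of the form \<open>m / y^k\<close> the annihilator is a colon ideal of
  \<open>frac_B_ideal\<close>, and the annihilator of a set is an intersection of these.\<close>

lemma annihilator_ideal:
  assumes N: "N \<subseteq> carrier H"
  shows "ideal (annihilator R H N) R"
proof -
  let ?Ann = "\<lambda>\<eta>. {a \<in> carrier R. a \<odot>\<^bsub>H\<^esub> \<eta> = \<zero>\<^bsub>H\<^esub>}"
  have "ideal (?Ann \<eta>) R" if \<eta>: "\<eta> \<in> carrier H" for \<eta>
  proof (rule H_carrierE[OF \<eta>])
    fix m k assume m: "m \<in> carrier R" "\<eta> = coh m k"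
    then have "?Ann \<eta> = {a \<in> carrier R. a \<otimes> m \<in> {m \<in> carrier R. fr m k \<in> B}}"
      by (simp add: coh_smult coh_eq_zero_iff frac_mem_B_iff cong: conj_cong)
    then show ?thesis using colon_ideal[OF frac_B_ideal m(1)] by simp
  qed
  \<comment> \<open>The whole ring is inserted so that the family is nonempty even if
    \<open>N\<close> is empty.\<close>
  then have "ideal (\<Inter>(insert (carrier R) (?Ann ` N))) R"
    using N oneideal by (intro i_Intersect) auto
  also have "\<Inter>(insert (carrier R) (?Ann ` N)) = annihilator R H N"
    by (auto simp: annihilator_def)
  finally show ?thesis .
qed

end

section \<open>Membership in the test ideals\<close>

locale perfectoid_test_ideals = cech_base_change A S \<phi> d x
  for A :: "'a ring" (structure) and S :: "'s ring" (structure) and \<phi> and d x +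
  fixes p :: nat and \<kappa> :: "Kcirc_elt \<Rightarrow> 's" and \<mm> :: "'a set"
  assumes p_ge_2: "p \<ge> 2"
    and \<kappa>_carrier: "\<kappa> (Kcirc_root p k) \<in> carrier S"
    and \<kappa>_pow: "\<kappa> (Kcirc_root p k) [^]\<^bsub>S\<^esub> (p ^ k) = nat_elt S p"
    and torsion_free: "s \<in> carrier S \<Longrightarrow> nat_elt S p \<otimes>\<^bsub>S\<^esub> s = \<zero>\<^bsub>S\<^esub> \<Longrightarrow> s = \<zero>\<^bsub>S\<^esub>"
    and local: "local_ring A \<mm>" and noetherian: "noetherian_ring A"
    and complete: "adically_complete A \<mm>" and char_zero: "has_char A 0"
    and flat: "almost_flat p A S \<kappa> \<phi>" and faithful: "almost_faithful p A S \<kappa> \<phi>"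
begin

lemmas infinite_A = has_char_zero_infinite[OF A.is_cring char_zero]
lemmas one_neq_zero_A = has_char_zero_one_neq_zero[OF A.is_cring char_zero]

lemma \<mm>_ideal: "ideal \<mm> A"
  using local by (auto simp: local_ring_def intro: maximalideal.axioms)

text \<open>Injectivity of \<phi> is the case of the zero ideal in almost faithful
  contraction.\<close>

lemma \<phi>_eq_zero:
  assumes "a \<in> carrier A" "\<phi> a = \<zero>\<^bsub>S\<^esub>"
  shows "a = \<zero>"
proof -
  have "\<phi> \<zero> \<in> Idl\<^bsub>S\<^esub> (\<phi> ` {\<zero>})" by (rule ideal_extension_mem[OF A.zeroideal]) simp
  then have "\<phi> a \<in> Idl\<^bsub>S\<^esub> (\<phi> ` {\<zero>})" using assms(2) by simp
  then have "a \<in> {\<zero>}"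
    by (rule almost_faithful_contraction[OF flat faithful \<kappa>_carrier infinite_A one_neq_zero_A A.zeroideal assms(1)])
  then show ?thesis by simp
qed

lemma exists_exponent:
  assumes f: "f \<in> carrier A" "f \<noteq> \<zero>"
  obtains e where "e > 0" "nat_elt A p \<otimes> f \<notin> ideal_pow A \<mm> (p ^ e)"
proof -
  have pf: "nat_elt A p \<otimes> f \<in> carrier A" using f by simp
  have "nat_elt A p \<otimes> f \<noteq> \<zero>"
  proof
    assume "nat_elt A p \<otimes> f = \<zero>"
    then have "\<phi> (nat_elt A p \<otimes> f) = \<zero>\<^bsub>S\<^esub>" by simp
    then have "nat_elt S p \<otimes>\<^bsub>S\<^esub> \<phi> f = \<zero>\<^bsub>S\<^esub>"
      using f(1) ring_hom_nat_elt[OF A.is_cring S.is_cring \<phi>_hom] by simp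
    then have "\<phi> f = \<zero>\<^bsub>S\<^esub>" by (rule torsion_free[OF \<phi>.hom_closed[OF f(1)]])
    with \<phi>_eq_zero f show False by blast
  qed
  then obtain n where n: "nat_elt A p \<otimes> f \<notin> ideal_pow A \<mm> n"
    using adically_complete_separated[OF A.is_cring \<mm>_ideal complete pf] by metis
  have "n < p ^ n" using p_ge_2 by (intro power_gt_expt) auto
  \<comment> \<open>The successor makes the exponent positive, as the test ideals quantify over
    \<open>e > 0\<close>.\<close>
  also have "\<dots> \<le> p ^ Suc n" using p_ge_2 by (intro power_increasing) auto
  finally have "ideal_pow A \<mm> (p ^ Suc n) \<subseteq> ideal_pow A \<mm> n"
    by (intro ideal_pow_antimono[OF A.is_cring \<mm>_ideal]) simp
  with n show ?thesis by (intro that[of "Suc n"]) auto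
qed

lemma kills_if_almost_kills:
  assumes f: "f \<in> carrier A" "nat_elt A p \<otimes> f \<notin> ideal_pow A \<mm> (p ^ e)"
    and g: "g \<in> carrier S" "g [^]\<^bsub>S\<^esub> (p ^ e) = \<phi> f"
    and \<eta>: "\<eta> \<in> carrier H" and kills: "almost_kills p A S \<kappa> \<phi> d x (\<phi> f \<otimes>\<^bsub>S\<^esub> g) \<eta>"
  shows "f \<odot>\<^bsub>H\<^esub> \<eta> = \<zero>\<^bsub>H\<^esub>"
proof (rule H_carrierE[OF \<eta>])
  fix m k assume m: "m \<in> carrier A" "\<eta> = coh m k"
  \<comment> \<open>Almost vanishing holds for every root of \<open>p\<close>; index
    \<open>e + 1\<close> is small enough for two copies to be affordable after raising to the power
    \<open>p^e\<close>.\<close>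
  let ?s = "\<kappa> (Kcirc_root p (Suc e))"
  have s: "?s \<in> carrier S" by (rule \<kappa>_carrier)
  have "\<phi> f \<otimes>\<^bsub>S\<^esub> g \<in> carrier S" using f g by simp
  from kills[unfolded m(2) almost_kills_coh_iff[where \<kappa> = \<kappa> and p = p, OF m(1) this \<kappa>_carrier]]
  obtain l :: nat where l: "S.y [^]\<^bsub>S\<^esub> l \<otimes>\<^bsub>S\<^esub> (?s \<otimes>\<^bsub>S\<^esub> ((\<phi> f \<otimes>\<^bsub>S\<^esub> g) \<otimes>\<^bsub>S\<^esub> \<phi> m)) \<in> S.pow_ideal (k + l)" by blast
  \<comment> \<open>The full factor \<open>f\<close> is joined to the numerator inside
    \<open>A\<close>, so only the fractional factor \<open>g\<close> remains in \<open>S\<close>.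
    Membership of this \<open>u\<close> in the ideal is precisely the vanishing of \<open>f\<close>
    times the class.\<close>
  define u where "u = y [^] l \<otimes> (f \<otimes> m)"
  have u: "u \<in> carrier A" unfolding u_def using f m by simp
  have "\<phi> u = S.y [^]\<^bsub>S\<^esub> l \<otimes>\<^bsub>S\<^esub> (\<phi> f \<otimes>\<^bsub>S\<^esub> \<phi> m)"
    unfolding u_def using f(1) m(1) by (simp add: \<phi>_pow \<phi>_y)
  then have "?s \<otimes>\<^bsub>S\<^esub> g \<otimes>\<^bsub>S\<^esub> \<phi> u = S.y [^]\<^bsub>S\<^esub> l \<otimes>\<^bsub>S\<^esub> (?s \<otimes>\<^bsub>S\<^esub> ((\<phi> f \<otimes>\<^bsub>S\<^esub> g) \<otimes>\<^bsub>S\<^esub> \<phi> m))"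
    using s g(1) f(1) m(1) by (simp add: S.m_ac)
  then have "?s \<otimes>\<^bsub>S\<^esub> g \<otimes>\<^bsub>S\<^esub> \<phi> u \<in> Idl\<^bsub>S\<^esub> (\<phi> ` pow_ideal (k + l))"
    using l S_pow_ideal_subset by auto
  then have "u \<in> pow_ideal (k + l)"
    by (rule almost_perfect_root_colon[OF flat faithful \<kappa>_carrier \<kappa>_pow p_ge_2 infinite_A one_neq_zero_A local noetherian
          f g pow_ideal_ideal u])
  then show ?thesis using m f(1) by (auto simp: coh_smult coh_eq_zero_iff u_def)
qed

lemma H_base_eq: "H_base A d x = H"
  by (simp add: H_base_def)

text \<open>The order of quantifiers is the point: \<open>e\<close> depends on \<open>f\<close> and
  serves all classes and all roots at once, since the exponent of the test ideal has to be fixed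
  before its classes are.\<close>

lemma exists_uniform_exponent:
  assumes f: "f \<in> carrier A"
  obtains e where "e > 0"
    "\<And>g \<eta>. g \<in> carrier S \<Longrightarrow> g [^]\<^bsub>S\<^esub> (p ^ e) = \<phi> f \<Longrightarrow> \<eta> \<in> carrier H \<Longrightarrow>
      almost_kills p A S \<kappa> \<phi> d x (\<phi> f \<otimes>\<^bsub>S\<^esub> g) \<eta> \<Longrightarrow> f \<odot>\<^bsub>H\<^esub> \<eta> = \<zero>\<^bsub>H\<^esub>"
proof (cases "f = \<zero>")
  case True
  \<comment> \<open>Separatedness gives no exponent when \<open>f\<close> is zero; any
    \<open>e\<close> works then, as zero kills every class.\<close>
  have "\<zero> \<in> annihilator A H (carrier H)"
    by (rule additive_subgroup.zero_closed[OF ideal.axioms(1)[OF annihilator_ideal[OF subset_refl]]])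
  then show ?thesis using True by (intro that[of 1]) (auto simp: annihilator_def)
next
  case False
  with f obtain e where "e > 0" "nat_elt A p \<otimes> f \<notin> ideal_pow A \<mm> (p ^ e)" by (rule exists_exponent)
  then show ?thesis using kills_if_almost_kills[OF f] by (intro that[of e]) auto
qed

text \<open>Repetitions are allowed in the products of chosen roots, so the single system of roots
  of \<open>f i\<close> already supplies a product with exponent \<open>1 + 1/p^e\<close>.\<close>

lemma mem_tau_sharp_br:
  assumes f: "f i \<in> carrier A" and i: "i < n" and r: "compatible_roots p S (\<phi> (f i)) (r i)"
  obtains \<epsilon> where "\<epsilon> > 0" "f i \<in> tau_sharp_br p A S \<kappa> \<phi> d x n r (1 + \<epsilon>)"
proof -
  obtain e where e: "e > 0"
    and kill: "\<And>g \<eta>. g \<in> carrier S \<Longrightarrow> g [^]\<^bsub>S\<^esub> (p ^ e) = \<phi> (f i) \<Longrightarrow> \<eta> \<in> carrier H \<Longrightarrow>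
      almost_kills p A S \<kappa> \<phi> d x (\<phi> (f i) \<otimes>\<^bsub>S\<^esub> g) \<eta> \<Longrightarrow> f i \<odot>\<^bsub>H\<^esub> \<eta> = \<zero>\<^bsub>H\<^esub>"
    by (rule exists_uniform_exponent[OF f], rule that)
  have g: "r i e \<in> carrier S" using r by (simp add: compatible_roots_def)
  have gp: "r i e [^]\<^bsub>S\<^esub> (p ^ e) = \<phi> (f i)" by (rule compatible_roots_pow[OF S.is_cring r])
  \<comment> \<open>\<open>p^e + 1\<close> equal factors: the first \<open>p^e\<close> of them
    recombine to \<open>f i\<close>. This number is exactly the bound \<open>t p^e\<close> for
    \<open>t = 1 + 1/p^e\<close>.\<close>
  have prod: "(\<Otimes>\<^bsub>S\<^esub>j\<in>{..<Suc (p ^ e)}. r i e) = \<phi> (f i) \<otimes>\<^bsub>S\<^esub> r i e"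
    using S.finprod_const[OF g, of "{..<Suc (p ^ e)}"] gp by simp
  have pe: "real p ^ e > 0" using p_ge_2 by simp
  have bound: "real (Suc (p ^ e)) \<ge> (1 + 1 / real p ^ e) * real p ^ e"
    using pe by (simp add: distrib_right)
  have "f i \<odot>\<^bsub>H\<^esub> \<eta> = \<zero>\<^bsub>H\<^esub>" if \<eta>: "\<eta> \<in> zero_diamond_br p A S \<kappa> \<phi> d x n r (1 + 1 / real p ^ e)" for \<eta>
  proof (rule kill[OF g gp])
    show "\<eta> \<in> carrier H" using \<eta> by (simp add: zero_diamond_br_def H_base_eq)
    have "almost_kills p A S \<kappa> \<phi> d x (\<Otimes>\<^bsub>S\<^esub>j\<in>{..<Suc (p ^ e)}. r ((\<lambda>_. i) j) e) \<eta>"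
    proof -
      have "\<forall>e'>0. \<forall>a. real a \<ge> (1 + 1 / real p ^ e) * real p ^ e' \<longrightarrow> (\<forall>j \<in> {..<a} \<rightarrow> {..<n}.
          almost_kills p A S \<kappa> \<phi> d x (\<Otimes>\<^bsub>S\<^esub>i\<in>{..<a}. r (j i) e') \<eta>)"
        using \<eta> unfolding zero_diamond_br_def by simp
      from this[rule_format, OF e bound, of "\<lambda>_. i"] i show ?thesis by simp
    qed
    then show "almost_kills p A S \<kappa> \<phi> d x (\<phi> (f i) \<otimes>\<^bsub>S\<^esub> r i e) \<eta>" by (simp only: prod)
  qed
  then have "f i \<in> tau_sharp_br p A S \<kappa> \<phi> d x n r (1 + 1 / real p ^ e)"
    using f by (simp add: tau_sharp_br_def annihilator_def H_base_eq)
  with pe show ?thesis by (intro that[of "1 / real p ^ e"]) auto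
qed

lemma tau_sharp_br_ideal: "ideal (tau_sharp_br p A S \<kappa> \<phi> d x n r t) A"
  unfolding tau_sharp_br_def H_base_eq
  by (rule annihilator_ideal) (auto simp: zero_diamond_br_def H_base_eq)

text \<open>A larger exponent imposes vanishing on fewer products, so more classes qualify and fewer
  scalars kill all of them.\<close>

lemma tau_sharp_br_antimono:
  assumes "t \<le> t'"
  shows "tau_sharp_br p A S \<kappa> \<phi> d x n r t' \<subseteq> tau_sharp_br p A S \<kappa> \<phi> d x n r t"
proof -
  have "t' * real p ^ e \<le> real a \<Longrightarrow> t * real p ^ e \<le> real a" for e a
    using mult_right_mono[OF assms, of "real p ^ e"] by simp
  then have "zero_diamond_br p A S \<kappa> \<phi> d x n r t \<subseteq> zero_diamond_br p A S \<kappa> \<phi> d x n r t'"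
    unfolding zero_diamond_br_def by blast
  then show ?thesis by (auto simp: tau_sharp_br_def annihilator_def)
qed

text \<open>The ideals grow as \<epsilon> decreases. In a noetherian ring such a chain attains its
  union at some \<open>\<epsilon>0\<close>, and it is constant from there down to zero; this
  constant value is \<open>tau_br\<close>.\<close>

lemma tau_br_eq:
  obtains \<epsilon>0 where "\<epsilon>0 > 0" "tau_br p A S \<kappa> \<phi> d x n r t = tau_sharp_br p A S \<kappa> \<phi> d x n r (t + \<epsilon>0)"
    "\<And>\<epsilon>. \<epsilon> > 0 \<Longrightarrow> tau_sharp_br p A S \<kappa> \<phi> d x n r (t + \<epsilon>) \<subseteq> tau_br p A S \<kappa> \<phi> d x n r t"
proof -
  interpret N: noetherian_ring A by (rule noetherian)
  define \<tau> where "\<tau> \<epsilon> = tau_sharp_br p A S \<kappa> \<phi> d x n r (t + \<epsilon>)" for \<epsilon>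
  have mono: "\<tau> \<epsilon>' \<subseteq> \<tau> \<epsilon>" if "\<epsilon> \<le> \<epsilon>'" for \<epsilon> \<epsilon>' unfolding \<tau>_def using that by (intro tau_sharp_br_antimono) simp
  have "\<Union>(\<tau> ` {0<..}) \<in> \<tau> ` {0<..}"
  proof (rule N.ideal_chain_is_trivial)
    show "\<tau> ` {0<..} \<noteq> {}" using gt_ex[of "0::real"] by auto
    show "subset.chain {I. ideal I A} (\<tau> ` {0<..})"
      unfolding pred_on.chain_def
    proof (intro conjI ballI)
      show "\<tau> ` {0<..} \<subseteq> {I. ideal I A}" unfolding \<tau>_def using tau_sharp_br_ideal by auto
      show "(\<subset>)\<^sup>=\<^sup>= X Y \<or> (\<subset>)\<^sup>=\<^sup>= Y X" if XY: "X \<in> \<tau> ` {0<..}" "Y \<in> \<tau> ` {0<..}" for X Y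
      proof -
        obtain a b where "X = \<tau> a" "Y = \<tau> b" using XY by blast
        then have "X \<subseteq> Y \<or> Y \<subseteq> X" using mono[of a b] mono[of b a] linear[of a b] by blast
        then show ?thesis by auto
      qed
    qed
  qed
  then obtain \<epsilon>0 where \<epsilon>0: "\<epsilon>0 > 0" "\<Union>(\<tau> ` {0<..}) = \<tau> \<epsilon>0" by auto
  have sub: "\<tau> \<epsilon> \<subseteq> \<tau> \<epsilon>0" if "\<epsilon> > 0" for \<epsilon> using that \<epsilon>0(2) by blast
  have ev: "eventually (\<lambda>\<epsilon>. \<tau> \<epsilon> = \<tau> \<epsilon>0) (at_right 0)"
  proof (rule eventually_at_rightI[OF _ \<epsilon>0(1)])
    fix \<epsilon> assume "\<epsilon> \<in> {0<..<\<epsilon>0}"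
    then show "\<tau> \<epsilon> = \<tau> \<epsilon>0" using sub[of \<epsilon>] mono[of \<epsilon> \<epsilon>0] by auto
  qed
  have "tau_br p A S \<kappa> \<phi> d x n r t = \<tau> \<epsilon>0"
    unfolding tau_br_def \<tau>_def[symmetric]
  proof (rule the_equality)
    show "eventually (\<lambda>\<epsilon>. \<tau> \<epsilon> = \<tau> \<epsilon>0) (at_right 0)" by (rule ev)
    fix I assume "eventually (\<lambda>\<epsilon>. \<tau> \<epsilon> = I) (at_right 0)"
    with ev have "eventually (\<lambda>\<epsilon>. I = \<tau> \<epsilon>0) (at_right (0::real))" by eventually_elim simp
    then show "I = \<tau> \<epsilon>0" by simp
  qed
  with \<epsilon>0(1) sub show ?thesis by (intro that[of \<epsilon>0]) (auto simp: \<tau>_def)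
qed

text \<open>Each generator comes with its own \<epsilon>. All of them are absorbed by
  \<open>tau_br\<close>, which is an ideal because it equals one of the
  \<open>tau_sharp_br\<close>.\<close>

lemma Idl_subset_tau_br:
  assumes f: "f \<in> {..<n} \<rightarrow> carrier A" and r: "\<And>i. i < n \<Longrightarrow> compatible_roots p S (\<phi> (f i)) (r i)"
  shows "Idl (f ` {..<n}) \<subseteq> tau_br p A S \<kappa> \<phi> d x n r 1"
proof -
  obtain \<epsilon>0 where eq: "tau_br p A S \<kappa> \<phi> d x n r 1 = tau_sharp_br p A S \<kappa> \<phi> d x n r (1 + \<epsilon>0)"
    and sub: "\<And>\<epsilon>. \<epsilon> > 0 \<Longrightarrow> tau_sharp_br p A S \<kappa> \<phi> d x n r (1 + \<epsilon>) \<subseteq> tau_br p A S \<kappa> \<phi> d x n r 1"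
    by (rule tau_br_eq[where t = 1 and n = n and r = r], rule that)
  have "f i \<in> tau_br p A S \<kappa> \<phi> d x n r 1" if i: "i < n" for i
  proof -
    have fi: "f i \<in> carrier A" using f i by auto
    obtain \<epsilon> where "\<epsilon> > 0" "f i \<in> tau_sharp_br p A S \<kappa> \<phi> d x n r (1 + \<epsilon>)"
      by (rule mem_tau_sharp_br[of f i n r, OF fi i r[OF i]])
    then show ?thesis using sub by blast
  qed
  then show ?thesis
    using tau_sharp_br_ideal by (intro A.genideal_minimal) (auto simp: eq)
qed

text \<open>Here the test elements come from powers of the ideal, so the element to test is
  \<open>f^(p^e + 1)\<close>. The powers of the roots of \<open>f\<close> are a compatible system
  for it, and their term of index \<open>e\<close> is \<open>f\<close> times the
  \<open>p^e\<close>-th root of \<open>f\<close>.\<close>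

lemma ideal_subset_tau:
  assumes a: "ideal \<aa> A" and roots: "\<And>g. g \<in> carrier A \<Longrightarrow> \<exists>\<sigma>. compatible_roots p S (\<phi> g) \<sigma>"
  shows "\<aa> \<subseteq> tau p A S \<kappa> \<phi> d x \<aa> 1"
proof
  fix f assume fa: "f \<in> \<aa>"
  have f: "f \<in> carrier A" by (rule ideal.Icarr[OF a fa])
  obtain e where e: "e > 0"
    and kill: "\<And>g \<eta>. g \<in> carrier S \<Longrightarrow> g [^]\<^bsub>S\<^esub> (p ^ e) = \<phi> f \<Longrightarrow> \<eta> \<in> carrier H \<Longrightarrow>
      almost_kills p A S \<kappa> \<phi> d x (\<phi> f \<otimes>\<^bsub>S\<^esub> g) \<eta> \<Longrightarrow> f \<odot>\<^bsub>H\<^esub> \<eta> = \<zero>\<^bsub>H\<^esub>"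
    by (rule exists_uniform_exponent[OF f], rule that)
  obtain \<sigma> where \<sigma>: "compatible_roots p S (\<phi> f) \<sigma>" using roots[OF f] by blast
  have g: "\<sigma> e \<in> carrier S" using \<sigma> by (simp add: compatible_roots_def)
  have gp: "\<sigma> e [^]\<^bsub>S\<^esub> (p ^ e) = \<phi> f" by (rule compatible_roots_pow[OF S.is_cring \<sigma>])
  have pe: "real p ^ e > 0" using p_ge_2 by simp
  define t where "t = 1 + 1 / real p ^ e"
  \<comment> \<open>\<open>t\<close> is chosen to make this product an integer, so rounding up costs
    nothing.\<close>
  have "t * real p ^ e = of_int (int (Suc (p ^ e)))" using pe by (simp add: t_def distrib_right)
  then have ceil: "nat \<lceil>t * real p ^ e\<rceil> = Suc (p ^ e)" by (simp only: ceiling_of_int nat_int)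
  have "f \<odot>\<^bsub>H\<^esub> \<eta> = \<zero>\<^bsub>H\<^esub>" if \<eta>: "\<eta> \<in> zero_diamond p A S \<kappa> \<phi> d x \<aa> t" for \<eta>
  proof (rule kill[OF g gp])
    show "\<eta> \<in> carrier H" using \<eta> by (simp add: zero_diamond_def H_base_eq)
    have "f [^] Suc (p ^ e) \<in> ideal_pow A \<aa> (nat \<lceil>t * real p ^ e\<rceil>)"
      unfolding ceil by (rule pow_mem_ideal_pow[OF A.is_cring a fa])
    moreover have "compatible_roots p S (\<phi> (f [^] Suc (p ^ e))) (\<lambda>e'. \<sigma> e' [^]\<^bsub>S\<^esub> Suc (p ^ e))"
      unfolding \<phi>_pow[OF f] by (rule compatible_roots_nat_pow[OF S.is_cring \<sigma>])
    ultimately have "almost_kills p A S \<kappa> \<phi> d x (\<sigma> e [^]\<^bsub>S\<^esub> Suc (p ^ e)) \<eta>"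
      using \<eta> e unfolding zero_diamond_def by blast
    then show "almost_kills p A S \<kappa> \<phi> d x (\<phi> f \<otimes>\<^bsub>S\<^esub> \<sigma> e) \<eta>" by (simp add: gp)
  qed
  then have "f \<in> tau_sharp p A S \<kappa> \<phi> d x \<aa> t"
    using f by (simp add: tau_sharp_def annihilator_def H_base_eq)
  moreover have "t > 1" using pe by (simp add: t_def)
  moreover have "(\<Union>t'\<in>{1<..}. tau_sharp p A S \<kappa> \<phi> d x \<aa> t') \<subseteq> carrier A"
    by (auto simp: tau_sharp_def annihilator_def)
  ultimately show "f \<in> tau p A S \<kappa> \<phi> d x \<aa> 1"
    unfolding tau_def by (intro set_mp[OF A.genideal_self]) auto
qed

end

theorem proposition3p9:
  fixes p d :: nat
    and A :: "'a ring" and \<mm> :: "'a set" and x :: "nat \<Rightarrow> 'a"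
    and S :: "'s ring" and \<kappa> :: "Kcirc_elt \<Rightarrow> 's" and \<phi> :: "'a \<Rightarrow> 's"
  assumes "Factorial_Ring.prime p"
    and "complete_regular_local_ring A \<mm> d"
    and "mixed_char p A \<mm>"
    and "x \<in> {..<d} \<rightarrow> carrier A"
    and "\<mm> = Idl\<^bsub>A\<^esub> (x ` {..<d})"
    and "integral_perfectoid p S \<kappa>"
    and "\<phi> \<in> ring_hom A S"
    and "\<forall>g \<in> carrier A. \<exists>\<sigma>. compatible_roots p S (\<phi> g) \<sigma>"
    and "almost_flat p A S \<kappa> \<phi>"
    and "almost_faithful p A S \<kappa> \<phi>"
  shows "(\<forall>(n::nat) f r.
            f \<in> {..<n} \<rightarrow> carrier A \<and> (\<forall>i<n. compatible_roots p S (\<phi> (f i)) (r i)) \<longrightarrow>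
            Idl\<^bsub>A\<^esub> (f ` {..<n}) \<subseteq> tau_br p A S \<kappa> \<phi> d x n r 1) \<and>
         (\<forall>\<aa>. ideal \<aa> A \<longrightarrow> \<aa> \<subseteq> tau p A S \<kappa> \<phi> d x \<aa> 1)"
proof -
  have p2: "p \<ge> 2" using assms(1) by (rule prime_ge_2_nat)
  have loc: "local_ring A \<mm>" and noeth: "noetherian_ring A" and compl: "adically_complete A \<mm>"
    using assms(2) by (auto simp: complete_regular_local_ring_def)
  have A: "cring A" using loc by (simp add: local_ring_def)
  have S: "cring S" and \<kappa>: "\<kappa> \<in> ring_hom (Kcirc p) S"
    and tf: "\<forall>s\<in>carrier S. nat_elt S p \<otimes>\<^bsub>S\<^esub> s = \<zero>\<^bsub>S\<^esub> \<longrightarrow> s = \<zero>\<^bsub>S\<^esub>"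
    using assms(6) by (auto simp: integral_perfectoid_def Kcirc_algebra_def)
  have "p > 0" using p2 by simp
  note K = Kcirc_facts[OF this]
  have \<kappa>c: "\<kappa> (Kcirc_root p k) \<in> carrier S" for k
    by (rule ring_hom_closed[OF \<kappa> K(2)])
  \<comment> \<open>The identity is known in the base ring; \<kappa> preserves both the power and
    the image of the integer \<open>p\<close>.\<close>
  have \<kappa>p: "\<kappa> (Kcirc_root p k) [^]\<^bsub>S\<^esub> (p ^ k) = nat_elt S p" for k
    unfolding ring_hom_nat_pow[OF K(1) S \<kappa> K(2), symmetric] K(3) by (rule ring_hom_nat_elt[OF K(1) S \<kappa>])
  interpret perfectoid_test_ideals A S \<phi> d x p \<kappa> \<mm>
  proof (intro perfectoid_test_ideals.intro perfectoid_test_ideals_axioms.intro cech_base_change.intro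
      base_change.intro base_change_axioms.intro cech.intro cech_axioms.intro)
    show "has_char A 0" using assms(3) by (simp add: mixed_char_def)
    show "s = \<zero>\<^bsub>S\<^esub>" if "s \<in> carrier S" "nat_elt S p \<otimes>\<^bsub>S\<^esub> s = \<zero>\<^bsub>S\<^esub>" for s
      using tf that by blast
  qed (fact A S assms(7) assms(4) p2 \<kappa>c \<kappa>p loc noeth compl assms(9) assms(10))+
  show ?thesis
    using Idl_subset_tau_br ideal_subset_tau assms(8) by blast
qed

end
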